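(* Let $p$ be a prime, let $G$ be a finite $p$-group of nilpotency class at least $3$, and let $K$ be a central subgroup of $G$ such that the restriction homomorphism from $M(G)$ to $M(K)$ is zero. Assume that $|G/K| = p^m$ and $|\gamma_2(G)K/K| = p^r$. Then \[|\gamma_2(G)||M(G)| \leq \big|(G/K)^{ab} \otimes K\big|\,p^{\frac{1}{2}d(G/K)(m+r-2)+1}.\] In particular, \[|\gamma_2(G)||M(G)| \leq \big|(G/K)^{ab} \otimes K\big|\,p^{\frac{1}{2}(m-r)(m+r-2)+1}.\]
   Context: $\gamma_2(G)=[G,G]$ is the commutator subgroup of $G$; $H^{ab}=H/\gamma_2(H)$ for a group $H$; $d(H)$ is the minimal number of generators of $H$; $\otimes$ is the tensor product of abelian groups over $\mathbb{Z}$. $M(G)$ is the Schur multiplier of $G$, i.e. $M(G)=H^2(G,\mathbb{C}^{\times})$ with trivial action, and the restriction homomorphism $M(G)\to M(K)$ is the usual restriction map $H^2(G,\mathbb{C}^{\times})\to H^2(K,\mathbb{C}^{\times})$ in group cohomology. The exponents of $p$ are rational numbers, so the inequalities are between real numbers. *)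

theory Defs
  imports Complex_Main "HOL-Algebra.Algebra"
begin

subsection \<open>Lower central series and nilpotency class\<close>

definition commutator_subgroup :: "('a, 'b) monoid_scheme \<Rightarrow> 'a set \<Rightarrow> 'a set \<Rightarrow> 'a set" where
  "commutator_subgroup G H L =
     generate G (\<Union>h\<in>H. \<Union>l\<in>L. {h \<otimes>\<^bsub>G\<^esub> l \<otimes>\<^bsub>G\<^esub> inv\<^bsub>G\<^esub> h \<otimes>\<^bsub>G\<^esub> inv\<^bsub>G\<^esub> l})"

text \<open>The index is shifted by one: \<open>lower_central G n\<close> is the term usually written
  \<open>\<gamma>\<close> with subscript \<open>n + 1\<close>, so that the class is the least \<open>n\<close> with a trivial term.\<close>

primrec lower_central :: "('a, 'b) monoid_scheme \<Rightarrow> nat \<Rightarrow> 'a set" where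
  "lower_central G 0 = carrier G"
| "lower_central G (Suc n) = commutator_subgroup G (lower_central G n) (carrier G)"

text \<open>Only meaningful for nilpotent groups, e.g. finite \<open>p\<close>-groups.\<close>

definition nilpotency_class :: "('a, 'b) monoid_scheme \<Rightarrow> nat" where
  "nilpotency_class G = (LEAST n. lower_central G n = {\<one>\<^bsub>G\<^esub>})"

lemma lower_central_1: "lower_central G (Suc 0) = derived G (carrier G)"
  by (simp add: commutator_subgroup_def derived_def)

subsection \<open>Abelianization and minimal number of generators\<close>

definition abelianization :: "('a, 'b) monoid_scheme \<Rightarrow> 'a set monoid" where
  "abelianization G = G Mod derived G (carrier G)"

text \<open>Only meaningful for finitely generated groups.\<close>

definition min_generators :: "('a, 'b) monoid_scheme \<Rightarrow> nat" where
  "min_generators G =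
     (LEAST n. \<exists>S. S \<subseteq> carrier G \<and> finite S \<and> card S = n \<and> generate G S = carrier G)"

lemma (in group) min_generators_witness:
  assumes "finite (carrier G)"
  shows "\<exists>S. S \<subseteq> carrier G \<and> finite S \<and> card S = min_generators G \<and> generate G S = carrier G"
proof -
  have "generate G (carrier G) = carrier G"
    using generate_in_carrier[of "carrier G"] by (auto intro: generate.incl)
  with assms have "\<exists>n S. S \<subseteq> carrier G \<and> finite S \<and> card S = n \<and> generate G S = carrier G"
    by blast
  then show ?thesis
    unfolding min_generators_def by (rule LeastI_ex)
qed

subsection \<open>Tensor product of abelian groups over the integers\<close>

definition tensor_relations ::
    "('a, 'c) monoid_scheme \<Rightarrow> ('b, 'd) monoid_scheme \<Rightarrow> ('a \<times> 'b \<Rightarrow>\<^sub>0 int) set" where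
  "tensor_relations A B =
     {frag_of (a \<otimes>\<^bsub>A\<^esub> a', b) - frag_of (a, b) - frag_of (a', b) | a a' b.
        a \<in> carrier A \<and> a' \<in> carrier A \<and> b \<in> carrier B} \<union>
     {frag_of (a, b \<otimes>\<^bsub>B\<^esub> b') - frag_of (a, b) - frag_of (a, b') | a b b'.
        a \<in> carrier A \<and> b \<in> carrier B \<and> b' \<in> carrier B}"

definition tensor_product ::
    "('a, 'c) monoid_scheme \<Rightarrow> ('b, 'd) monoid_scheme \<Rightarrow> ('a \<times> 'b \<Rightarrow>\<^sub>0 int) set monoid" where
  "tensor_product A B =
     (let F = free_Abelian_group (carrier A \<times> carrier B)
      in F Mod generate F (tensor_relations A B))"

lemma tensor_relations_carrier:
  assumes "group A" "group B"
  shows "tensor_relations A B \<subseteq> carrier (free_Abelian_group (carrier A \<times> carrier B))"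
proof -
  interpret A: group A by fact
  interpret B: group B by fact
  have diff: "x - y - z \<in> carrier (free_Abelian_group S)"
    if "x \<in> carrier (free_Abelian_group S)" "y \<in> carrier (free_Abelian_group S)"
       "z \<in> carrier (free_Abelian_group S)" for x y z :: "'x \<Rightarrow>\<^sub>0 int" and S
  proof -
    have "Poly_Mapping.keys (x - y - z) \<subseteq> Poly_Mapping.keys x \<union> Poly_Mapping.keys y \<union> Poly_Mapping.keys z"
      using keys_diff[of "x - y" z] keys_diff[of x y] by (meson order_trans sup_mono order_refl)
    also have "\<dots> \<subseteq> S"
      using that by simp
    finally show ?thesis by simp
  qed
  show ?thesis
    unfolding tensor_relations_def
    by (intro Un_least subsetI; elim CollectE exE conjE; hypsubst; intro diff)
       (simp_all add: A.m_closed B.m_closed)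
qed

lemma comm_group_tensor_product:
  assumes "group A" "group B"
  shows "comm_group (tensor_product A B)"
proof -
  let ?F = "free_Abelian_group (carrier A \<times> carrier B)"
  interpret F: comm_group ?F by (rule abelian_free_Abelian_group)
  show ?thesis
    unfolding tensor_product_def Let_def
    by (intro F.abelian_FactGroup F.generate_is_subgroup tensor_relations_carrier assms)
qed

subsection \<open>Second cohomology with trivial coefficients\<close>

abbreviation cochains2 ::
    "('a, 'c) monoid_scheme \<Rightarrow> ('b, 'd) monoid_scheme \<Rightarrow> ('a \<times> 'a \<Rightarrow> 'b) monoid" where
  "cochains2 G A \<equiv> product_group (carrier G \<times> carrier G) (\<lambda>_. A)"

definition cocycles2 ::
    "('a, 'c) monoid_scheme \<Rightarrow> ('b, 'd) monoid_scheme \<Rightarrow> ('a \<times> 'a \<Rightarrow> 'b) set" where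
  "cocycles2 G A = {f \<in> carrier (cochains2 G A).
     \<forall>x\<in>carrier G. \<forall>y\<in>carrier G. \<forall>z\<in>carrier G.
       f (y, z) \<otimes>\<^bsub>A\<^esub> f (x, y \<otimes>\<^bsub>G\<^esub> z) = f (x \<otimes>\<^bsub>G\<^esub> y, z) \<otimes>\<^bsub>A\<^esub> f (x, y)}"

definition coboundary2 ::
    "('a, 'c) monoid_scheme \<Rightarrow> ('b, 'd) monoid_scheme \<Rightarrow> ('a \<Rightarrow> 'b) \<Rightarrow> 'a \<times> 'a \<Rightarrow> 'b" where
  "coboundary2 G A h =
     (\<lambda>(x, y) \<in> carrier G \<times> carrier G. h y \<otimes>\<^bsub>A\<^esub> inv\<^bsub>A\<^esub> h (x \<otimes>\<^bsub>G\<^esub> y) \<otimes>\<^bsub>A\<^esub> h x)"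

definition coboundaries2 ::
    "('a, 'c) monoid_scheme \<Rightarrow> ('b, 'd) monoid_scheme \<Rightarrow> ('a \<times> 'a \<Rightarrow> 'b) set" where
  "coboundaries2 G A = coboundary2 G A ` (carrier G \<rightarrow> carrier A)"

definition cocycle_group2 ::
    "('a, 'c) monoid_scheme \<Rightarrow> ('b, 'd) monoid_scheme \<Rightarrow> ('a \<times> 'a \<Rightarrow> 'b) monoid" where
  "cocycle_group2 G A = (cochains2 G A)\<lparr>carrier := cocycles2 G A\<rparr>"

definition cohomology2 ::
    "('a, 'c) monoid_scheme \<Rightarrow> ('b, 'd) monoid_scheme \<Rightarrow> ('a \<times> 'a \<Rightarrow> 'b) set monoid" where
  "cohomology2 G A = cocycle_group2 G A Mod coboundaries2 G A"

text \<open>The map on classes induced by restricting cocycles to a subgroup \<open>K\<close>. All cosets in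
  the union coincide, see \<open>cohomology2_res_coset\<close>.\<close>

definition cohomology2_res ::
    "('a, 'c) monoid_scheme \<Rightarrow> ('b, 'd) monoid_scheme \<Rightarrow> 'a set \<Rightarrow>
     ('a \<times> 'a \<Rightarrow> 'b) set \<Rightarrow> ('a \<times> 'a \<Rightarrow> 'b) set" where
  "cohomology2_res G A K c =
     (\<Union>f\<in>c. coboundaries2 (G\<lparr>carrier := K\<rparr>) A
              #>\<^bsub>cocycle_group2 (G\<lparr>carrier := K\<rparr>) A\<^esub> restrict f (K \<times> K))"

subsection \<open>Schur multiplier\<close>

definition complex_units :: "complex monoid" where
  "complex_units = \<lparr>carrier = - {0}, monoid.mult = (*), one = 1\<rparr>"

definition schur_multiplier :: "('a, 'b) monoid_scheme \<Rightarrow> ('a \<times> 'a \<Rightarrow> complex) set monoid" where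
  "schur_multiplier G = cohomology2 G complex_units"

definition schur_res ::
    "('a, 'b) monoid_scheme \<Rightarrow> 'a set \<Rightarrow>
     ('a \<times> 'a \<Rightarrow> complex) set \<Rightarrow> ('a \<times> 'a \<Rightarrow> complex) set" where
  "schur_res G K = cohomology2_res G complex_units K"

lemma comm_group_complex_units: "comm_group complex_units"
proof (rule comm_groupI)
  fix x assume "x \<in> carrier complex_units"
  then show "\<exists>y\<in>carrier complex_units. y \<otimes>\<^bsub>complex_units\<^esub> x = \<one>\<^bsub>complex_units\<^esub>"
    by (intro bexI[where x = "inverse x"]) (auto simp: complex_units_def)
qed (auto simp: complex_units_def)

lemma cohomology2_subgroups:
  assumes "group G" "comm_group A"
  shows comm_group_cochains2: "comm_group (cochains2 G A)"
    and subgroup_cocycles2: "subgroup (cocycles2 G A) (cochains2 G A)"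
    and comm_group_cocycle_group2: "comm_group (cocycle_group2 G A)"
    and subgroup_coboundaries2: "subgroup (coboundaries2 G A) (cocycle_group2 G A)"
    and comm_group_cohomology2: "comm_group (cohomology2 G A)"
proof -
  interpret G: group G by fact
  interpret A: comm_group A by fact
  interpret C: group "cochains2 G A" by simp
  note ac = A.m_assoc A.m_comm A.m_lcomm
  show C: "comm_group (cochains2 G A)"
  proof (rule C.group_comm_groupI)
    fix x y assume "x \<in> carrier (cochains2 G A)" "y \<in> carrier (cochains2 G A)"
    then show "x \<otimes>\<^bsub>cochains2 G A\<^esub> y = y \<otimes>\<^bsub>cochains2 G A\<^esub> x"
      by (auto simp: PiE_iff A.m_comm intro!: restrict_ext)
  qed
  interpret C: comm_group "cochains2 G A" by fact
  have cl: "f (x, y) \<in> carrier A"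
    if "f \<in> carrier (cochains2 G A)" "x \<in> carrier G" "y \<in> carrier G" for f x y
    using that by (auto simp: PiE_iff)
  have inv_f: "(inv\<^bsub>cochains2 G A\<^esub> f) (x, y) = inv\<^bsub>A\<^esub> f (x, y)"
    if "f \<in> carrier (cochains2 G A)" "x \<in> carrier G" "y \<in> carrier G" for f x y
    using that by (simp add: inv_product_group)
  show Z: "subgroup (cocycles2 G A) (cochains2 G A)"
  proof (rule C.subgroupI)
    show "cocycles2 G A \<subseteq> carrier (cochains2 G A)"
      by (auto simp: cocycles2_def)
    have "\<one>\<^bsub>cochains2 G A\<^esub> \<in> cocycles2 G A"
      using C.one_closed unfolding cocycles2_def by simp
    then show "cocycles2 G A \<noteq> {}" by blast
  next
    fix f assume f: "f \<in> cocycles2 G A"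
    then have fc: "f \<in> carrier (cochains2 G A)" by (simp add: cocycles2_def)
    show "inv\<^bsub>cochains2 G A\<^esub> f \<in> cocycles2 G A"
      unfolding cocycles2_def mem_Collect_eq
    proof (intro conjI ballI)
      show "inv\<^bsub>cochains2 G A\<^esub> f \<in> carrier (cochains2 G A)" using fc by (rule C.inv_closed)
      fix x y z assume *: "x \<in> carrier G" "y \<in> carrier G" "z \<in> carrier G"
      then have "f (y, z) \<otimes>\<^bsub>A\<^esub> f (x, y \<otimes>\<^bsub>G\<^esub> z) = f (x \<otimes>\<^bsub>G\<^esub> y, z) \<otimes>\<^bsub>A\<^esub> f (x, y)"
        using f by (simp add: cocycles2_def)
      then have "inv\<^bsub>A\<^esub> (f (y, z) \<otimes>\<^bsub>A\<^esub> f (x, y \<otimes>\<^bsub>G\<^esub> z)) = inv\<^bsub>A\<^esub> (f (x \<otimes>\<^bsub>G\<^esub> y, z) \<otimes>\<^bsub>A\<^esub> f (x, y))"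
        by simp
      then show "(inv\<^bsub>cochains2 G A\<^esub> f) (y, z) \<otimes>\<^bsub>A\<^esub> (inv\<^bsub>cochains2 G A\<^esub> f) (x, y \<otimes>\<^bsub>G\<^esub> z) =
          (inv\<^bsub>cochains2 G A\<^esub> f) (x \<otimes>\<^bsub>G\<^esub> y, z) \<otimes>\<^bsub>A\<^esub> (inv\<^bsub>cochains2 G A\<^esub> f) (x, y)"
        using * by (simp only: inv_f[OF fc] G.m_closed A.inv_mult cl[OF fc])
    qed
  next
    fix f g assume f: "f \<in> cocycles2 G A" and g: "g \<in> cocycles2 G A"
    then have fc: "f \<in> carrier (cochains2 G A)" and gc: "g \<in> carrier (cochains2 G A)"
      by (simp_all add: cocycles2_def)
    show "f \<otimes>\<^bsub>cochains2 G A\<^esub> g \<in> cocycles2 G A"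
      unfolding cocycles2_def mem_Collect_eq
    proof (intro conjI ballI)
      show "f \<otimes>\<^bsub>cochains2 G A\<^esub> g \<in> carrier (cochains2 G A)" using fc gc by (rule C.m_closed)
      fix x y z assume *: "x \<in> carrier G" "y \<in> carrier G" "z \<in> carrier G"
      have 1: "f (y, z) \<otimes>\<^bsub>A\<^esub> f (x, y \<otimes>\<^bsub>G\<^esub> z) = f (x \<otimes>\<^bsub>G\<^esub> y, z) \<otimes>\<^bsub>A\<^esub> f (x, y)"
        using f * by (simp add: cocycles2_def)
      have 2: "g (y, z) \<otimes>\<^bsub>A\<^esub> g (x, y \<otimes>\<^bsub>G\<^esub> z) = g (x \<otimes>\<^bsub>G\<^esub> y, z) \<otimes>\<^bsub>A\<^esub> g (x, y)"
        using g * by (simp add: cocycles2_def)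
      have sw: "(a \<otimes>\<^bsub>A\<^esub> b) \<otimes>\<^bsub>A\<^esub> (c \<otimes>\<^bsub>A\<^esub> d) = (a \<otimes>\<^bsub>A\<^esub> c) \<otimes>\<^bsub>A\<^esub> (b \<otimes>\<^bsub>A\<^esub> d)"
        if "a \<in> carrier A" "b \<in> carrier A" "c \<in> carrier A" "d \<in> carrier A" for a b c d
        using that by (simp add: ac)
      show "(f \<otimes>\<^bsub>cochains2 G A\<^esub> g) (y, z) \<otimes>\<^bsub>A\<^esub> (f \<otimes>\<^bsub>cochains2 G A\<^esub> g) (x, y \<otimes>\<^bsub>G\<^esub> z) =
          (f \<otimes>\<^bsub>cochains2 G A\<^esub> g) (x \<otimes>\<^bsub>G\<^esub> y, z) \<otimes>\<^bsub>A\<^esub> (f \<otimes>\<^bsub>cochains2 G A\<^esub> g) (x, y)"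
        using * sw[of "f (y, z)" "g (y, z)" "f (x, y \<otimes>\<^bsub>G\<^esub> z)" "g (x, y \<otimes>\<^bsub>G\<^esub> z)"]
          sw[of "f (x \<otimes>\<^bsub>G\<^esub> y, z)" "g (x \<otimes>\<^bsub>G\<^esub> y, z)" "f (x, y)" "g (x, y)"]
          cl[OF fc] cl[OF gc] 1 2 by (simp del: carrier_product_group)
    qed
  qed
  show ZG: "comm_group (cocycle_group2 G A)"
  proof (rule group.group_comm_groupI)
    show "group (cocycle_group2 G A)"
      unfolding cocycle_group2_def using Z C.group_axioms by (rule subgroup.subgroup_is_group)
    fix f g assume "f \<in> carrier (cocycle_group2 G A)" "g \<in> carrier (cocycle_group2 G A)"
    then have "f \<in> carrier (cochains2 G A)" "g \<in> carrier (cochains2 G A)"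
      by (simp_all add: cocycle_group2_def cocycles2_def)
    then have "f \<otimes>\<^bsub>cochains2 G A\<^esub> g = g \<otimes>\<^bsub>cochains2 G A\<^esub> f"
      by (rule C.m_comm)
    then show "f \<otimes>\<^bsub>cocycle_group2 G A\<^esub> g = g \<otimes>\<^bsub>cocycle_group2 G A\<^esub> f"
      by (simp add: cocycle_group2_def)
  qed
  interpret Z: comm_group "cocycle_group2 G A" by fact
  have bZ: "coboundary2 G A h \<in> cocycles2 G A" if h: "h \<in> carrier G \<rightarrow> carrier A" for h
  proof -
    have hc: "h x \<in> carrier A" if "x \<in> carrier G" for x using h that by blast
    have "coboundary2 G A h \<in> carrier (cochains2 G A)"
      using hc by (auto simp: coboundary2_def)
    moreover have "coboundary2 G A h (y, z) \<otimes>\<^bsub>A\<^esub> coboundary2 G A h (x, y \<otimes>\<^bsub>G\<^esub> z) =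
        coboundary2 G A h (x \<otimes>\<^bsub>G\<^esub> y, z) \<otimes>\<^bsub>A\<^esub> coboundary2 G A h (x, y)"
      if *: "x \<in> carrier G" "y \<in> carrier G" "z \<in> carrier G" for x y z
    proof -
      have can: "a \<otimes>\<^bsub>A\<^esub> inv\<^bsub>A\<^esub> s \<otimes>\<^bsub>A\<^esub> b \<otimes>\<^bsub>A\<^esub> (s \<otimes>\<^bsub>A\<^esub> c \<otimes>\<^bsub>A\<^esub> d) = a \<otimes>\<^bsub>A\<^esub> b \<otimes>\<^bsub>A\<^esub> (c \<otimes>\<^bsub>A\<^esub> d)"
        if "a \<in> carrier A" "b \<in> carrier A" "c \<in> carrier A" "d \<in> carrier A" "s \<in> carrier A" for a b c d s
      proof -
        have "a \<otimes>\<^bsub>A\<^esub> inv\<^bsub>A\<^esub> s \<otimes>\<^bsub>A\<^esub> b \<otimes>\<^bsub>A\<^esub> (s \<otimes>\<^bsub>A\<^esub> c \<otimes>\<^bsub>A\<^esub> d) = (s \<otimes>\<^bsub>A\<^esub> inv\<^bsub>A\<^esub> s) \<otimes>\<^bsub>A\<^esub> (a \<otimes>\<^bsub>A\<^esub> b \<otimes>\<^bsub>A\<^esub> (c \<otimes>\<^bsub>A\<^esub> d))"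
          using that by (simp add: ac del: A.r_inv A.Units_r_inv)
        then show ?thesis using that by simp
      qed
      have can': "a \<otimes>\<^bsub>A\<^esub> c \<otimes>\<^bsub>A\<^esub> s \<otimes>\<^bsub>A\<^esub> (b \<otimes>\<^bsub>A\<^esub> inv\<^bsub>A\<^esub> s \<otimes>\<^bsub>A\<^esub> d) = a \<otimes>\<^bsub>A\<^esub> b \<otimes>\<^bsub>A\<^esub> (c \<otimes>\<^bsub>A\<^esub> d)"
        if "a \<in> carrier A" "b \<in> carrier A" "c \<in> carrier A" "d \<in> carrier A" "s \<in> carrier A" for a b c d s
      proof -
        have "a \<otimes>\<^bsub>A\<^esub> c \<otimes>\<^bsub>A\<^esub> s \<otimes>\<^bsub>A\<^esub> (b \<otimes>\<^bsub>A\<^esub> inv\<^bsub>A\<^esub> s \<otimes>\<^bsub>A\<^esub> d) = (s \<otimes>\<^bsub>A\<^esub> inv\<^bsub>A\<^esub> s) \<otimes>\<^bsub>A\<^esub> (a \<otimes>\<^bsub>A\<^esub> b \<otimes>\<^bsub>A\<^esub> (c \<otimes>\<^bsub>A\<^esub> d))"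
          using that by (simp add: ac del: A.r_inv A.Units_r_inv)
        then show ?thesis using that by simp
      qed
      show ?thesis
        using * by (simp add: coboundary2_def can can' hc G.m_assoc)
    qed
    ultimately show ?thesis by (simp add: cocycles2_def del: carrier_product_group)
  qed
  have mult_b: "coboundary2 G A h \<otimes>\<^bsub>cochains2 G A\<^esub> coboundary2 G A k =
      coboundary2 G A (\<lambda>x. h x \<otimes>\<^bsub>A\<^esub> k x)"
    if h: "h \<in> carrier G \<rightarrow> carrier A" and k: "k \<in> carrier G \<rightarrow> carrier A" for h k
  proof -
    have hc: "h x \<in> carrier A" "k x \<in> carrier A" if "x \<in> carrier G" for x using h k that by blast+
    show ?thesis
      by (auto simp: coboundary2_def hc A.inv_mult ac intro!: restrict_ext)
  qed
  have one_b: "\<one>\<^bsub>cochains2 G A\<^esub> = coboundary2 G A (\<lambda>_. \<one>\<^bsub>A\<^esub>)"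
    by (auto simp: coboundary2_def intro!: restrict_ext)
  show B: "subgroup (coboundaries2 G A) (cocycle_group2 G A)"
  proof (rule Z.subgroupI)
    show "coboundaries2 G A \<subseteq> carrier (cocycle_group2 G A)"
      using bZ by (auto simp: coboundaries2_def cocycle_group2_def)
    show "coboundaries2 G A \<noteq> {}" by (auto simp: coboundaries2_def)
  next
    fix f assume "f \<in> coboundaries2 G A"
    then obtain h where h: "h \<in> carrier G \<rightarrow> carrier A" and f: "f = coboundary2 G A h"
      by (auto simp: coboundaries2_def)
    let ?k = "\<lambda>x. inv\<^bsub>A\<^esub> h x"
    have k: "?k \<in> carrier G \<rightarrow> carrier A" using h by auto
    have "coboundary2 G A ?k \<otimes>\<^bsub>cochains2 G A\<^esub> f = coboundary2 G A (\<lambda>_. \<one>\<^bsub>A\<^esub>)"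
      unfolding f mult_b[OF k h] using h by (auto simp: coboundary2_def Pi_iff intro!: restrict_ext)
    then have "inv\<^bsub>cocycle_group2 G A\<^esub> f = coboundary2 G A ?k"
      using bZ[OF k] bZ[OF h] f
      by (intro Z.inv_equality) (simp_all add: cocycle_group2_def flip: one_b)
    then show "inv\<^bsub>cocycle_group2 G A\<^esub> f \<in> coboundaries2 G A"
      using k by (auto simp: coboundaries2_def)
  next
    fix f g assume "f \<in> coboundaries2 G A" "g \<in> coboundaries2 G A"
    then obtain h k where h: "h \<in> carrier G \<rightarrow> carrier A" "k \<in> carrier G \<rightarrow> carrier A"
      and "f = coboundary2 G A h" "g = coboundary2 G A k"
      by (auto simp: coboundaries2_def)
    then have "f \<otimes>\<^bsub>cocycle_group2 G A\<^esub> g = coboundary2 G A (\<lambda>x. h x \<otimes>\<^bsub>A\<^esub> k x)"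
      using mult_b by (simp add: cocycle_group2_def del: mult_product_group)
    moreover have "(\<lambda>x. h x \<otimes>\<^bsub>A\<^esub> k x) \<in> carrier G \<rightarrow> carrier A" using h by auto
    ultimately show "f \<otimes>\<^bsub>cocycle_group2 G A\<^esub> g \<in> coboundaries2 G A"
      by (auto simp: coboundaries2_def)
  qed
  show "comm_group (cohomology2 G A)"
    unfolding cohomology2_def using B by (rule Z.abelian_FactGroup)
qed

lemma cohomology2_res_coset:
  assumes G: "group G" and A: "comm_group A" and K: "subgroup K G" and f: "f \<in> cocycles2 G A"
  shows "restrict f (K \<times> K) \<in> cocycles2 (G\<lparr>carrier := K\<rparr>) A"
    and "cohomology2_res G A K (coboundaries2 G A #>\<^bsub>cocycle_group2 G A\<^esub> f) =
         coboundaries2 (G\<lparr>carrier := K\<rparr>) A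
           #>\<^bsub>cocycle_group2 (G\<lparr>carrier := K\<rparr>) A\<^esub> restrict f (K \<times> K)"
proof -
  interpret G: group G by fact
  interpret A: comm_group A by fact
  interpret K: subgroup K G by fact
  let ?K = "G\<lparr>carrier := K\<rparr>"
  let ?B = "coboundaries2 ?K A" and ?Z = "cocycle_group2 ?K A"
  have gK: "group ?K" using G K by (simp add: K.subgroup_is_group)
  interpret Z: comm_group ?Z using gK A by (rule comm_group_cocycle_group2)
  interpret B: subgroup ?B ?Z using gK A by (rule subgroup_coboundaries2)
  show rZ: "restrict f (K \<times> K) \<in> cocycles2 ?K A"
    using f by (auto simp: cocycles2_def PiE_iff)
  have eq: "?B #>\<^bsub>?Z\<^esub> restrict g (K \<times> K) = ?B #>\<^bsub>?Z\<^esub> restrict f (K \<times> K)"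
    if "g \<in> coboundaries2 G A #>\<^bsub>cocycle_group2 G A\<^esub> f" for g
  proof -
    from that obtain h where h: "h \<in> carrier G \<rightarrow> carrier A"
      and g: "g = coboundary2 G A h \<otimes>\<^bsub>cocycle_group2 G A\<^esub> f"
      by (auto simp: r_coset_def coboundaries2_def)
    have "restrict g (K \<times> K) = coboundary2 ?K A h \<otimes>\<^bsub>?Z\<^esub> restrict f (K \<times> K)"
      unfolding g cocycle_group2_def
      by (auto simp: coboundary2_def restrict_def)
    moreover have "coboundary2 ?K A h \<in> ?B"
      using h K.subset by (auto simp: coboundaries2_def)
    ultimately have "restrict g (K \<times> K) \<in> ?B #>\<^bsub>?Z\<^esub> restrict f (K \<times> K)"
      by (auto simp: r_coset_def)
    moreover have "restrict f (K \<times> K) \<in> carrier ?Z"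
      using rZ by (simp add: cocycle_group2_def)
    ultimately show ?thesis
      using B.subgroup_axioms by (rule Z.repr_independence[symmetric])
  qed
  have "f \<in> coboundaries2 G A #>\<^bsub>cocycle_group2 G A\<^esub> f"
  proof -
    interpret ZG: comm_group "cocycle_group2 G A" using G A by (rule comm_group_cocycle_group2)
    show ?thesis
      using f subgroup_coboundaries2[OF G A] by (intro ZG.rcos_self) (simp_all add: cocycle_group2_def)
  qed
  then show "cohomology2_res G A K (coboundaries2 G A #>\<^bsub>cocycle_group2 G A\<^esub> f) =
      ?B #>\<^bsub>?Z\<^esub> restrict f (K \<times> K)"
    unfolding cohomology2_res_def using eq by blast
qed

lemma cohomology2_res_hom:
  assumes G: "group G" and A: "comm_group A" and K: "subgroup K G"
  shows "cohomology2_res G A K \<in> hom (cohomology2 G A) (cohomology2 (G\<lparr>carrier := K\<rparr>) A)"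
proof -
  let ?K = "G\<lparr>carrier := K\<rparr>"
  have gK: "group ?K" using G K by (simp add: subgroup.subgroup_is_group)
  have KG: "K \<subseteq> carrier G" using K by (rule subgroup.subset)
  have nG: "coboundaries2 G A \<lhd> cocycle_group2 G A" and nK: "coboundaries2 ?K A \<lhd> cocycle_group2 ?K A"
    using G gK A by (simp_all add: comm_group.normal_iff_subgroup comm_group_cocycle_group2 subgroup_coboundaries2)
  interpret ZG: comm_group "cocycle_group2 G A" using G A by (rule comm_group_cocycle_group2)
  note res = cohomology2_res_coset[OF G A K]
  have Zc: "carrier (cocycle_group2 H A) = cocycles2 H A" for H :: "('a, 'b) monoid_scheme"
    by (simp add: cocycle_group2_def)
  show ?thesis
  proof (rule homI)
    fix c assume "c \<in> carrier (cohomology2 G A)"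
    then obtain f where f: "f \<in> cocycles2 G A" and c: "c = coboundaries2 G A #>\<^bsub>cocycle_group2 G A\<^esub> f"
      by (auto simp: cohomology2_def carrier_FactGroup Zc)
    show "cohomology2_res G A K c \<in> carrier (cohomology2 ?K A)"
      unfolding c res(2)[OF f] using res(1)[OF f]
      by (auto simp: cohomology2_def carrier_FactGroup Zc)
  next
    fix c d assume "c \<in> carrier (cohomology2 G A)" "d \<in> carrier (cohomology2 G A)"
    then obtain f g where f: "f \<in> cocycles2 G A" and c: "c = coboundaries2 G A #>\<^bsub>cocycle_group2 G A\<^esub> f"
      and g: "g \<in> cocycles2 G A" and d: "d = coboundaries2 G A #>\<^bsub>cocycle_group2 G A\<^esub> g"
      by (auto simp: cohomology2_def carrier_FactGroup Zc)
    have fg: "f \<otimes>\<^bsub>cocycle_group2 G A\<^esub> g \<in> cocycles2 G A"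
      using f g ZG.m_closed by (simp add: Zc)
    have rfg: "restrict (f \<otimes>\<^bsub>cocycle_group2 G A\<^esub> g) (K \<times> K) =
        restrict f (K \<times> K) \<otimes>\<^bsub>cocycle_group2 ?K A\<^esub> restrict g (K \<times> K)"
      using KG by (force simp: cocycle_group2_def restrict_def fun_eq_iff)
    have "c \<otimes>\<^bsub>cohomology2 G A\<^esub> d =
        coboundaries2 G A #>\<^bsub>cocycle_group2 G A\<^esub> (f \<otimes>\<^bsub>cocycle_group2 G A\<^esub> g)"
      using normal.rcos_sum[OF nG] f g by (simp add: cohomology2_def c d Zc)
    then show "cohomology2_res G A K (c \<otimes>\<^bsub>cohomology2 G A\<^esub> d) =
        cohomology2_res G A K c \<otimes>\<^bsub>cohomology2 ?K A\<^esub> cohomology2_res G A K d"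
      using res(2)[OF fg] rfg normal.rcos_sum[OF nK] res[OF f] res[OF g]
      by (simp add: cohomology2_def c d Zc)
  qed
qed

end

theory Submission
  imports Defs
begin

text \<open>Let \<open>E\<close> be a central extension of \<open>G\<close> by \<open>A\<close> in which every 2-cocycle of \<open>G\<close> appears as the
  composite of the factor set with a character of \<open>A\<close>. A character of \<open>A\<close> that is trivial on
  \<open>A \<inter> [E, E]\<close> extends to \<open>E\<close> and so belongs to a coboundary; hence \<open>M(G)\<close> embeds in the dual of
  \<open>A \<inter> [E, E]\<close>, and \<open>|[G, G]| |M(G)| \<le> |[E, E]|\<close>.

  For a normal subgroup \<open>U\<close> of \<open>Q = G/K\<close> put \<open>N(U) = [preimage of U, E]\<close>. As the restriction to
  \<open>M(K)\<close> vanishes, the preimage of \<open>K\<close> in \<open>E\<close> is abelian, so \<open>N(1)\<close> is an image of the tensor product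
  of \<open>Q\<^sup>a\<^sup>b\<close> and \<open>K\<close>. Climb from \<open>1\<close> to \<open>[Q, Q]\<close> by central steps of order \<open>p\<close>: adjoining \<open>c\<close> to
  \<open>U\<close> enlarges \<open>N(U)\<close> by the image of \<open>q \<mapsto> [c, q]\<close>, a homomorphism from \<open>Q\<close> to an elementary
  abelian group, hence at most by \<open>p ^ d\<close> if \<open>Q\<close> has \<open>d\<close> generators. In the last step \<open>c = [a, b]\<close>, and
  the Hall-Witt identity improves this to \<open>p ^ 2\<close>. The remaining factor is the commutator subgroup of a
  central extension of the abelian group \<open>Q/[Q, Q]\<close>, at most \<open>p ^ ((d - 1)(m - r)/2)\<close>. The class
  assumption makes \<open>Q\<close> non-abelian, hence \<open>m - r \<ge> 2\<close>, which absorbs the difference to the bound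
  claimed.\<close>

subsection \<open>Commutators and cyclic extensions of subgroups\<close>

text \<open>The group \<open>E\<close> is infinite, so nothing above \<open>G\<close> may be counted
  in advance: indices are replaced by covers with finitely many cosets, elements of \<open>E\<close>
  are only torsion modulo the kernel, and the finiteness of [E, E] is an outcome of the climb.

  Two savings decide the exponent. The maps q \<mapsto> [c, q] have central values modulo N(U),
  hence kill [Q, Q], so d may be the size of any set that generates Q modulo [Q, Q]. Some such set
  has at most m - r elements, and the second inequality is the same estimate for that set. The other
  saving is Hall-Witt: a cost of p ^ d in each of the r steps would miss the claimed exponent by d -
  1 - (m - r)/2, which can be positive. Paying p ^ 2 in one step gains d - 2 and leaves 1 - (m -
  r)/2. A single commutator is available there because the commutators generate [Q, Q] and so cannot
  all lie in a proper subgroup.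

  The factor for Q/[Q, Q] has an exponent that may be a half-integer, so it is carried as a number t
  with a bound on its square.\<close>

definition commutator :: "('a, 'b) monoid_scheme \<Rightarrow> 'a \<Rightarrow> 'a \<Rightarrow> 'a" where
  "commutator G x y = x \<otimes>\<^bsub>G\<^esub> y \<otimes>\<^bsub>G\<^esub> inv\<^bsub>G\<^esub> x \<otimes>\<^bsub>G\<^esub> inv\<^bsub>G\<^esub> y"

definition center :: "('a, 'b) monoid_scheme \<Rightarrow> 'a set" where
  "center G = {z \<in> carrier G. \<forall>g\<in>carrier G. z \<otimes>\<^bsub>G\<^esub> g = g \<otimes>\<^bsub>G\<^esub> z}"

text \<open>For normal \<open>U\<close> containing a positive power of \<open>x\<close> this is the
  subgroup generated by \<open>x\<close> and \<open>U\<close>: natural exponents then also produce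
  the inverses.\<close>

definition adjoin :: "('a, 'b) monoid_scheme \<Rightarrow> 'a \<Rightarrow> 'a set \<Rightarrow> 'a set" where
  "adjoin G x U = {x [^]\<^bsub>G\<^esub> (i::nat) \<otimes>\<^bsub>G\<^esub> u | i u. u \<in> U}"

lemma (in group_hom) hom_commutator:
  "x \<in> carrier G \<Longrightarrow> y \<in> carrier G \<Longrightarrow> h (commutator G x y) = commutator H (h x) (h y)"
  by (simp add: commutator_def)

lemma commutator_subgroup_eq:
  "commutator_subgroup G A B = generate G {commutator G x y | x y. x \<in> A \<and> y \<in> B}"
  unfolding commutator_subgroup_def commutator_def by (rule arg_cong[where f = "generate G"]) auto

lemma derived_eq_generate_commutators:
  "derived G A = generate G {commutator G x y | x y. x \<in> A \<and> y \<in> A}"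
  unfolding derived_def commutator_def by (rule arg_cong[where f = "generate G"]) auto

context group
begin

lemma mult_inv_cancel:
  "x \<in> carrier G \<Longrightarrow> y \<in> carrier G \<Longrightarrow> x \<otimes> (inv x \<otimes> y) = y"
  "x \<in> carrier G \<Longrightarrow> y \<in> carrier G \<Longrightarrow> inv x \<otimes> (x \<otimes> y) = y"
  by (simp_all flip: m_assoc)

lemmas group_word = m_assoc inv_mult_group mult_inv_cancel commutator_def

lemma commutator_closed [simp, intro]:
  "x \<in> carrier G \<Longrightarrow> y \<in> carrier G \<Longrightarrow> commutator G x y \<in> carrier G"
  by (simp add: commutator_def)

lemma commutator_in_derived:
  "x \<in> carrier G \<Longrightarrow> y \<in> carrier G \<Longrightarrow> commutator G x y \<in> derived G (carrier G)"
  unfolding derived_eq_generate_commutators by (rule generate.incl) blast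

lemma commutator_eq_one_iff:
  assumes "x \<in> carrier G" "y \<in> carrier G"
  shows "commutator G x y = \<one> \<longleftrightarrow> x \<otimes> y = y \<otimes> x"
proof -
  have "commutator G x y = (x \<otimes> y) \<otimes> inv (y \<otimes> x)"
    using assms by (simp add: group_word)
  then show ?thesis
    using assms by (metis inv_closed inv_equality inv_inv m_closed r_inv)
qed

lemma commutator_mult_right:
  assumes "c \<in> carrier G" "g \<in> carrier G" "h \<in> carrier G"
  shows "commutator G c (g \<otimes> h) = commutator G c g \<otimes> (g \<otimes> commutator G c h \<otimes> inv g)"
  using assms by (simp add: group_word)

lemma commutator_mult_left:
  assumes "x \<in> carrier G" "y \<in> carrier G" "h \<in> carrier G"
  shows "commutator G (x \<otimes> y) h = (x \<otimes> commutator G y h \<otimes> inv x) \<otimes> commutator G x h"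
  using assms by (simp add: group_word)

lemma center_closed: "z \<in> center G \<Longrightarrow> z \<in> carrier G"
  by (simp add: center_def)

lemma center_comm: "z \<in> center G \<Longrightarrow> g \<in> carrier G \<Longrightarrow> z \<otimes> g = g \<otimes> z"
  by (simp add: center_def)

lemma center_conj:
  assumes "z \<in> center G" "g \<in> carrier G" shows "g \<otimes> z \<otimes> inv g = z"
  using assms by (metis center_closed center_comm inv_closed m_assoc r_inv r_one)

lemma center_commutator:
  "z \<in> center G \<Longrightarrow> g \<in> carrier G \<Longrightarrow> commutator G z g = \<one>"
  "z \<in> center G \<Longrightarrow> g \<in> carrier G \<Longrightarrow> commutator G g z = \<one>"
  by (auto simp: commutator_eq_one_iff center_closed center_comm)

lemma commutator_hom:
  assumes "c \<in> carrier G" "\<And>g. g \<in> carrier G \<Longrightarrow> commutator G c g \<in> center G"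
  shows "commutator G c \<in> hom G G"
  using assms by (intro homI) (auto simp: commutator_mult_right center_conj)

lemma group_hom_commutator:
  assumes "c \<in> carrier G" "\<And>g. g \<in> carrier G \<Longrightarrow> commutator G c g \<in> center G"
  shows "group_hom G G (commutator G c)"
  using commutator_hom[OF assms] by (simp add: group_hom_def group_hom_axioms_def)

lemma commutator_pow_left:
  assumes "c \<in> carrier G" "\<And>g. g \<in> carrier G \<Longrightarrow> commutator G c g \<in> center G" "g \<in> carrier G"
  shows "commutator G (c [^] (i::nat)) g = commutator G c g [^] i"
proof (induction i)
  case 0
  show ?case using assms by (simp add: commutator_def)
next
  case (Suc i)
  have "commutator G (c [^] Suc i) g
      = (c [^] i \<otimes> commutator G c g \<otimes> inv (c [^] i)) \<otimes> commutator G (c [^] i) g"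
    using assms by (simp add: commutator_mult_left)
  also have "\<dots> = commutator G c g \<otimes> commutator G c g [^] i"
    using assms Suc by (simp add: center_conj)
  also have "\<dots> = commutator G c g [^] Suc i"
    using nat_pow_Suc2[of "commutator G c g" i] assms(1,3) by (simp del: nat_pow_Suc)
  finally show ?case .
qed

text \<open>A central factor drops out of a commutator, and [c^i, g] = [c, g]^i = [c, g^i] because g
  \<mapsto> [c, g] is a homomorphism with central values. So every generator already lies in the
  image of that homomorphism, which is a subgroup.\<close>

lemma commutator_subgroup_adjoin_central:
  assumes C: "C \<subseteq> center G" and c: "c \<in> carrier G"
    and cC: "\<And>g. g \<in> carrier G \<Longrightarrow> commutator G c g \<in> center G"
  shows "commutator_subgroup G (adjoin G c C) (carrier G) \<subseteq> commutator G c ` carrier G"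
proof -
  interpret f: group_hom G G "commutator G c" using c cC by (rule group_hom_commutator)
  have "commutator G (c [^] (i::nat) \<otimes> z) g \<in> commutator G c ` carrier G"
    if "z \<in> C" "g \<in> carrier G" for i z g
  proof -
    have z: "z \<in> center G" using that C by blast
    have "commutator G (c [^] i \<otimes> z) g = commutator G c (g [^] i)"
      using that z c cC
      by (simp add: commutator_mult_left center_commutator center_closed center_conj
          commutator_pow_left f.hom_nat_pow)
    then show ?thesis using that by simp
  qed
  then have "{commutator G x y | x y. x \<in> adjoin G c C \<and> y \<in> carrier G} \<subseteq> commutator G c ` carrier G"
    by (auto simp: adjoin_def)
  then show ?thesis
    unfolding commutator_subgroup_eq
    by (rule generate_subgroup_incl) (rule f.img_is_subgroup)
qed

lemma central_subgroup_normal: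
  assumes "subgroup K G" "K \<subseteq> center G" shows "K \<lhd> G"
proof (rule normal_invI[OF assms(1)])
  fix h x assume "h \<in> carrier G" "x \<in> K"
  then show "h \<otimes> x \<otimes> inv h \<in> K" using center_conj[of x h] assms(2) by auto
qed

lemma hall_witt:
  assumes "x \<in> carrier G" "y \<in> carrier G" "z \<in> carrier G"
  shows "commutator G (commutator G x y) (y \<otimes> z \<otimes> inv y) \<otimes>
    commutator G (commutator G y z) (z \<otimes> x \<otimes> inv z) \<otimes>
    commutator G (commutator G z x) (x \<otimes> y \<otimes> inv x) = \<one>"
  using assms by (simp add: group_word)

lemma normal_if_derived_subset:
  assumes H: "subgroup H G" and D: "derived G (carrier G) \<subseteq> H"
  shows "H \<lhd> G"
proof (rule normal_invI[OF H])
  fix g h assume g: "g \<in> carrier G" and h: "h \<in> H"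
  have hc: "h \<in> carrier G" using subgroup.mem_carrier[OF H] h by simp
  have "g \<otimes> h \<otimes> inv g = commutator G g h \<otimes> h"
    using g hc by (simp add: group_word)
  then show "g \<otimes> h \<otimes> inv g \<in> H"
    using commutator_in_derived[OF g] hc D h H by (metis subgroup.m_closed subsetD)
qed

end

section \<open>Cyclic extensions of a normal subgroup\<close>

lemma (in normal) commutator_nat_pow_closed:
  assumes x: "x \<in> carrier G" and c: "\<And>g. g \<in> carrier G \<Longrightarrow> commutator G x g \<in> H"
    and g: "g \<in> carrier G"
  shows "commutator G (x [^] (i::nat)) g \<in> H"
proof (induction i)
  case 0
  show ?case using g by (simp add: commutator_def)
next
  case (Suc i)
  then show ?case
    using g x c[OF g] inv_op_closed2[of "x [^] i"] by (simp add: commutator_mult_left)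
qed

text \<open>The exponent \<open>k\<close> only witnesses that \<open>x\<close> is torsion modulo
  \<open>U\<close>; the ambient group may be infinite, as it is when characters of the cocycle
  extension are extended. The exact order of \<open>x\<close> modulo \<open>U\<close> is
  \<open>rel_ord\<close>.\<close>

locale adjoin_normal = normal U G for U and G (structure) +
  fixes x k
  assumes x_closed: "x \<in> carrier G" and k_pos: "0 < (k::nat)" and x_pow_k: "x [^] k \<in> U"
begin

definition "rel_ord = group.ord (G Mod U) (U #> x)"

lemma pow_in_iff: "x [^] (i::nat) \<in> U \<longleftrightarrow> rel_ord dvd i"
proof -
  interpret Q: group "G Mod U" by (rule factorgroup_is_group)
  have "U #> x \<in> carrier (G Mod U)" using x_closed by (auto simp: carrier_FactGroup)
  then have "rel_ord dvd i \<longleftrightarrow> U #> x [^] i = U"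
    unfolding rel_ord_def using Q.pow_eq_id[of "U #> x" i] x_closed by (simp add: FactGroup_pow)
  also have "\<dots> \<longleftrightarrow> x [^] i \<in> U"
    using coset_join1[of U "x [^] i"] coset_join2[of "x [^] i" U] x_closed subset subgroup_axioms by auto
  finally show ?thesis ..
qed

lemma rel_ord_pos: "0 < rel_ord"
  using pow_in_iff[of k] x_pow_k k_pos by (auto intro!: Nat.gr0I)

lemma pow_rel_ord: "x [^] rel_ord \<in> U"
  by (simp add: pow_in_iff)

lemma mem_adjoin: "u \<in> U \<Longrightarrow> x [^] (i::nat) \<otimes> u \<in> adjoin G x U"
  by (auto simp: adjoin_def)

lemma subset_adjoin: "U \<subseteq> adjoin G x U"
proof
  fix u assume "u \<in> U"
  then show "u \<in> adjoin G x U" using mem_adjoin[of u 0] by simp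
qed

lemma self_in_adjoin: "x \<in> adjoin G x U"
  using mem_adjoin[of "\<one>" 1] x_closed by simp

lemma pow_conj_closed:
  assumes "u \<in> U" shows "inv (x [^] (i::nat)) \<otimes> u \<otimes> x [^] i \<in> U"
  using assms x_closed by (simp add: inv_op_closed1)

lemma subgroup_adjoin: "subgroup (adjoin G x U) G"
proof (rule subgroupI)
  show "adjoin G x U \<subseteq> carrier G" using x_closed by (auto simp: adjoin_def)
  show "adjoin G x U \<noteq> {}" using self_in_adjoin by blast
next
  fix a assume "a \<in> adjoin G x U"
  then obtain i u where u: "u \<in> U" and a: "a = x [^] (i::nat) \<otimes> u" by (auto simp: adjoin_def)
  \<comment> \<open>Modulo \<open>U\<close> the inverse of x^i is x^((k-1)i), since x^(ki) lies in
    \<open>U\<close>; the remaining factors are collected into an element of \<open>U\<close> by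
    normality.\<close>
  have e: "x [^] (k * i) = x [^] i \<otimes> x [^] ((k - 1) * i)"
    using x_closed k_pos by (simp add: nat_pow_mult mult_eq_if)
  have "x [^] (k * i) \<in> U"
    using pow_in_iff x_pow_k by (meson dvd_trans dvd_triv_left pow_in_iff)
  then have "inv (x [^] (k * i)) \<otimes> (x [^] i \<otimes> inv u \<otimes> inv (x [^] i)) \<in> U"
    using u x_closed inv_op_closed2[of "x [^] i" "inv u"] by simp
  moreover have "inv a = x [^] ((k - 1) * i) \<otimes> (inv (x [^] (k * i)) \<otimes> (x [^] i \<otimes> inv u \<otimes> inv (x [^] i)))"
    using u x_closed unfolding a e by (simp add: group_word)
  ultimately show "inv a \<in> adjoin G x U" using mem_adjoin by presburger
next
  fix a b assume "a \<in> adjoin G x U" "b \<in> adjoin G x U"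
  then obtain i u j v where u: "u \<in> U" and a: "a = x [^] (i::nat) \<otimes> u"
    and v: "v \<in> U" and b: "b = x [^] (j::nat) \<otimes> v" by (auto simp: adjoin_def)
  have "a \<otimes> b = x [^] i \<otimes> x [^] j \<otimes> ((inv (x [^] j) \<otimes> u \<otimes> x [^] j) \<otimes> v)"
    using u v x_closed unfolding a b by (simp add: group_word)
  also have "x [^] i \<otimes> x [^] j = x [^] (i + j)" using x_closed by (simp add: nat_pow_mult)
  finally show "a \<otimes> b \<in> adjoin G x U"
    using mem_adjoin pow_conj_closed[OF u] v by simp
qed

lemma adjoin_unique:
  assumes "x [^] (i::nat) \<otimes> u = x [^] j \<otimes> v" "u \<in> U" "v \<in> U" "i < rel_ord" "j < rel_ord"
  shows "i = j \<and> u = v"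
proof -
  have *: "i = j" if eq: "x [^] (i::nat) \<otimes> u = x [^] j \<otimes> v" and uv: "u \<in> U" "v \<in> U"
    and le: "i \<le> j" "j < rel_ord" for i j u v
  proof -
    have "x [^] j = x [^] i \<otimes> x [^] (j - i)"
      using le x_closed by (simp add: nat_pow_mult)
    then have "x [^] i \<otimes> u = x [^] i \<otimes> (x [^] (j - i) \<otimes> v)"
      using eq uv x_closed by (simp add: m_assoc)
    then have "u = x [^] (j - i) \<otimes> v"
      using uv x_closed by (simp)
    then have "x [^] (j - i) = u \<otimes> inv v"
      using uv x_closed by (simp add: m_assoc)
    then have "rel_ord dvd j - i" using uv pow_in_iff[of "j - i"] by simp
    then show "i = j" using le by (metis diff_is_0_eq' dvd_imp_le less_imp_diff_less not_gr_zero
          leD le_antisym diff_is_0_eq)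
  qed
  have "i = j"
    using *[of i u j v] *[of j v i u] assms by (metis nle_le)
  then show ?thesis using assms x_closed by simp
qed

text \<open>The normal form, obtained by division of the exponent by \<open>rel_ord\<close>. It
  serves both to count \<open>adjoin G x U\<close> and to define functions on it, such as the
  extension of a character.\<close>

lemma bij_betw_adjoin:
  "bij_betw (\<lambda>(i, u). x [^] i \<otimes> u) ({..<rel_ord} \<times> U) (adjoin G x U)"
  unfolding bij_betw_def
proof
  show "inj_on (\<lambda>(i, u). x [^] i \<otimes> u) ({..<rel_ord} \<times> U)"
    using adjoin_unique by (auto simp: inj_on_def)
  have "x [^] i \<otimes> u \<in> (\<lambda>(i, u). x [^] i \<otimes> u) ` ({..<rel_ord} \<times> U)" if "u \<in> U" for i :: nat and u
  proof (rule image_eqI[where x = "(i mod rel_ord, x [^] (rel_ord * (i div rel_ord)) \<otimes> u)"])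
    have "x [^] i = x [^] (i mod rel_ord) \<otimes> x [^] (rel_ord * (i div rel_ord))"
      using x_closed by (simp add: nat_pow_mult)
    then show "x [^] i \<otimes> u = (case (i mod rel_ord, x [^] (rel_ord * (i div rel_ord)) \<otimes> u) of
        (i, u) \<Rightarrow> x [^] i \<otimes> u)"
      using that x_closed by (simp add: m_assoc)
    show "(i mod rel_ord, x [^] (rel_ord * (i div rel_ord)) \<otimes> u) \<in> {..<rel_ord} \<times> U"
      using that rel_ord_pos pow_in_iff[of "rel_ord * (i div rel_ord)"] by simp
  qed
  then show "(\<lambda>(i, u). x [^] i \<otimes> u) ` ({..<rel_ord} \<times> U) = adjoin G x U"
    by (auto simp: adjoin_def)
qed

lemma card_adjoin: "card (adjoin G x U) = rel_ord * card U"
  using bij_betw_same_card[OF bij_betw_adjoin] by (simp add: card_cartesian_product)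

lemma rel_ord_le: "rel_ord \<le> k"
  using pow_in_iff[of k] x_pow_k k_pos by (simp add: dvd_imp_le)

lemma adjoin_normal:
  assumes c: "\<And>g. g \<in> carrier G \<Longrightarrow> commutator G x g \<in> U"
  shows "adjoin G x U \<lhd> G"
proof (rule normal_invI[OF subgroup_adjoin])
  fix g a assume g: "g \<in> carrier G" and "a \<in> adjoin G x U"
  then obtain i u where u: "u \<in> U" and a: "a = x [^] (i::nat) \<otimes> u" by (auto simp: adjoin_def)
  have ci: "commutator G (x [^] i) g \<in> U"
    by (rule commutator_nat_pow_closed[OF x_closed c g])
  have "g \<otimes> a \<otimes> inv g =
      x [^] i \<otimes> ((inv (x [^] i) \<otimes> inv (commutator G (x [^] i) g) \<otimes> x [^] i) \<otimes> (g \<otimes> u \<otimes> inv g))"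
    using u x_closed g unfolding a by (simp add: group_word)
  moreover have "(inv (x [^] i) \<otimes> inv (commutator G (x [^] i) g) \<otimes> x [^] i) \<otimes> (g \<otimes> u \<otimes> inv g) \<in> U"
    using ci u g inv_op_closed2 pow_conj_closed by simp
  ultimately show "g \<otimes> a \<otimes> inv g \<in> adjoin G x U" using mem_adjoin by presburger
qed

end

subsection \<open>Covering by cosets and central chains in p-groups\<close>

text \<open>Replaces "\<open>|B : B \<inter> N| \<le> k\<close>" by a statement inside the one group \<open>G\<close>: in an induction along a chain of
  subgroups \<open>N\<close> the quotients by \<open>N\<close> would change their type.\<close>

definition covered :: "('a, 'b) monoid_scheme \<Rightarrow> nat \<Rightarrow> 'a set \<Rightarrow> 'a set \<Rightarrow> bool" where
  "covered G k B N \<longleftrightarrow> (\<exists>T. T \<subseteq> carrier G \<and> finite T \<and> card T \<le> k \<and> B \<subseteq> N <#>\<^bsub>G\<^esub> T)"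

lemma set_mult_eq_image: "A <#>\<^bsub>G\<^esub> B = (\<lambda>(a, b). a \<otimes>\<^bsub>G\<^esub> b) ` (A \<times> B)"
  by (auto simp: set_mult_def)

lemma finite_set_mult: "finite A \<Longrightarrow> finite B \<Longrightarrow> finite (A <#>\<^bsub>G\<^esub> B)"
  by (simp add: set_mult_eq_image)

lemma card_set_mult_le: "finite A \<Longrightarrow> finite B \<Longrightarrow> card (A <#>\<^bsub>G\<^esub> B) \<le> card A * card B"
  unfolding set_mult_eq_image by (metis card_cartesian_product card_image_le finite_cartesian_product)

lemma covered_mono: "covered G k B N \<Longrightarrow> k \<le> l \<Longrightarrow> B' \<subseteq> B \<Longrightarrow> covered G l B' N"
  unfolding covered_def by (meson order_trans)

lemma covered_finite:
  assumes "covered G k B N" "finite N"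
  shows "finite B" "card B \<le> card N * k"
proof -
  obtain T where T: "finite T" "card T \<le> k" "B \<subseteq> N <#>\<^bsub>G\<^esub> T" using assms(1) by (auto simp: covered_def)
  show "finite B" using T assms(2) finite_set_mult finite_subset by metis
  have "card B \<le> card (N <#>\<^bsub>G\<^esub> T)" using T assms(2) by (simp add: card_mono finite_set_mult)
  also have "\<dots> \<le> card N * card T" using T assms(2) by (simp add: card_set_mult_le)
  also have "\<dots> \<le> card N * k" using T by simp
  finally show "card B \<le> card N * k" .
qed

context group
begin

lemma covered_refl: "N \<subseteq> carrier G \<Longrightarrow> covered G 1 N N"
  unfolding covered_def by (rule exI[where x = "{\<one>}"]) (force simp: set_mult_def)

lemma covered_trans:
  assumes "covered G k B N" "covered G l N M" "M \<subseteq> carrier G"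
  shows "covered G (k * l) B M"
proof -
  obtain S where S: "S \<subseteq> carrier G" "finite S" "card S \<le> k" "B \<subseteq> N <#> S"
    using assms(1) by (auto simp: covered_def)
  obtain T where T: "T \<subseteq> carrier G" "finite T" "card T \<le> l" "N \<subseteq> M <#> T"
    using assms(2) by (auto simp: covered_def)
  have "B \<subseteq> (M <#> T) <#> S" using S T mono_set_mult by (metis order_refl order_trans)
  also have "\<dots> = M <#> (T <#> S)" using S T assms(3) by (simp add: set_mult_assoc)
  finally have "B \<subseteq> M <#> (T <#> S)" .
  moreover have "card (T <#> S) \<le> k * l"
    using card_set_mult_le[of T S G] S T by (metis mult.commute mult_le_mono order_trans)
  ultimately show ?thesis
    unfolding covered_def using S T finite_set_mult set_mult_closed by metis
qed

lemma covered_rcosets: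
  assumes "finite \<C>" "\<C> \<subseteq> rcosets N" "B \<subseteq> \<Union>\<C>" "N \<subseteq> carrier G"
  shows "covered G (card \<C>) B N"
proof -
  have "\<forall>c\<in>\<C>. \<exists>g\<in>carrier G. c = N #> g" using assms(2) by (auto simp: RCOSETS_def)
  then obtain f where f: "\<And>c. c \<in> \<C> \<Longrightarrow> f c \<in> carrier G \<and> c = N #> f c" by metis
  have "B \<subseteq> N <#> f ` \<C>"
  proof
    fix b assume "b \<in> B"
    then obtain c where c: "c \<in> \<C>" "b \<in> c" using assms by blast
    then have "b \<in> N #> f c" using f by metis
    then show "b \<in> N <#> f ` \<C>" using c by (auto simp: r_coset_def set_mult_def)
  qed
  then show ?thesis
    unfolding covered_def using assms f by (intro exI[of _ "f ` \<C>"]) (auto simp: card_image_le)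
qed

section \<open>Orders of subgroups generated over a subgroup containing the commutators\<close>

lemma generate_insert_subset_adjoin:
  assumes "adjoin_normal (generate G B) G x k"
  shows "generate G (insert x B) \<subseteq> adjoin G x (generate G B)"
proof -
  interpret adjoin_normal "generate G B" G x k by fact
  show ?thesis
    using self_in_adjoin subset_adjoin subgroup_adjoin
    by (intro generate_subgroup_incl) (auto intro: generate.incl)
qed

lemma adjoin_subset_subgroup:
  assumes "subgroup H G" "x \<in> H" "U \<subseteq> H" shows "adjoin G x U \<subseteq> H"
proof -
  interpret subgroup H G by fact
  have "x [^] (i::nat) \<in> H" for i using assms by (induction i) auto
  then show ?thesis using assms by (auto simp: adjoin_def)
qed

lemma subgroup_generate_if_derived_subset:
  assumes "derived G (carrier G) \<subseteq> U" "U \<subseteq> carrier G" "S \<subseteq> carrier G"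
  shows "generate G (U \<union> S) \<lhd> G"
proof (rule normal_if_derived_subset)
  show "subgroup (generate G (U \<union> S)) G" using assms by (intro generate_is_subgroup) auto
  show "derived G (carrier G) \<subseteq> generate G (U \<union> S)"
    using assms by (auto intro: generate.incl)
qed

text \<open>Adjoin the elements of \<open>S\<close> one at a time: each intermediate subgroup
  contains the derived subgroup, hence is normal, and adjoining \<open>x\<close> multiplies the
  order by at most \<open>n x\<close>. Finiteness belongs to the conclusion because one application
  is to a tensor product not yet known to be finite.\<close>

lemma generate_finite_card_le_prod:
  assumes U: "subgroup U G" "derived G (carrier G) \<subseteq> U" "finite U"
    and S: "finite S" "S \<subseteq> carrier G" and n: "\<And>x. x \<in> S \<Longrightarrow> 0 < (n x :: nat) \<and> x [^] n x \<in> U"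
  shows "finite (generate G (U \<union> S)) \<and> card (generate G (U \<union> S)) \<le> card U * (\<Prod>x\<in>S. n x)"
  using S n
proof (induction S)
  case empty
  have "generate G U = U" using U by (metis generateI order_refl)
  then show ?case using U by simp
next
  case (insert x S)
  let ?V = "generate G (U \<union> S)"
  have UG: "U \<subseteq> carrier G" using U subgroup.subset by blast
  have "?V \<lhd> G" using insert UG U by (intro subgroup_generate_if_derived_subset) auto
  moreover have "x [^] n x \<in> ?V" using insert by (auto intro: generate.incl)
  ultimately interpret adjoin_normal ?V G x "n x"
    using insert by (auto simp: adjoin_normal_def adjoin_normal_axioms_def)
  have IH: "finite ?V" "card ?V \<le> card U * (\<Prod>x\<in>S. n x)" using insert by auto
  have fin: "finite (adjoin G x ?V)"
    using bij_betw_finite[OF bij_betw_adjoin] IH by simp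
  have sub: "generate G (U \<union> insert x S) \<subseteq> adjoin G x ?V"
    using generate_insert_subset_adjoin[OF adjoin_normal_axioms] by simp
  have "card (generate G (U \<union> insert x S)) \<le> card (adjoin G x ?V)"
    using sub fin by (rule card_mono[rotated])
  also have "\<dots> \<le> n x * card ?V"
    by (simp add: card_adjoin rel_ord_le)
  also have "\<dots> \<le> n x * (card U * (\<Prod>x\<in>S. n x))"
    using IH by simp
  finally show ?case
    using insert finite_subset[OF sub fin] by (simp add: ac_simps)
qed

end

text \<open>Orbits of a p-group have p-power size, so those without a fixed point have size
  divisible by p. If \<open>y0\<close> were the only fixed point, card \<open>Y\<close> would be 1
  modulo p.\<close>

lemma (in group_action) exists_fixed_point_ne:
  assumes p: "Factorial_Ring.prime (p::nat)" and G: "order G = p ^ m"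
    and Y: "Y \<subseteq> E" "finite Y" "p dvd card Y" and inv: "\<And>g y. g \<in> carrier G \<Longrightarrow> y \<in> Y \<Longrightarrow> \<phi> g y \<in> Y"
    and y0: "y0 \<in> Y" "\<And>g. g \<in> carrier G \<Longrightarrow> \<phi> g y0 = y0"
  shows "\<exists>y\<in>Y. y \<noteq> y0 \<and> (\<forall>g\<in>carrier G. \<phi> g y = y)"
proof (rule ccontr)
  assume "\<not> ?thesis"
  then have nofix: "\<exists>g\<in>carrier G. \<phi> g y \<noteq> y" if "y \<in> Y" "y \<noteq> y0" for y using that by blast
  interpret G: group G using group_hom group_hom.axioms(1) by blast
  have self: "y \<in> orbit G \<phi> y" if "y \<in> Y" for y using orbit_refl that Y by blast
  have orb: "orbit G \<phi> y \<subseteq> Y" if "y \<in> Y" for y using inv that by (auto simp: orbit_def)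
  have eq: "orbit G \<phi> y = orbit G \<phi> z" if "y \<in> Y" "z \<in> Y" "w \<in> orbit G \<phi> y" "w \<in> orbit G \<phi> z" for y z w
  proof -
    have "w \<in> Y" using that orb by blast
    have "orbit G \<phi> y = orbit G \<phi> w" if "y \<in> Y" "w \<in> orbit G \<phi> y" for y
      using that \<open>w \<in> Y\<close> Y orb orbit_sym orbit_trans by (meson subsetD subsetI subset_antisym)
    then show ?thesis using that by metis
  qed
  have y0orb: "orbit G \<phi> y0 = {y0}" using y0 self by (auto simp: orbit_def)
  have dvd: "p dvd card (orbit G \<phi> y)" if y: "y \<in> Y" "y \<noteq> y0" for y
  proof -
    have "card (orbit G \<phi> y) dvd p ^ m"
      using orbit_stabilizer_theorem[of y] y Y G by (metis dvd_triv_left subsetD)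
    then obtain i where i: "card (orbit G \<phi> y) = p ^ i" using p divides_primepow_nat by blast
    obtain g where g: "g \<in> carrier G" "\<phi> g y \<noteq> y" using nofix[OF y] by blast
    then have "{y, \<phi> g y} \<subseteq> orbit G \<phi> y" using self y by (auto simp: orbit_def)
    then have "card {y, \<phi> g y} \<le> card (orbit G \<phi> y)"
      using orb y Y finite_subset by (metis card_mono)
    then have "i \<noteq> 0" using i g by (intro notI) auto
    then show ?thesis using i by (simp add: dvd_power)
  qed
  let ?O = "orbit G \<phi> ` Y"
  have fO: "finite ?O" "\<And>R. R \<in> ?O \<Longrightarrow> finite R" using Y orb finite_subset by blast+
  have "\<Union>?O = Y" using self orb by blast
  then have "card Y = card (\<Union>?O)" by simp
  also have "\<dots> = (\<Sum>R\<in>?O. card R)"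
  proof (rule card_Union_disjoint)
    show "disjoint ?O" unfolding pairwise_def disjnt_iff using eq by blast
  qed (use fO in auto)
  also have "\<dots> = card {y0} + (\<Sum>R\<in>?O - {{y0}}. card R)"
    using fO y0orb y0 by (intro sum.remove) auto
  finally have "card Y = 1 + (\<Sum>R\<in>?O - {{y0}}. card R)" by simp
  moreover have "p dvd (\<Sum>R\<in>?O - {{y0}}. card R)"
    using dvd y0orb by (intro dvd_sum) auto
  ultimately have "p dvd 1" using Y by (metis dvd_add_left_iff)
  then show False using p by simp
qed

text \<open>The nontrivial normal subgroup Y/U of the p-group G/U contains a nontrivial central
  element, found as a fixed point of conjugation other than the identity. A suitable power of it has
  order p modulo \<open>U\<close>.\<close>

lemma (in group) p_group_central_step:
  assumes p: "Factorial_Ring.prime (p::nat)" and G: "order G = p ^ m"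
    and U: "U \<lhd> G" and Y: "Y \<lhd> G" and UY: "U \<subset> Y"
  shows "\<exists>c\<in>Y - U. (\<forall>g\<in>carrier G. commutator G c g \<in> U) \<and> c [^] p \<in> U"
proof -
  interpret U: normal U G by fact
  interpret Y: normal Y G by fact
  interpret H: group "G Mod U" by (rule U.factorgroup_is_group)
  interpret q: group_hom G "G Mod U" "\<lambda>x. U #> x"
    using U.r_coset_hom_Mod by (simp add: group_hom_def group_hom_axioms_def H.group_axioms)
  have fin: "finite (carrier G)" using G p by (metis order_gt_0_iff_finite prime_gt_0_nat zero_less_power)
  have mem: "U #> x = U \<longleftrightarrow> x \<in> U" if "x \<in> carrier G" for x
    using that coset_join1 coset_join2 U.subset U.subgroup_axioms by metis
  let ?Y = "(\<lambda>x. U #> x) ` Y"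
  have oH: "order (G Mod U) dvd p ^ m"
    using lagrange[OF U.subgroup_axioms] G by (metis FactGroup_def dvd_triv_left order_def partial_object.select_convs(1))
  then obtain m' where m': "order (G Mod U) = p ^ m'" using p divides_primepow_nat by blast
  have sY: "subgroup ?Y (G Mod U)" by (rule q.subgroup_img_is_subgroup) (rule Y.subgroup_axioms)
  then have "card ?Y dvd order (G Mod U)" using H.lagrange by (metis dvd_triv_right)
  then obtain i where i: "card ?Y = p ^ i" using m' p divides_primepow_nat by metis
  have finY: "finite ?Y" using fin Y.subset finite_subset by blast
  obtain y where y: "y \<in> Y" "y \<notin> U" using UY by blast
  then have "{U, U #> y} \<subseteq> ?Y" using q.hom_one Y.one_closed by (metis empty_subsetI image_eqI insert_subset one_FactGroup)
  then have "card {U, U #> y} \<le> card ?Y" using finY card_mono by blast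
  moreover have "U #> y \<noteq> U" using y mem Y.subset by blast
  ultimately have "i \<noteq> 0" using i by (intro notI) auto
  then have pY: "p dvd card ?Y" using i by simp
  interpret a: group_action "G Mod U" "carrier (G Mod U)"
    "\<lambda>g. \<lambda>h\<in>carrier (G Mod U). g \<otimes>\<^bsub>G Mod U\<^esub> h \<otimes>\<^bsub>G Mod U\<^esub> inv\<^bsub>G Mod U\<^esub> g"
    by (rule H.action_by_conjugation)
  have "\<exists>z\<in>?Y. z \<noteq> \<one>\<^bsub>G Mod U\<^esub> \<and> (\<forall>g\<in>carrier (G Mod U).
      (\<lambda>h\<in>carrier (G Mod U). g \<otimes>\<^bsub>G Mod U\<^esub> h \<otimes>\<^bsub>G Mod U\<^esub> inv\<^bsub>G Mod U\<^esub> g) z = z)"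
  proof (rule a.exists_fixed_point_ne[OF p m' _ finY pY])
    show "?Y \<subseteq> carrier (G Mod U)" using sY subgroup.subset by blast
    show "\<one>\<^bsub>G Mod U\<^esub> \<in> ?Y" using sY subgroup.one_closed by blast
  next
    fix g z assume "g \<in> carrier (G Mod U)" "z \<in> ?Y"
    then obtain g' z' where g': "g' \<in> carrier G" "g = U #> g'" and z': "z' \<in> Y" "z = U #> z'"
      by (auto simp: carrier_FactGroup)
    then have z'c: "z' \<in> carrier G" using Y.subset by blast
    have "g \<otimes>\<^bsub>G Mod U\<^esub> z \<otimes>\<^bsub>G Mod U\<^esub> inv\<^bsub>G Mod U\<^esub> g = U #> (g' \<otimes> z' \<otimes> inv g')"
      using g' z' z'c q.hom_mult q.hom_inv by (metis inv_closed m_closed)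
    moreover have "g' \<otimes> z' \<otimes> inv g' \<in> Y" using Y.inv_op_closed2 g' z' by blast
    moreover have "z \<in> carrier (G Mod U)" using z' z'c by (auto simp: carrier_FactGroup)
    ultimately show "(\<lambda>h\<in>carrier (G Mod U). g \<otimes>\<^bsub>G Mod U\<^esub> h \<otimes>\<^bsub>G Mod U\<^esub> inv\<^bsub>G Mod U\<^esub> g) z \<in> ?Y"
      by (metis image_eqI restrict_apply')
  qed (simp only: restrict_apply' H.one_closed H.r_one H.r_inv)
  then obtain z0 where z0: "z0 \<in> ?Y" "z0 \<noteq> U" and zf0: "\<And>g. g \<in> carrier (G Mod U) \<Longrightarrow>
      (\<lambda>h\<in>carrier (G Mod U). g \<otimes>\<^bsub>G Mod U\<^esub> h \<otimes>\<^bsub>G Mod U\<^esub> inv\<^bsub>G Mod U\<^esub> g) z0 = z0"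
    unfolding one_FactGroup by blast
  then obtain z where z: "z \<in> Y" "U #> z \<noteq> U" and zf: "\<And>g. g \<in> carrier (G Mod U) \<Longrightarrow>
      (\<lambda>h\<in>carrier (G Mod U). g \<otimes>\<^bsub>G Mod U\<^esub> h \<otimes>\<^bsub>G Mod U\<^esub> inv\<^bsub>G Mod U\<^esub> g) (U #> z) = U #> z"
    by blast
  have zc: "z \<in> carrier G" using z Y.subset by blast
  have zcomm: "commutator G z g \<in> U" if g: "g \<in> carrier G" for g
  proof -
    have gz: "U #> g \<in> carrier (G Mod U)" "U #> z \<in> carrier (G Mod U)" using g zc by (auto simp: carrier_FactGroup)
    then have "(U #> g) \<otimes>\<^bsub>G Mod U\<^esub> (U #> z) \<otimes>\<^bsub>G Mod U\<^esub> inv\<^bsub>G Mod U\<^esub> (U #> g) = U #> z"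
      using zf[of "U #> g"] by (simp only: restrict_apply' gz)
    then have "(U #> z) \<otimes>\<^bsub>G Mod U\<^esub> (U #> g) = (U #> g) \<otimes>\<^bsub>G Mod U\<^esub> (U #> z)"
      using gz by (metis H.inv_closed H.inv_solve_right H.m_closed)
    then have "commutator (G Mod U) (U #> z) (U #> g) = \<one>\<^bsub>G Mod U\<^esub>"
      using gz by (simp add: H.commutator_eq_one_iff del: mult_FactGroup one_FactGroup)
    then have "U #> commutator G z g = U"
      using q.hom_commutator[OF zc g] by simp
    then show ?thesis using mem[of "commutator G z g"] zc g by simp
  qed
  \<comment> \<open>The last p-power of z outside \<open>U\<close> has its p-th power in
    \<open>U\<close>, and as a power of z it stays central modulo \<open>U\<close>.\<close>
  define j where "j = (LEAST j. z [^] (p ^ j) \<in> U)"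
  have "z [^] (p ^ m) \<in> U" using pow_order_eq_1[OF zc] G by simp
  then have j: "z [^] (p ^ j) \<in> U" unfolding j_def by (rule LeastI)
  have "j \<noteq> 0" using j z mem zc by (intro notI) simp
  then have j1: "z [^] (p ^ (j - 1)) \<notin> U" using not_less_Least[of "j - 1" "\<lambda>j. z [^] (p ^ j) \<in> U"] by (simp add: j_def)
  let ?c = "z [^] (p ^ (j - 1))"
  have "?c [^] p = z [^] (p ^ j)"
    using zc \<open>j \<noteq> 0\<close> by (simp add: nat_pow_pow power_eq_if mult.commute)
  moreover have "z [^] (i::nat) \<in> Y" for i using z(1) by (induction i) auto
  ultimately show ?thesis
    using j j1 U.commutator_nat_pow_closed[OF zc zcomm] by (intro bexI[of _ ?c]) auto
qed

text \<open>An induction principle in place of an explicit chain: \<open>P\<close> is carried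
  upwards inside \<open>Y\<close> by central steps of order p. The climb can be stopped at any order
  \<open>p ^ k\<close>, which allows the last step below [Q, Q] to be treated separately.\<close>

lemma (in group) p_group_central_chain:
  assumes p: "Factorial_Ring.prime (p::nat)" and G: "order G = p ^ m"
    and Y: "Y \<lhd> G" "card Y = p ^ r" and k: "k \<le> r"
    and base: "P {\<one>}"
    and step: "\<And>U c. U \<lhd> G \<Longrightarrow> U \<subseteq> Y \<Longrightarrow> c \<in> Y - U \<Longrightarrow> c [^] p \<in> U \<Longrightarrow>
      (\<And>g. g \<in> carrier G \<Longrightarrow> commutator G c g \<in> U) \<Longrightarrow> P U \<Longrightarrow> P (adjoin G c U)"
  shows "\<exists>U. U \<lhd> G \<and> U \<subseteq> Y \<and> card U = p ^ k \<and> P U"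
  using k
proof (induction k)
  case 0
  then show ?case
    using base one_is_normal subgroup.one_closed[OF normal_imp_subgroup[OF Y(1)]] by (intro exI[of _ "{\<one>}"]) auto
next
  case (Suc k)
  then obtain U where U: "U \<lhd> G" "U \<subseteq> Y" "card U = p ^ k" "P U" by auto
  interpret Y: normal Y G by fact
  have "U \<noteq> Y" using U(3) Y(2) Suc.prems power_inject_exp[OF prime_gt_1_nat[OF p], of k r] by auto
  then obtain c where c: "c \<in> Y - U" "\<And>g. g \<in> carrier G \<Longrightarrow> commutator G c g \<in> U" "c [^] p \<in> U"
    using p_group_central_step[OF p G U(1) Y(1)] U by blast
  have cc: "c \<in> carrier G" using c Y.subset by blast
  interpret adjoin_normal U G c p
    using U(1) c cc p by (simp add: adjoin_normal_def adjoin_normal_axioms_def prime_gt_0_nat)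
  have "rel_ord dvd p" using pow_in_iff[of p] c by simp
  moreover have "rel_ord \<noteq> 1" using pow_in_iff[of 1] c cc by auto
  ultimately have "rel_ord = p" using p by (metis prime_nat_iff)
  then have "card (adjoin G c U) = p ^ Suc k" using card_adjoin U by simp
  moreover have "adjoin G c U \<subseteq> Y" using c U Y.subgroup_axioms by (intro adjoin_subset_subgroup) auto
  ultimately show ?case
    using adjoin_normal c step U by (intro exI[of _ "adjoin G c U"]) auto
qed

text \<open>Each element adjoined outside the current subgroup multiplies its order by at least p.
  With \<open>U\<close> the derived subgroup this supplies the generating set behind the second
  inequality.\<close>

lemma (in group) p_group_generators_over:
  assumes p: "Factorial_Ring.prime (p::nat)" and G: "order G = p ^ m"
    and U: "subgroup U G" "derived G (carrier G) \<subseteq> U" "card U = p ^ k"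
  shows "\<exists>S. S \<subseteq> carrier G \<and> finite S \<and> card S \<le> m - k \<and> generate G (U \<union> S) = carrier G"
  using U
proof (induction "m - k" arbitrary: U k rule: less_induct)
  case less
  interpret U: normal U G using less.prems by (intro normal_if_derived_subset)
  have fin: "finite (carrier G)" using G p by (metis order_gt_0_iff_finite prime_gt_0_nat zero_less_power)
  show ?case
  proof (cases "U = carrier G")
    case True
    have "generate G U = U" using U.subgroup_axioms by (metis generateI order_refl)
    then show ?thesis using True by (intro exI[of _ "{}"]) auto
  next
    case False
    then obtain x where x: "x \<in> carrier G" "x \<notin> U" using U.subset by blast
    have "x [^] (p ^ m) \<in> U" using pow_order_eq_1[OF x(1)] G by simp
    then interpret adjoin_normal U G x "p ^ m"
      using x p U.normal_axioms by (simp add: adjoin_normal_def adjoin_normal_axioms_def prime_gt_0_nat)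
    have dG: "card (adjoin G x U) dvd p ^ m"
      using lagrange[OF subgroup_adjoin] G by (metis dvd_triv_right)
    then obtain l where l: "card (adjoin G x U) = p ^ l" using p divides_primepow_nat by metis
    have lm: "l \<le> m" using dG l p by (metis dvd_power_iff_le prime_ge_2_nat)
    have "U \<subset> adjoin G x U" using subset_adjoin self_in_adjoin x by blast
    then have "card U < card (adjoin G x U)"
      using fin subgroup_adjoin finite_subset subgroup.subset by (metis psubset_card_mono)
    then have kl: "k < l" using l less.prems p by (metis power_less_imp_less_exp prime_gt_1_nat)
    have dl: "derived G (carrier G) \<subseteq> adjoin G x U" using less.prems(2) subset_adjoin by blast
    obtain S where S: "S \<subseteq> carrier G" "finite S" "card S \<le> m - l" "generate G (adjoin G x U \<union> S) = carrier G"
      using less.hyps[of l "adjoin G x U", OF _ subgroup_adjoin _ l] dl diff_less_mono2[of k l m] lm kl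
      by (metis order_less_le_trans)
    have sub: "insert x S \<subseteq> carrier G" using S x by simp
    have gs: "subgroup (generate G (U \<union> insert x S)) G"
      using sub U.subset by (intro generate_is_subgroup) auto
    have "adjoin G x U \<subseteq> generate G (U \<union> insert x S)"
      using gs by (intro adjoin_subset_subgroup) (auto intro: generate.incl)
    then have "carrier G \<subseteq> generate G (U \<union> insert x S)"
      unfolding S(4)[symmetric] using gs by (intro generate_subgroup_incl) (auto intro: generate.incl)
    then have "generate G (U \<union> insert x S) = carrier G" using gs subgroup.subset by blast
    moreover have "card (insert x S) \<le> m - k"
      using S kl lm card_insert_le_m1[of "m - k" S x] by simp
    ultimately show ?thesis using S sub by (intro exI[of _ "insert x S"]) auto
  qed
qed

subsection \<open>Commutators with a central section\<close>

lemma (in group_hom) card_image_kernel: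
  assumes "finite (carrier G)"
  shows "card (h ` carrier G) * card (kernel G H h) = order G"
proof -
  have fib: "{x \<in> carrier G. h x = h a} = kernel G H h #> a" if a: "a \<in> carrier G" for a
  proof safe
    fix x assume x: "x \<in> carrier G" "h x = h a"
    then have "x \<otimes> inv a \<in> kernel G H h" using a by (simp add: kernel_def)
    moreover have "x = x \<otimes> inv a \<otimes> a" using x a by (simp add: G.m_assoc)
    ultimately show "x \<in> kernel G H h #> a" by (auto simp: r_coset_def)
  qed (use a in \<open>auto simp: r_coset_def kernel_def\<close>)
  have "order G = (\<Sum>y\<in>h ` carrier G. card {x \<in> carrier G. h x = y})"
    unfolding order_def card_eq_sum by (rule sum.group[symmetric]) (use assms in auto)
  also have "\<dots> = (\<Sum>y\<in>h ` carrier G. card (kernel G H h))"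
  proof (rule sum.cong)
    fix y assume "y \<in> h ` carrier G"
    then obtain a where a: "a \<in> carrier G" "y = h a" by auto
    have "kernel G H h #> a \<in> rcosets (kernel G H h)" using a by (auto simp: RCOSETS_def)
    then show "card {x \<in> carrier G. h x = y} = card (kernel G H h)"
      using fib[OF a(1)] a G.card_rcosets_equal subgroup.subset[OF subgroup_kernel] by metis
  qed simp
  finally show ?thesis by simp
qed

section \<open>Preimages and commutators along an epimorphism\<close>

locale group_epi = group_hom E Q \<pi> for E (structure) and Q (structure) and \<pi> +
  assumes surj: "\<pi> ` carrier E = carrier Q"
begin

lemma surjE:
  assumes "x \<in> carrier Q" obtains e where "e \<in> carrier E" "\<pi> e = x"
  using assms unfolding surj[symmetric] by (auto simp: image_iff)

definition preim where "preim U = {e \<in> carrier E. \<pi> e \<in> U}"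

text \<open>This is N(U) of the overview.\<close>

definition lift_comm where "lift_comm U = commutator_subgroup E (preim U) (carrier E)"

lemma preim_subset: "preim U \<subseteq> carrier E"
  by (auto simp: preim_def)

lemma lift_comm_gens: "{commutator E x y |x y. x \<in> preim U \<and> y \<in> carrier E} \<subseteq> carrier E"
  using preim_subset by (blast intro: G.commutator_closed)

lemma preim_normal: assumes "U \<lhd> Q" shows "preim U \<lhd> E"
proof -
  interpret U: normal U Q by fact
  show ?thesis
  proof (rule G.normal_invI)
    show "subgroup (preim U) E"
      by (rule G.subgroupI) (auto simp: preim_def intro: exI[of _ "\<one>\<^bsub>E\<^esub>"])
    show "g \<otimes> h \<otimes> inv g \<in> preim U" if "g \<in> carrier E" "h \<in> preim U" for g h
      using that U.inv_op_closed2 by (simp add: preim_def)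
  qed
qed

lemma lift_comm_normal: assumes "U \<lhd> Q" shows "lift_comm U \<lhd> E"
proof -
  interpret P: normal "preim U" E using assms by (rule preim_normal)
  show ?thesis
    unfolding lift_comm_def commutator_subgroup_eq
  proof (rule G.normal_generateI)
    show "{commutator E x y |x y. x \<in> preim U \<and> y \<in> carrier E} \<subseteq> carrier E"
      by (rule lift_comm_gens)
    fix h g assume "h \<in> {commutator E x y |x y. x \<in> preim U \<and> y \<in> carrier E}" and g: "g \<in> carrier E"
    then obtain x y where h: "h = commutator E x y" and x: "x \<in> preim U" and y: "y \<in> carrier E" by blast
    have xc: "x \<in> carrier E" using x preim_subset by blast
    have "g \<otimes> h \<otimes> inv g = commutator E (g \<otimes> x \<otimes> inv g) (g \<otimes> y \<otimes> inv g)"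
      using xc y g unfolding h by (simp add: G.group_word)
    then show "g \<otimes> h \<otimes> inv g \<in> {commutator E x y |x y. x \<in> preim U \<and> y \<in> carrier E}"
      using P.inv_op_closed2[OF g x] y g by blast
  qed
qed

lemma commutator_in_lift_comm:
  "x \<in> carrier E \<Longrightarrow> \<pi> x \<in> U \<Longrightarrow> y \<in> carrier E \<Longrightarrow> commutator E x y \<in> lift_comm U"
  unfolding lift_comm_def commutator_subgroup_eq by (rule generate.incl) (auto simp: preim_def)

lemma lift_comm_subset: "lift_comm U \<subseteq> carrier E"
  unfolding lift_comm_def commutator_subgroup_eq by (rule G.generate_incl) (rule lift_comm_gens)

lemma lift_comm_carrier: "lift_comm (carrier Q) = derived E (carrier E)"
proof -
  have "preim (carrier Q) = carrier E" by (auto simp: preim_def)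
  then show ?thesis by (simp add: lift_comm_def commutator_subgroup_def derived_def)
qed

end

text \<open>The map \<open>e \<mapsto> [c', e]\<close> modulo \<open>lift_comm U\<close> factors through \<open>Q\<close>, and its image measures the
  growth of \<open>lift_comm\<close> from \<open>U\<close> to \<open>\<langle>\<pi> c'\<rangle>U\<close>.\<close>

locale central_step = group_epi + U: normal U Q for U +
  fixes c'
  assumes c'_closed: "c' \<in> carrier E"
    and c_comm: "\<And>q. q \<in> carrier Q \<Longrightarrow> commutator Q (\<pi> c') q \<in> U"
begin

abbreviation "M \<equiv> E Mod lift_comm U"
abbreviation "proj e \<equiv> lift_comm U #> e"
abbreviation "\<gamma> \<equiv> proj c'"

sublocale N: normal "lift_comm U" E
  by (rule lift_comm_normal) (rule U.normal_axioms)

sublocale M: group M by (rule N.factorgroup_is_group)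

sublocale proj: group_hom E M proj
  using N.r_coset_hom_Mod by (simp add: group_hom_def group_hom_axioms_def M.group_axioms)

lemma carrier_M: "carrier M = proj ` carrier E"
  by (simp add: carrier_FactGroup)

text \<open>The commutators of elements over \<open>U\<close> with \<open>E\<close> are exactly the
  generators of \<open>lift_comm U\<close>, so the quotient makes these elements central. The other
  centrality facts about \<open>M\<close> come from here.\<close>

lemma proj_preim_central:
  assumes "x \<in> carrier E" "\<pi> x \<in> U" shows "proj x \<in> center M"
proof -
  have "proj x \<otimes>\<^bsub>M\<^esub> proj e = proj e \<otimes>\<^bsub>M\<^esub> proj x" if e: "e \<in> carrier E" for e
  proof -
    have "proj (commutator E x e) = \<one>\<^bsub>M\<^esub>"
      using commutator_in_lift_comm[OF assms e] G.coset_join2[OF _ N.subgroup_axioms]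
        assms e by simp
    then show ?thesis
      using assms e by (simp add: proj.hom_commutator M.commutator_eq_one_iff del: mult_FactGroup one_FactGroup)
  qed
  then show ?thesis using assms unfolding center_def carrier_M by blast
qed

lemma commutator_central:
  assumes "g \<in> carrier M" shows "commutator M \<gamma> g \<in> center M"
proof -
  obtain e where e: "e \<in> carrier E" "g = proj e" using assms unfolding carrier_M by blast
  have "\<pi> (commutator E c' e) \<in> U" using c_comm e c'_closed by (simp add: hom_commutator)
  then have "proj (commutator E c' e) \<in> center M" using e c'_closed by (intro proj_preim_central) auto
  then show ?thesis using e c'_closed by (simp add: proj.hom_commutator)
qed

lemma \<gamma>_closed: "\<gamma> \<in> carrier M"
  using c'_closed by simp

sublocale \<phi>: group_hom M M "commutator M \<gamma>"
  using \<gamma>_closed commutator_central by (rule M.group_hom_commutator)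

definition \<theta> where "\<theta> q = commutator M \<gamma> (proj (SOME e. e \<in> carrier E \<and> \<pi> e = q))"

text \<open>The choice in \<open>\<theta>\<close> does not matter: two lifts of the same element
  differ by something over 1, which lies in \<open>U\<close>, so it becomes central in
  \<open>M\<close> and contributes a trivial commutator.\<close>

lemma \<theta>_\<pi>:
  assumes e: "e \<in> carrier E" shows "\<theta> (\<pi> e) = commutator M \<gamma> (proj e)"
proof -
  define e' where "e' = (SOME e'. e' \<in> carrier E \<and> \<pi> e' = \<pi> e)"
  have e': "e' \<in> carrier E" "\<pi> e' = \<pi> e"
    using someI[of "\<lambda>e'. e' \<in> carrier E \<and> \<pi> e' = \<pi> e" e] e unfolding e'_def by auto
  have "\<pi> (inv e \<otimes> e') \<in> U" using e e' by simp
  then have "proj (inv e \<otimes> e') \<in> center M" using e e' by (intro proj_preim_central) auto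
  then have "commutator M \<gamma> (proj (inv e \<otimes> e')) = \<one>\<^bsub>M\<^esub>"
    by (rule M.center_commutator(2)) (rule \<gamma>_closed)
  moreover have "commutator M \<gamma> (proj (e \<otimes> (inv e \<otimes> e')))
      = commutator M \<gamma> (proj e) \<otimes>\<^bsub>M\<^esub> commutator M \<gamma> (proj (inv e \<otimes> e'))"
    using e e' by (metis G.inv_closed G.m_closed \<phi>.hom_mult proj.hom_closed proj.hom_mult)
  ultimately have "commutator M \<gamma> (proj e') = commutator M \<gamma> (proj e)"
    using e e' by (simp add: G.mult_inv_cancel del: mult_FactGroup one_FactGroup)
  then show ?thesis unfolding \<theta>_def e'_def .
qed

lemma \<theta>_hom: "\<theta> \<in> hom Q M"
proof (rule homI)
  fix x assume "x \<in> carrier Q"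
  then obtain e where e: "e \<in> carrier E" "x = \<pi> e" using surj by blast
  then show "\<theta> x \<in> carrier M" using \<phi>.hom_closed by (simp add: \<theta>_\<pi>)
  fix y assume "y \<in> carrier Q"
  then obtain f where f: "f \<in> carrier E" "y = \<pi> f" using surj by blast
  have "\<theta> (\<pi> (e \<otimes> f)) = \<theta> (\<pi> e) \<otimes>\<^bsub>M\<^esub> \<theta> (\<pi> f)"
    using e f by (simp add: \<theta>_\<pi> proj.hom_mult \<phi>.hom_mult del: hom_mult mult_FactGroup)
  then show "\<theta> (x \<otimes>\<^bsub>Q\<^esub> y) = \<theta> x \<otimes>\<^bsub>M\<^esub> \<theta> y" using e f by simp
qed

sublocale \<theta>: group_hom Q M \<theta>
  using \<theta>_hom by (simp add: group_hom_def group_hom_axioms_def M.group_axioms)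

lemma \<theta>_central:
  assumes "x \<in> carrier Q" shows "\<theta> x \<in> center M"
proof -
  obtain e where e: "e \<in> carrier E" "\<pi> e = x" using surjE[OF assms] .
  then show ?thesis using commutator_central[OF proj.hom_closed[OF e(1)]] \<theta>_\<pi>[OF e(1)] by simp
qed

lemma \<theta>_eq_one:
  assumes "u \<in> U" shows "\<theta> u = \<one>\<^bsub>M\<^esub>"
proof -
  obtain e where e: "e \<in> carrier E" "\<pi> e = u" using surjE[OF U.mem_carrier[OF assms]] .
  then show ?thesis
    using M.center_commutator(2)[OF proj_preim_central[OF e(1)] \<gamma>_closed] assms \<theta>_\<pi>[OF e(1)]
    by (simp del: one_FactGroup)
qed

lemma \<theta>_c: "\<theta> (\<pi> c') = \<one>\<^bsub>M\<^esub>"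
  using c'_closed by (simp add: \<theta>_\<pi> M.commutator_eq_one_iff del: mult_FactGroup one_FactGroup)

lemma derived_subset_kernel: "derived Q (carrier Q) \<subseteq> kernel Q M \<theta>"
  unfolding derived_eq_generate_commutators
proof (rule H.generate_subgroup_incl[OF _ \<theta>.subgroup_kernel], safe)
  fix x y assume "x \<in> carrier Q" "y \<in> carrier Q"
  then show "commutator Q x y \<in> kernel Q M \<theta>"
    using M.center_commutator(1)[OF \<theta>_central \<theta>.hom_closed] by (simp add: kernel_def \<theta>.hom_commutator)
qed

text \<open>\<open>\<theta>\<close> kills \<open>U\<close>, whose lifts are central in
  \<open>M\<close>, and also \<open>\<pi> c'\<close>, because c' commutes with itself. Hence the
  image of \<open>\<theta>\<close> is no larger than the index of
  \<open>adjoin Q (\<pi> c') U\<close>.\<close>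

lemma adjoin_subset_kernel: "adjoin Q (\<pi> c') U \<subseteq> kernel Q M \<theta>"
proof (rule H.adjoin_subset_subgroup[OF \<theta>.subgroup_kernel])
  show "\<pi> c' \<in> kernel Q M \<theta>" using \<theta>_c c'_closed by (simp add: kernel_def)
  show "U \<subseteq> kernel Q M \<theta>" using \<theta>_eq_one U.subset by (auto simp: kernel_def)
qed

lemma proj_adjoin:
  assumes e: "e \<in> carrier E" and "\<pi> e \<in> adjoin Q (\<pi> c') U"
  shows "\<exists>(i::nat) z. z \<in> carrier E \<and> \<pi> z \<in> U \<and> e = c' [^] i \<otimes> z"
proof -
  obtain i u where u: "u \<in> U" "\<pi> e = \<pi> c' [^]\<^bsub>Q\<^esub> (i::nat) \<otimes>\<^bsub>Q\<^esub> u"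
    using assms(2) unfolding adjoin_def by blast
  have uc: "u \<in> carrier Q" using u(1) by (rule U.mem_carrier)
  have "\<pi> (inv (c' [^] i) \<otimes> e) = u"
    using u uc e c'_closed by (simp add: hom_nat_pow H.mult_inv_cancel)
  then show ?thesis
    using u e c'_closed by (intro exI[of _ i] exI[of _ "inv (c' [^] i) \<otimes> e"]) (simp add: G.mult_inv_cancel)
qed

text \<open>In \<open>M\<close> the elements over \<open>adjoin Q (\<pi> c') U\<close> are powers of
  \<open>\<gamma>\<close> times central elements, so all their commutators are values of
  \<open>\<theta>\<close>. A value of \<open>\<theta>\<close> is a coset of
  \<open>lift_comm U\<close>, which explains the union.\<close>

lemma lift_comm_adjoin_subset: "lift_comm (adjoin Q (\<pi> c') U) \<subseteq> \<Union>(\<theta> ` carrier Q)"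
proof
  fix x assume x: "x \<in> lift_comm (adjoin Q (\<pi> c') U)"
  let ?B = "{commutator E x y |x y. x \<in> preim (adjoin Q (\<pi> c') U) \<and> y \<in> carrier E}"
  let ?Z = "proj ` preim U"
  have Z: "?Z \<subseteq> center M" using proj_preim_central by (auto simp: preim_def)
  have B: "?B \<subseteq> carrier E" by (rule lift_comm_gens)
  have "proj x \<in> proj ` generate E ?B" using x unfolding lift_comm_def commutator_subgroup_eq by blast
  also have "\<dots> = generate M (proj ` ?B)" using B by (rule proj.generate_img[symmetric])
  also have "\<dots> \<subseteq> generate M {commutator M x y |x y. x \<in> adjoin M \<gamma> ?Z \<and> y \<in> carrier M}"
  proof (rule M.mono_generate, safe)
    fix a y assume a: "a \<in> preim (adjoin Q (\<pi> c') U)" and y: "y \<in> carrier E"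
    then have ac: "a \<in> carrier E" by (simp add: preim_def)
    obtain i z where z: "z \<in> carrier E" "\<pi> z \<in> U" "a = c' [^] (i::nat) \<otimes> z"
      using proj_adjoin[OF ac] a by (auto simp: preim_def)
    have "proj a = \<gamma> [^]\<^bsub>M\<^esub> i \<otimes>\<^bsub>M\<^esub> proj z"
      using z c'_closed by (simp add: proj.hom_nat_pow proj.hom_mult del: mult_FactGroup)
    then have "proj a \<in> adjoin M \<gamma> ?Z" using z unfolding adjoin_def preim_def by blast
    then show "\<exists>x' y'. proj (commutator E a y) = commutator M x' y' \<and> x' \<in> adjoin M \<gamma> ?Z \<and> y' \<in> carrier M"
      using proj.hom_commutator[OF ac y] proj.hom_closed[OF y] by blast
  qed
  also have "\<dots> = commutator_subgroup M (adjoin M \<gamma> ?Z) (carrier M)"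
    by (simp only: commutator_subgroup_eq)
  also have "\<dots> \<subseteq> commutator M \<gamma> ` carrier M"
    using Z \<gamma>_closed commutator_central by (rule M.commutator_subgroup_adjoin_central)
  finally obtain g where g: "g \<in> carrier M" "proj x = commutator M \<gamma> g" by blast
  then obtain e where e: "e \<in> carrier E" "g = proj e" unfolding carrier_M by blast
  have "proj x = \<theta> (\<pi> e)" using g e by (simp add: \<theta>_\<pi>)
  moreover have "x \<in> proj x" using x lift_comm_subset N.subgroup_axioms by (intro G.rcos_self) auto
  ultimately show "x \<in> \<Union>(\<theta> ` carrier Q)" using e by auto
qed

lemma covered_adjoin:
  assumes "finite (carrier Q)"
  shows "covered E (card (\<theta> ` carrier Q)) (lift_comm (adjoin Q (\<pi> c') U)) (lift_comm U)"
proof (rule G.covered_rcosets)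
  show "\<theta> ` carrier Q \<subseteq> rcosets lift_comm U" using \<theta>.hom_closed by (auto simp: FactGroup_def)
qed (use assms lift_comm_adjoin_subset lift_comm_subset in auto)

text \<open>The p-th power of [\<gamma>, e] is [\<gamma>^p, e], which is trivial because c'^p lies
  over \<open>U\<close>. So p-th powers lie in the kernel, and a set \<open>S\<close> that generates
  \<open>Q\<close> over the kernel bounds the index of the kernel by
  \<open>p ^ card S\<close>.\<close>

lemma card_image_\<theta>_le:
  assumes fin: "finite (carrier Q)" and p: "0 < p" "\<pi> c' [^]\<^bsub>Q\<^esub> (p::nat) \<in> U"
    and S: "S \<subseteq> carrier Q" "generate Q (kernel Q M \<theta> \<union> S) = carrier Q"
  shows "card (\<theta> ` carrier Q) \<le> p ^ card S"
proof -
  have fS: "finite S" using fin S finite_subset by blast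
  have finK: "finite (kernel Q M \<theta>)" using fin by (simp add: kernel_def)
  have "x [^]\<^bsub>Q\<^esub> p \<in> kernel Q M \<theta>" if x: "x \<in> carrier Q" for x
  proof -
    obtain e where e: "e \<in> carrier E" "x = \<pi> e" using x surj by blast
    have "\<gamma> [^]\<^bsub>M\<^esub> p = proj (c' [^] p)" using c'_closed by (simp add: proj.hom_nat_pow)
    also have "\<dots> \<in> center M" using c'_closed p by (intro proj_preim_central) (auto simp: hom_nat_pow)
    finally have "commutator M (\<gamma> [^]\<^bsub>M\<^esub> p) (proj e) = \<one>\<^bsub>M\<^esub>"
      using e by (intro M.center_commutator) auto
    then have "\<theta> x [^]\<^bsub>M\<^esub> p = \<one>\<^bsub>M\<^esub>"
      using e M.commutator_pow_left[OF \<gamma>_closed commutator_central, of "proj e" p]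
      by (simp add: \<theta>_\<pi> del: one_FactGroup)
    then show ?thesis using x by (simp add: kernel_def \<theta>.hom_nat_pow)
  qed
  then have "card (carrier Q) \<le> card (kernel Q M \<theta>) * (\<Prod>x\<in>S. p)"
    using H.generate_finite_card_le_prod[OF \<theta>.subgroup_kernel derived_subset_kernel finK fS S(1), of "\<lambda>_. p"] S p by auto
  then have "card (\<theta> ` carrier Q) * card (kernel Q M \<theta>) \<le> card (kernel Q M \<theta>) * p ^ card S"
    using \<theta>.card_image_kernel[OF fin] by (simp add: order_def)
  moreover have "kernel Q M \<theta> \<noteq> {}" "finite (kernel Q M \<theta>)"
    using subgroup.one_closed[OF \<theta>.subgroup_kernel] fin by (auto simp: kernel_def)
  ultimately show ?thesis by (simp add: mult.commute card_gt_0_iff)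
qed

text \<open>By the Hall-Witt identity the commutators of \<open>[a, b]\<close> with all of \<open>E\<close> are, modulo
  \<open>lift_comm U\<close>, generated by those with \<open>a\<close> and \<open>b\<close>.\<close>

lemma \<theta>_hall_witt:
  assumes ab: "a \<in> carrier E" "b \<in> carrier E" "c' = commutator E a b"
    and D: "derived Q (carrier Q) \<subseteq> adjoin Q (\<pi> c') U" and x: "x \<in> carrier E"
  shows "\<exists>i j. \<pi> x \<otimes>\<^bsub>Q\<^esub> (\<pi> a [^]\<^bsub>Q\<^esub> (i::nat) \<otimes>\<^bsub>Q\<^esub> \<pi> b [^]\<^bsub>Q\<^esub> (j::nat)) \<in> kernel Q M \<theta>"
proof -
  \<comment> \<open>The conjugations in the Hall-Witt identity are invisible here, as the values of
    \<open>\<theta>\<close> are central.\<close>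
  have conj: "commutator M \<gamma> (proj (g \<otimes> h \<otimes> inv g)) = \<theta> (\<pi> h)" if gh: "g \<in> carrier E" "h \<in> carrier E" for g h
  proof -
    have "commutator M \<gamma> (proj (g \<otimes> h \<otimes> inv g)) = \<theta> (\<pi> (g \<otimes> h \<otimes> inv g))"
      using gh by (intro \<theta>_\<pi>[symmetric]) simp
    also have "\<dots> = \<theta> (\<pi> g) \<otimes>\<^bsub>M\<^esub> \<theta> (\<pi> h) \<otimes>\<^bsub>M\<^esub> inv\<^bsub>M\<^esub> \<theta> (\<pi> g)"
      using gh by (simp del: mult_FactGroup)
    also have "\<dots> = \<theta> (\<pi> h)" using gh \<theta>_central by (intro M.center_conj) auto
    finally show ?thesis .
  qed
  \<comment> \<open>[u, v] lies over [Q, Q], hence is c'^i z with z central in \<open>M\<close>; its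
    commutator with a conjugate of h is then the i-th power of
    \<open>\<theta> (\<pi> h)\<close>.\<close>
  have "\<exists>i::nat. commutator M (proj (commutator E u v)) (proj (g \<otimes> h \<otimes> inv g)) = \<theta> (\<pi> h) [^]\<^bsub>M\<^esub> i"
    if uv: "u \<in> carrier E" "v \<in> carrier E" and gh: "g \<in> carrier E" "h \<in> carrier E" for u v g h
  proof -
    have "\<pi> (commutator E u v) \<in> adjoin Q (\<pi> c') U"
      using D uv H.commutator_in_derived by (auto simp: hom_commutator)
    then obtain i z where z: "z \<in> carrier E" "\<pi> z \<in> U" "commutator E u v = c' [^] (i::nat) \<otimes> z"
      using proj_adjoin uv by blast
    then have zc: "proj z \<in> center M" by (simp add: proj_preim_central)
    have ghc: "proj (g \<otimes> h \<otimes> inv g) \<in> carrier M" using gh by (intro proj.hom_closed) auto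
    have "commutator M (proj (commutator E u v)) (proj (g \<otimes> h \<otimes> inv g))
        = commutator M (\<gamma> [^]\<^bsub>M\<^esub> i \<otimes>\<^bsub>M\<^esub> proj z) (proj (g \<otimes> h \<otimes> inv g))"
      using z c'_closed by (simp add: proj.hom_nat_pow proj.hom_mult del: mult_FactGroup)
    also have "\<dots> = commutator M (\<gamma> [^]\<^bsub>M\<^esub> i) (proj (g \<otimes> h \<otimes> inv g))"
      using M.commutator_mult_left[OF M.nat_pow_closed[OF \<gamma>_closed] M.center_closed[OF zc] ghc]
        M.center_commutator(1)[OF zc ghc] \<gamma>_closed ghc
      by (simp del: mult_FactGroup one_FactGroup)
    also have "\<dots> = commutator M \<gamma> (proj (g \<otimes> h \<otimes> inv g)) [^]\<^bsub>M\<^esub> i"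
      using \<gamma>_closed commutator_central ghc by (rule M.commutator_pow_left)
    finally show ?thesis using conj[OF gh] by metis
  qed note pow = this
  obtain i j where ij:
    "commutator M (proj (commutator E b x)) (proj (x \<otimes> a \<otimes> inv x)) = \<theta> (\<pi> a) [^]\<^bsub>M\<^esub> (i::nat)"
    "commutator M (proj (commutator E x a)) (proj (a \<otimes> b \<otimes> inv a)) = \<theta> (\<pi> b) [^]\<^bsub>M\<^esub> (j::nat)"
    using pow[OF ab(2) x x ab(1)] pow[OF x ab(1) ab(1) ab(2)] by blast
  have "commutator E c' (b \<otimes> x \<otimes> inv b) \<otimes> commutator E (commutator E b x) (x \<otimes> a \<otimes> inv x) \<otimes>
      commutator E (commutator E x a) (a \<otimes> b \<otimes> inv a) = \<one>"
    unfolding ab(3) using ab x by (intro G.hall_witt)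
  then have "commutator M \<gamma> (proj (b \<otimes> x \<otimes> inv b)) \<otimes>\<^bsub>M\<^esub>
      commutator M (proj (commutator E b x)) (proj (x \<otimes> a \<otimes> inv x)) \<otimes>\<^bsub>M\<^esub>
      commutator M (proj (commutator E x a)) (proj (a \<otimes> b \<otimes> inv a)) = \<one>\<^bsub>M\<^esub>"
    using ab(1,2) x c'_closed
    by (metis (no_types, lifting) G.commutator_closed G.inv_closed G.m_closed proj.hom_commutator proj.hom_mult proj.hom_one)
  then have "\<theta> (\<pi> x) \<otimes>\<^bsub>M\<^esub> \<theta> (\<pi> a) [^]\<^bsub>M\<^esub> i \<otimes>\<^bsub>M\<^esub> \<theta> (\<pi> b) [^]\<^bsub>M\<^esub> j = \<one>\<^bsub>M\<^esub>"
    unfolding ij conj[OF ab(2) x] .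
  then have "\<theta> (\<pi> x \<otimes>\<^bsub>Q\<^esub> (\<pi> a [^]\<^bsub>Q\<^esub> i \<otimes>\<^bsub>Q\<^esub> \<pi> b [^]\<^bsub>Q\<^esub> j)) = \<one>\<^bsub>M\<^esub>"
    using x ab(1,2) by (simp add: \<theta>.hom_nat_pow M.m_assoc del: mult_FactGroup one_FactGroup)
  then show ?thesis
    using x ab(1,2) by (intro exI[of _ i] exI[of _ j]) (simp add: kernel_def)
qed

text \<open>With this \<open>card_image_\<theta>_le\<close> applies to the two elements
  \<open>\<pi> a\<close> and \<open>\<pi> b\<close> in place of d generators of \<open>Q\<close>,
  which gives the cost p ^ 2.\<close>

lemma generate_kernel_hall_witt:
  assumes ab: "a \<in> carrier E" "b \<in> carrier E" "c' = commutator E a b"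
    and D: "derived Q (carrier Q) \<subseteq> adjoin Q (\<pi> c') U"
  shows "generate Q (kernel Q M \<theta> \<union> {\<pi> a, \<pi> b}) = carrier Q" (is "?R = _")
proof
  have sub: "kernel Q M \<theta> \<union> {\<pi> a, \<pi> b} \<subseteq> carrier Q" using ab by (auto simp: kernel_def)
  interpret R: subgroup ?R Q using sub by (rule H.generate_is_subgroup)
  show "?R \<subseteq> carrier Q" by (rule R.subset)
  show "carrier Q \<subseteq> ?R"
  proof
    fix q assume q: "q \<in> carrier Q"
    then obtain x where x: "x \<in> carrier E" "q = \<pi> x" using surj by blast
    obtain i j where ij: "\<pi> x \<otimes>\<^bsub>Q\<^esub> (\<pi> a [^]\<^bsub>Q\<^esub> (i::nat) \<otimes>\<^bsub>Q\<^esub> \<pi> b [^]\<^bsub>Q\<^esub> (j::nat)) \<in> kernel Q M \<theta>"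
      using \<theta>_hall_witt[OF ab D x(1)] by blast
    let ?w = "\<pi> a [^]\<^bsub>Q\<^esub> i \<otimes>\<^bsub>Q\<^esub> \<pi> b [^]\<^bsub>Q\<^esub> j"
    have in_R: "s \<in> ?R" if "s \<in> kernel Q M \<theta> \<union> {\<pi> a, \<pi> b}" for s using that by (rule generate.incl)
    have pw: "s [^]\<^bsub>Q\<^esub> (k::nat) \<in> ?R" if "s \<in> ?R" for s k
      using that R.one_closed R.m_closed by (induction k) (simp_all only: H.nat_pow_0 H.nat_pow_Suc)
    have w: "?w \<in> ?R" using pw in_R by (intro R.m_closed) blast+
    have "\<pi> x \<otimes>\<^bsub>Q\<^esub> ?w \<otimes>\<^bsub>Q\<^esub> inv\<^bsub>Q\<^esub> ?w \<in> ?R" using ij in_R w by blast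
    moreover have "\<pi> x \<otimes>\<^bsub>Q\<^esub> ?w \<otimes>\<^bsub>Q\<^esub> inv\<^bsub>Q\<^esub> ?w = \<pi> x"
      using ab x by (simp add: H.m_assoc del: H.inv_mult_group)
    ultimately show "q \<in> ?R" using x by simp
  qed
qed

end

subsection \<open>Commutators over a fixed p-group quotient\<close>

lemma (in group_epi) central_stepI:
  assumes "U \<lhd> Q" "c' \<in> carrier E" "\<And>q. q \<in> carrier Q \<Longrightarrow> commutator Q (\<pi> c') q \<in> U"
  shows "central_step E Q \<pi> U c'"
  using assms by (simp add: central_step_def central_step_axioms_def group_epi_axioms)

text \<open>Adjoining a generator \<open>x\<close> of largest order \<open>n\<close> modulo \<open>U\<close> first makes the induction work:
  the step costs \<open>|Q/\<langle>x\<rangle>U| = q/n\<close>, and \<open>q \<le> n ^ d\<close>.\<close>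

lemma (in group_epi) covered_over_derived:
  assumes fin: "finite (carrier Q)"
    and U: "subgroup U Q" "derived Q (carrier Q) \<subseteq> U" "order Q = q * card U"
    and S: "S \<subseteq> carrier Q" "generate Q (U \<union> S) = carrier Q"
  shows "\<exists>t. covered E t (derived E (carrier E)) (lift_comm U) \<and> t\<^sup>2 \<le> q ^ (card S - 1)"
  using U S
proof (induction "card S" arbitrary: S U q)
  case 0
  then have "S = {}" using fin finite_subset by fastforce
  moreover have "generate Q U = U" using 0 by (metis H.generateI order_refl)
  ultimately have "U = carrier Q" using 0 by simp
  then show ?case
    using G.covered_refl[OF lift_comm_subset[of U]] 0 by (intro exI[of _ 1]) (simp add: lift_comm_carrier)
next
  case (Suc d)
  have fS: "finite S" and neS: "S \<noteq> {}" using Suc.hyps(2) card_gt_0_iff[of S] by auto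
  interpret U: normal U Q using Suc.prems by (intro H.normal_if_derived_subset)
  have adj: "adjoin_normal U Q x (order Q)" if "x \<in> carrier Q" for x
    using that fin H.pow_order_eq_1[OF that] U.normal_axioms
    by (simp add: adjoin_normal_def adjoin_normal_axioms_def H.order_gt_0_iff_finite)
  define n where "n = adjoin_normal.rel_ord U Q"
  have n: "0 < n x \<and> x [^]\<^bsub>Q\<^esub> n x \<in> U" if "x \<in> S" for x
    using adjoin_normal.rel_ord_pos[OF adj] adjoin_normal.pow_rel_ord[OF adj] that Suc.prems(4)
    unfolding n_def by (simp add: subset_iff)
  obtain x where x: "x \<in> S" and max: "\<And>y. y \<in> S \<Longrightarrow> n y \<le> n x"
    using Max_in[of "n ` S"] Max_ge[of "n ` S"] fS neS by fastforce
  have xc: "x \<in> carrier Q" using x Suc.prems(4) by blast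
  interpret x: adjoin_normal U Q x "order Q" using adj[OF xc] .
  have finU: "finite U" using U.subset fin by (rule finite_subset)
  have cU: "0 < card U" using U.one_closed U.subset fin finite_subset card_gt_0_iff by blast
  have "order Q \<le> card U * (\<Prod>y\<in>S. n y)"
    using H.generate_finite_card_le_prod[OF Suc.prems(1,2) finU fS Suc.prems(4) n] Suc.prems(5) by (simp add: order_def)
  also have "\<dots> \<le> card U * n x ^ card S"
    using max prod_mono[of S n "\<lambda>_. n x"] by simp
  finally have qn: "q \<le> n x ^ Suc d" using Suc.prems(3) Suc.hyps(2) cU by simp
  let ?U = "adjoin Q x U"
  have cU1: "card ?U = n x * card U" unfolding n_def by (rule x.card_adjoin)
  obtain q1 where q1: "order Q = q1 * card ?U"
    using H.lagrange[OF x.subgroup_adjoin] by metis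
  then have qq: "q = q1 * n x" using cU1 Suc.prems(3) cU by simp
  have "U \<union> S \<subseteq> ?U \<union> (S - {x})" using x.subset_adjoin x.self_in_adjoin by blast
  then have "generate Q (U \<union> S) \<subseteq> generate Q (?U \<union> (S - {x}))" by (rule H.mono_generate)
  then have gen: "generate Q (?U \<union> (S - {x})) = carrier Q"
    using Suc.prems(4,5) H.generate_incl[of "?U \<union> (S - {x})"] subgroup.subset[OF x.subgroup_adjoin] by blast
  have D: "derived Q (carrier Q) \<subseteq> ?U" using Suc.prems(2) x.subset_adjoin by blast
  have cS: "d = card (S - {x})" using Suc.hyps(2) x fS by simp
  obtain t where t: "covered E t (derived E (carrier E)) (lift_comm ?U)" "t\<^sup>2 \<le> q1 ^ (d - 1)"
    using Suc.hyps(1)[OF cS x.subgroup_adjoin D q1 _ gen] Suc.prems(4) cS by auto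
  obtain c where c: "c \<in> carrier E" "\<pi> c = x" using surjE[OF xc] .
  have comm: "commutator Q (\<pi> c) y \<in> U" if "y \<in> carrier Q" for y
    using H.commutator_in_derived[OF xc that] Suc.prems(2) c by blast
  interpret s: central_step E Q \<pi> U c
    using U.normal_axioms c(1) comm by (rule central_stepI)
  have c1: "0 < card ?U" using cU1 cU x n by simp
  \<comment> \<open>The kernel contains \<open>?U\<close>, so the step costs at most q1, the index
    of \<open>?U\<close>.\<close>
  have "card (s.\<theta> ` carrier Q) * card ?U \<le> card (s.\<theta> ` carrier Q) * card (kernel Q s.M s.\<theta>)"
    using s.adjoin_subset_kernel c fin by (intro mult_le_mono2 card_mono) (auto simp: kernel_def)
  also have "\<dots> = q1 * card ?U" using s.\<theta>.card_image_kernel[OF fin] q1 by simp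
  finally have "card (s.\<theta> ` carrier Q) \<le> q1" using c1 by simp
  then have "covered E q1 (lift_comm ?U) (lift_comm U)"
    using covered_mono[OF s.covered_adjoin[OF fin]] c by auto
  then have cov: "covered E (t * q1) (derived E (carrier E)) (lift_comm U)"
    using G.covered_trans[OF t(1)] lift_comm_subset by blast
  have "(t * q1)\<^sup>2 \<le> q ^ d"
  \<comment> \<open>The exponent d - 1 is truncated at d = 0. There \<open>S\<close> consists of x
    alone, so \<open>?U\<close> is all of \<open>Q\<close> and the step costs nothing.\<close>
  proof (cases "d = 0")
    case True
    then have "card S = 1" using Suc.hyps(2) by simp
    then have "S = {x}" using x card_1_singletonE by blast
    then have "carrier Q \<subseteq> ?U"
      using Suc.prems(5) H.generate_subgroup_incl[OF _ x.subgroup_adjoin, of "U \<union> S"] x.subset_adjoin x.self_in_adjoin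
      by blast
    then have "?U = carrier Q" using subgroup.subset[OF x.subgroup_adjoin] by blast
    then have "q1 = 1" using q1 c1 by (simp add: order_def)
    then show ?thesis using t True by simp
  next
    case False
    \<comment> \<open>The inequality is proved after multiplication by \<open>n x ^ Suc d\<close>:
      the left side is then at most q ^ (d + 1), and q \<le> \<open>n x ^ Suc d\<close> permits the
      cancellation.\<close>
    have "(t * q1)\<^sup>2 * n x ^ Suc d = t\<^sup>2 * q1\<^sup>2 * n x ^ Suc d" by (simp add: power_mult_distrib)
    also have "\<dots> \<le> q1 ^ (d - 1) * q1\<^sup>2 * n x ^ Suc d" using t by (intro mult_le_mono) auto
    also have "q1 ^ (d - 1) * q1\<^sup>2 = q1 ^ Suc d" using False by (simp flip: power_add)
    also have "q1 ^ Suc d * n x ^ Suc d = q * q ^ d" unfolding qq by (simp add: power_mult_distrib)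
    also have "\<dots> \<le> n x ^ Suc d * q ^ d" using qn by (intro mult_le_mono) auto
    finally show ?thesis using n[OF x] by simp
  qed
  then show ?case using cov Suc.hyps(2)[symmetric] by auto
qed

text \<open>The three factors are r - 1 central steps inside the derived subgroup, the Hall-Witt
  step onto it, and the climb from there to \<open>Q\<close>. The set \<open>S\<close> has to
  generate only modulo the derived subgroup, since \<open>\<theta>\<close> kills
  commutators.\<close>

theorem (in group_epi) covered_derived:
  assumes p: "Factorial_Ring.prime (p::nat)" and Q: "order Q = p ^ m"
    and r: "card (derived Q (carrier Q)) = p ^ r" "0 < r"
    and S: "S \<subseteq> carrier Q" "generate Q (derived Q (carrier Q) \<union> S) = carrier Q"
  shows "\<exists>t. covered E ((p ^ card S) ^ (r - 1) * p\<^sup>2 * t) (derived E (carrier E)) (lift_comm {\<one>\<^bsub>Q\<^esub>}) \<and>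
    t\<^sup>2 \<le> (p ^ (m - r)) ^ (card S - 1) \<and> 2 + r \<le> m"
proof -
  let ?D = "derived Q (carrier Q)"
  have fin: "finite (carrier Q)" using Q p by (metis H.order_gt_0_iff_finite prime_gt_0_nat zero_less_power)
  have p0: "0 < p" and p1: "1 < p" using p prime_gt_0_nat prime_gt_1_nat by auto
  have pr: "p ^ r = p * p ^ (r - 1)" using r(2) by (simp add: power_eq_if)
  interpret D: normal ?D Q by (rule H.derived_self_is_normal)
  \<comment> \<open>The chain principle carries a property of \<open>U\<close> alone, so the number
    k of steps made so far is encoded in the order of \<open>U\<close>.\<close>
  define P where "P U \<longleftrightarrow> (\<exists>k. card U = p ^ k \<and>
    covered E ((p ^ card S) ^ k) (lift_comm U) (lift_comm {\<one>\<^bsub>Q\<^esub>}))" for U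
  have "\<exists>W. W \<lhd> Q \<and> W \<subseteq> ?D \<and> card W = p ^ (r - 1) \<and> P W"
  proof (rule H.p_group_central_chain[OF p Q D.normal_axioms r(1)])
    show "P {\<one>\<^bsub>Q\<^esub>}"
      unfolding P_def using G.covered_refl[OF lift_comm_subset] by (intro exI[of _ 0]) simp
  next
    fix U c assume U: "U \<lhd> Q" "U \<subseteq> ?D" and c: "c \<in> ?D - U" "c [^]\<^bsub>Q\<^esub> p \<in> U"
      and comm: "\<And>g. g \<in> carrier Q \<Longrightarrow> commutator Q c g \<in> U" and "P U"
    then obtain k where k: "card U = p ^ k" "covered E ((p ^ card S) ^ k) (lift_comm U) (lift_comm {\<one>\<^bsub>Q\<^esub>})"
      unfolding P_def by blast
    have cc: "c \<in> carrier Q" using c(1) D.subset by blast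
    obtain c' where c': "c' \<in> carrier E" "\<pi> c' = c" using surjE[OF cc] .
    interpret s: central_step E Q \<pi> U c'
      using U(1) c'(1) comm[folded c'(2)] by (rule central_stepI)
    interpret a: adjoin_normal U Q c p
      using U(1) c cc p0 by (simp add: adjoin_normal_def adjoin_normal_axioms_def)
    have "a.rel_ord dvd p" using a.pow_in_iff[of p] c by simp
    moreover have "a.rel_ord \<noteq> 1" using a.pow_in_iff[of 1] c cc by auto
    ultimately have "a.rel_ord = p" using p by (metis prime_nat_iff)
    then have "card (adjoin Q c U) = p ^ Suc k" using a.card_adjoin k by simp
    moreover have "carrier Q \<subseteq> generate Q (kernel Q s.M s.\<theta> \<union> S)"
      using H.mono_generate[of "?D \<union> S" "kernel Q s.M s.\<theta> \<union> S"] s.derived_subset_kernel S(2) by blast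
    then have "generate Q (kernel Q s.M s.\<theta> \<union> S) = carrier Q"
      using H.generate_incl[of "kernel Q s.M s.\<theta> \<union> S"] S(1) by (auto simp: kernel_def)
    then have "card (s.\<theta> ` carrier Q) \<le> p ^ card S"
      using s.card_image_\<theta>_le[OF fin p0 _ S(1)] c c' by simp
    then have "covered E (p ^ card S) (lift_comm (adjoin Q c U)) (lift_comm U)"
      using covered_mono[OF s.covered_adjoin[OF fin]] c' by auto
    then have "covered E (p ^ card S * (p ^ card S) ^ k) (lift_comm (adjoin Q c U)) (lift_comm {\<one>\<^bsub>Q\<^esub>})"
      using G.covered_trans[OF _ k(2)] lift_comm_subset by blast
    ultimately show "P (adjoin Q c U)" unfolding P_def by (intro exI[of _ "Suc k"]) simp
  qed simp
  then obtain W where W: "W \<lhd> Q" "W \<subseteq> ?D" "card W = p ^ (r - 1)" "P W" by blast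
  interpret W: normal W Q by fact
  have covW: "covered E ((p ^ card S) ^ (r - 1)) (lift_comm W) (lift_comm {\<one>\<^bsub>Q\<^esub>})"
    using W p1 unfolding P_def by (metis power_inject_exp)
  \<comment> \<open>\<open>W\<close> has index p in \<open>?D\<close>, so any element of
    \<open>?D\<close> outside \<open>W\<close> generates \<open>?D\<close> over \<open>W\<close> and
    has its p-th power in \<open>W\<close>.\<close>
  have card_adjoin_D: "adjoin Q c W = ?D \<and> c [^]\<^bsub>Q\<^esub> p \<in> W" if c: "c \<in> ?D - W" for c
  proof -
    have cc: "c \<in> carrier Q" using c D.subset by blast
    interpret a: adjoin_normal W Q c "order Q"
      using W(1) cc fin H.pow_order_eq_1[OF cc] W.one_closed
      by (simp add: adjoin_normal_def adjoin_normal_axioms_def H.order_gt_0_iff_finite)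
    have sub: "adjoin Q c W \<subseteq> ?D" using c W by (intro H.adjoin_subset_subgroup D.subgroup_axioms) auto
    have "card (adjoin Q c W) dvd card ?D"
    proof -
      interpret DG: group "Q\<lparr>carrier := ?D\<rparr>" using D.subgroup_axioms by (rule H.subgroup_imp_group)
      have sub': "subgroup (adjoin Q c W) (Q\<lparr>carrier := ?D\<rparr>)"
        using a.subgroup_adjoin sub D.subgroup_axioms H.subgroup_incl by blast
      have "order (Q\<lparr>carrier := ?D\<rparr>) = card ?D" by (simp add: order_def)
      then show ?thesis using DG.lagrange[OF sub'] by (metis dvd_triv_right)
    qed
    then have "a.rel_ord * p ^ (r - 1) dvd p * p ^ (r - 1)"
      unfolding a.card_adjoin W(3) r(1) pr .
    then have dp: "a.rel_ord dvd p" using p0 by simp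
    moreover have "a.rel_ord \<noteq> 1" using a.pow_in_iff[of 1] c cc by auto
    ultimately have "a.rel_ord = p" using p by (metis prime_nat_iff)
    then have "card (adjoin Q c W) = card ?D"
      unfolding a.card_adjoin W(3) r(1) pr by simp
    then have "adjoin Q c W = ?D" using sub fin D.subset finite_subset by (metis card_subset_eq)
    then show ?thesis using dp a.pow_in_iff by simp
  qed
  have DW: "?D \<noteq> W" using W(3) r p1 by (metis Suc_pred' lessI less_irrefl power_strict_increasing)
  \<comment> \<open>Hall-Witt requires the element of the last step to be a single commutator, and
    some commutator lies outside \<open>W\<close> because together they generate
    \<open>?D\<close>.\<close>
  have "\<not> {commutator Q x y |x y. x \<in> carrier Q \<and> y \<in> carrier Q} \<subseteq> W"
  proof
    assume "{commutator Q x y |x y. x \<in> carrier Q \<and> y \<in> carrier Q} \<subseteq> W"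
    then have "?D \<subseteq> W"
      unfolding derived_eq_generate_commutators by (rule H.generate_subgroup_incl[OF _ W.subgroup_axioms])
    then show False using DW W(2) by blast
  qed
  then obtain a0 b0 where ab0: "a0 \<in> carrier Q" "b0 \<in> carrier Q" "commutator Q a0 b0 \<notin> W" by blast
  let ?c = "commutator Q a0 b0"
  have cD: "?c \<in> ?D - W" using ab0 H.commutator_in_derived by blast
  \<comment> \<open>\<open>?D\<close> modulo \<open>W\<close> is a normal subgroup of order p in a
    p-group, hence central: the central element supplied by \<open>p_group_central_step\<close>
    generates it.\<close>
  have DcentralW: "commutator Q y g \<in> W" if "y \<in> ?D" "g \<in> carrier Q" for y g
  proof -
    have "W \<subset> ?D" using W(2) DW by blast
    then obtain c0 where c0: "c0 \<in> ?D - W" "\<And>g. g \<in> carrier Q \<Longrightarrow> commutator Q c0 g \<in> W"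
      using H.p_group_central_step[OF p Q W(1) D.normal_axioms] by blast
    have "y \<in> adjoin Q c0 W" using card_adjoin_D[OF c0(1)] that(1) by simp
    then obtain i w where iw: "y = c0 [^]\<^bsub>Q\<^esub> (i::nat) \<otimes>\<^bsub>Q\<^esub> w" "w \<in> W"
      unfolding adjoin_def by blast
    have c0c: "c0 \<in> carrier Q" and wc: "w \<in> carrier Q" using c0(1) iw(2) D.subset W.subset by auto
    have "commutator Q w g = w \<otimes>\<^bsub>Q\<^esub> (g \<otimes>\<^bsub>Q\<^esub> inv\<^bsub>Q\<^esub> w \<otimes>\<^bsub>Q\<^esub> inv\<^bsub>Q\<^esub> g)"
      using wc that(2) by (simp add: H.group_word)
    then have "commutator Q w g \<in> W" using iw(2) that(2) W.inv_op_closed2 by simp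
    then have "c0 [^]\<^bsub>Q\<^esub> i \<otimes>\<^bsub>Q\<^esub> commutator Q w g \<otimes>\<^bsub>Q\<^esub> inv\<^bsub>Q\<^esub> (c0 [^]\<^bsub>Q\<^esub> i) \<in> W"
      using c0c W.inv_op_closed2 by simp
    then show ?thesis
      using W.commutator_nat_pow_closed[OF c0c c0(2) that(2)] c0c wc that(2)
      unfolding iw(1) by (simp add: H.commutator_mult_left)
  qed
  obtain a where a: "a \<in> carrier E" "\<pi> a = a0" using surjE[OF ab0(1)] .
  obtain b where b: "b \<in> carrier E" "\<pi> b = b0" using surjE[OF ab0(2)] .
  define c' where "c' = commutator E a b"
  have c': "c' \<in> carrier E" "\<pi> c' = ?c" using a b by (simp_all add: c'_def hom_commutator)
  have comm: "commutator Q (\<pi> c') q \<in> W" if "q \<in> carrier Q" for q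
    using DcentralW[of ?c q] cD c'(2) that by simp
  interpret s: central_step E Q \<pi> W c' using W(1) c'(1) comm by (rule central_stepI)
  have cW: "adjoin Q (\<pi> c') W = ?D" "\<pi> c' [^]\<^bsub>Q\<^esub> p \<in> W" using card_adjoin_D[OF cD] c' by auto
  have "card (s.\<theta> ` carrier Q) \<le> p ^ card {\<pi> a, \<pi> b}"
  proof (rule s.card_image_\<theta>_le[OF fin p0 cW(2)])
    show "{\<pi> a, \<pi> b} \<subseteq> carrier Q" using a b by auto
    show "generate Q (kernel Q s.M s.\<theta> \<union> {\<pi> a, \<pi> b}) = carrier Q"
      using a(1) b(1) c'_def cW by (intro s.generate_kernel_hall_witt) auto
  qed
  also have "\<dots> \<le> p\<^sup>2" using p1 by (intro power_increasing) (auto simp: card_insert_if)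
  finally have "covered E (p\<^sup>2) (lift_comm ?D) (lift_comm W)"
    using covered_mono[OF s.covered_adjoin[OF fin]] cW by auto
  then have cov1: "covered E (p\<^sup>2 * (p ^ card S) ^ (r - 1)) (lift_comm ?D) (lift_comm {\<one>\<^bsub>Q\<^esub>})"
    using G.covered_trans[OF _ covW] lift_comm_subset by blast
  have "p ^ r \<le> p ^ m" using r Q fin D.subset card_mono order_def by metis
  then have rm: "r \<le> m" using p1 by simp
  have "order Q = p ^ (m - r) * card ?D" using Q r rm by (simp flip: power_add)
  then obtain t where t: "covered E t (derived E (carrier E)) (lift_comm ?D)" "t\<^sup>2 \<le> (p ^ (m - r)) ^ (card S - 1)"
    using covered_over_derived[OF fin D.subgroup_axioms subset_refl _ S] by blast
  have "covered E (t * (p\<^sup>2 * (p ^ card S) ^ (r - 1))) (derived E (carrier E)) (lift_comm {\<one>\<^bsub>Q\<^esub>})"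
    using G.covered_trans[OF t(1) cov1] lift_comm_subset by blast
  moreover have "t * (p\<^sup>2 * (p ^ card S) ^ (r - 1)) = (p ^ card S) ^ (r - 1) * p\<^sup>2 * t" by simp
  \<comment> \<open>Two proper inclusions lead from \<open>?D\<close> through
    \<open>adjoin Q a0 ?D\<close> to \<open>Q\<close>. Since \<open>?D\<close> is central modulo
    \<open>W\<close>, having a0 in \<open>?D\<close> or b0 in \<open>adjoin Q a0 ?D\<close> would
    put [a0, b0] into \<open>W\<close>.\<close>
  moreover have "2 + r \<le> m"
  proof -
    have adj: "adjoin_normal U Q x (order Q)" if "U \<lhd> Q" "x \<in> carrier Q" for U x
      using that fin H.pow_order_eq_1[OF that(2)] subgroup.one_closed[OF normal_imp_subgroup[OF that(1)]]
      by (simp add: adjoin_normal_def adjoin_normal_axioms_def H.order_gt_0_iff_finite)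
    interpret A: adjoin_normal ?D Q a0 "order Q" using adj D.normal_axioms ab0 by blast
    have subA: "subgroup (adjoin Q a0 ?D) Q" by (rule A.subgroup_adjoin)
    have "a0 \<notin> ?D" using DcentralW ab0 by blast
    then have l1: "card ?D < card (adjoin Q a0 ?D)"
      using A.subset_adjoin A.self_in_adjoin fin subA finite_subset subgroup.subset
      by (metis psubsetI psubset_card_mono)
    have "b0 \<notin> adjoin Q a0 ?D"
    proof
      assume "b0 \<in> adjoin Q a0 ?D"
      then obtain i y where y: "y \<in> ?D" "b0 = a0 [^]\<^bsub>Q\<^esub> (i::nat) \<otimes>\<^bsub>Q\<^esub> y" unfolding adjoin_def by blast
      have yc: "y \<in> carrier Q" using y D.subset by blast
      have cc: "commutator Q a0 (a0 [^]\<^bsub>Q\<^esub> i) = \<one>\<^bsub>Q\<^esub>"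
        using ab0 by (simp add: H.commutator_eq_one_iff flip: H.nat_pow_Suc2)
      have "commutator Q y a0 \<in> W" using DcentralW y ab0 by blast
      moreover have "commutator Q a0 y = inv\<^bsub>Q\<^esub> commutator Q y a0"
        using ab0 yc by (simp add: H.group_word)
      ultimately have "commutator Q a0 y \<in> W" by simp
      then have "commutator Q a0 b0 \<in> W"
        unfolding y(2) using ab0 yc cc by (simp add: H.commutator_mult_right W.inv_op_closed2)
      then show False using ab0 by blast
    qed
    then have "adjoin Q a0 ?D \<subset> carrier Q" using subgroup.subset[OF subA] ab0 by blast
    then have l2: "card (adjoin Q a0 ?D) < p ^ m" using fin Q by (metis order_def psubset_card_mono)
    have "card (adjoin Q a0 ?D) dvd p ^ m" using H.lagrange[OF subA] Q by (metis dvd_triv_right)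
    then obtain l where "card (adjoin Q a0 ?D) = p ^ l" using p divides_primepow_nat by metis
    then have "r < l" "l < m" using l1 l2 r p1 by simp_all
    then show ?thesis by simp
  qed
  ultimately show ?thesis using t(2) by metis
qed

subsection \<open>Characters with values in the complex units\<close>

definition character_on :: "('a, 'b) monoid_scheme \<Rightarrow> 'a set \<Rightarrow> ('a \<Rightarrow> complex) \<Rightarrow> bool" where
  "character_on G U \<chi> \<longleftrightarrow> (\<forall>u\<in>U. \<chi> u \<noteq> 0) \<and> (\<forall>u\<in>U. \<forall>v\<in>U. \<chi> (u \<otimes>\<^bsub>G\<^esub> v) = \<chi> u * \<chi> v)"

text \<open>\<open>extensional\<close> fixes the values outside \<open>U\<close>, so that functions
  agreeing on \<open>U\<close> are counted once.\<close>

definition characters :: "('a, 'b) monoid_scheme \<Rightarrow> 'a set \<Rightarrow> ('a \<Rightarrow> complex) set" where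
  "characters G U = {\<chi> \<in> extensional U. character_on G U \<chi>}"

lemma character_on_mult:
  "character_on G U \<chi> \<Longrightarrow> u \<in> U \<Longrightarrow> v \<in> U \<Longrightarrow> \<chi> (u \<otimes>\<^bsub>G\<^esub> v) = \<chi> u * \<chi> v"
  by (simp add: character_on_def)

lemma character_on_nonzero: "character_on G U \<chi> \<Longrightarrow> u \<in> U \<Longrightarrow> \<chi> u \<noteq> 0"
  by (simp add: character_on_def)

lemma character_on_subset: "character_on G U \<chi> \<Longrightarrow> V \<subseteq> U \<Longrightarrow> character_on G V \<chi>"
  by (auto simp: character_on_def)

lemma complex_root_exists:
  assumes "0 < n" "c \<noteq> 0" obtains z :: complex where "z ^ n = c"
proof -
  have "card {z. z ^ n = c} \<noteq> 0" using card_nth_roots[OF assms(2,1)] assms(1) by simp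
  then have "{z. z ^ n = c} \<noteq> {}" by force
  then show ?thesis using that by blast
qed

context group
begin

lemma character_on_one:
  assumes "subgroup U G" "character_on G U \<chi>" shows "\<chi> \<one> = 1"
proof -
  have "\<chi> \<one> = \<chi> \<one> * \<chi> \<one>"
    using assms by (metis character_on_mult l_one one_closed subgroup.one_closed)
  then show ?thesis
    using character_on_nonzero[OF assms(2) subgroup.one_closed[OF assms(1)]] by simp
qed

lemma character_on_pow:
  assumes "subgroup U G" "character_on G U \<chi>" "u \<in> U" shows "\<chi> (u [^] (n::nat)) = \<chi> u ^ n"
proof (induction n)
  case 0
  show ?case using character_on_one[OF assms(1,2)] by simp
next
  case (Suc n)
  have "u [^] n \<in> U" using assms by (induction n) (auto simp: subgroup.one_closed subgroup.m_closed)
  then show ?case using Suc assms by (simp add: character_on_mult)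
qed

text \<open>The complex units are divisible: choose z with z^n = \<chi>(x^n), where n is the order
  of x modulo \<open>U\<close>, and send x^i u to z^i \<chi>(u). Triviality on the derived subgroup
  makes \<chi> invariant under conjugation by x, which multiplicativity requires.\<close>

lemma extend_character_adjoin:
  assumes D: "derived G (carrier G) \<subseteq> U" and adj: "adjoin_normal U G x k"
    and \<chi>: "character_on G U \<chi>" and triv: "\<And>d. d \<in> derived G (carrier G) \<Longrightarrow> \<chi> d = 1"
  shows "\<exists>\<chi>'. character_on G (adjoin G x U) \<chi>' \<and> (\<forall>u\<in>U. \<chi>' u = \<chi> u)"
proof -
  interpret adjoin_normal U G x k by fact
  let ?n = "rel_ord"
  obtain z where z: "z ^ ?n = \<chi> (x [^] ?n)"
    using complex_root_exists[OF rel_ord_pos character_on_nonzero[OF \<chi> pow_rel_ord]] .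
  have z0: "z \<noteq> 0"
    using z rel_ord_pos character_on_nonzero[OF \<chi> pow_rel_ord] by (metis power_0_left less_irrefl)
  define \<chi>' where "\<chi>' y = (case inv_into ({..<?n} \<times> U) (\<lambda>(i, u). x [^] i \<otimes> u) y of (i, u) \<Rightarrow> z ^ i * \<chi> u)" for y
  have small: "\<chi>' (x [^] i \<otimes> u) = z ^ i * \<chi> u" if "i < ?n" "u \<in> U" for i u
  proof -
    have "inv_into ({..<?n} \<times> U) (\<lambda>(i, u). x [^] i \<otimes> u) ((\<lambda>(i, u). x [^] i \<otimes> u) (i, u)) = (i, u)"
      using bij_betw_adjoin that by (intro inv_into_f_f) (auto simp: bij_betw_def)
    then show ?thesis by (simp add: \<chi>'_def)
  qed
  \<comment> \<open>The definition goes through the normal form with i below \<open>rel_ord\<close>;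
    the choice of z extends the formula to every exponent.\<close>
  have gen: "\<chi>' (x [^] i \<otimes> u) = z ^ i * \<chi> u" if u: "u \<in> U" for i :: nat and u
  proof -
    let ?q = "i div ?n"
    have e: "x [^] i = x [^] (i mod ?n) \<otimes> (x [^] ?n) [^] ?q"
      using x_closed by (simp add: nat_pow_mult nat_pow_pow)
    have pU: "(x [^] ?n) [^] ?q \<in> U"
      using pow_in_iff[of "?n * ?q"] x_closed by (simp add: nat_pow_pow)
    have "x [^] i \<otimes> u = x [^] (i mod ?n) \<otimes> ((x [^] ?n) [^] ?q \<otimes> u)"
      using e pU u x_closed by (simp add: m_assoc)
    then have "\<chi>' (x [^] i \<otimes> u) = z ^ (i mod ?n) * \<chi> ((x [^] ?n) [^] ?q \<otimes> u)"
      using small pU u rel_ord_pos by simp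
    also have "\<chi> ((x [^] ?n) [^] ?q \<otimes> u) = (z ^ ?n) ^ ?q * \<chi> u"
      using character_on_mult[OF \<chi> pU u] character_on_pow[OF subgroup_axioms \<chi> pow_rel_ord] z by simp
    also have "z ^ (i mod ?n) * ((z ^ ?n) ^ ?q * \<chi> u) = z ^ i * \<chi> u"
      by (simp flip: power_mult power_add mult.assoc)
    finally show ?thesis .
  qed
  have "character_on G (adjoin G x U) \<chi>'"
    unfolding character_on_def
  proof (intro conjI ballI)
    fix a assume "a \<in> adjoin G x U"
    then obtain i u where u: "u \<in> U" and a: "a = x [^] (i::nat) \<otimes> u" unfolding adjoin_def by blast
    show "\<chi>' a \<noteq> 0" using gen[OF u] z0 character_on_nonzero[OF \<chi> u] a by simp
    fix b assume "b \<in> adjoin G x U"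
    then obtain j v where v: "v \<in> U" and b: "b = x [^] (j::nat) \<otimes> v" unfolding adjoin_def by blast
    have uc: "u \<in> carrier G" "v \<in> carrier G" using u v by simp_all
    let ?w = "inv (x [^] j) \<otimes> u \<otimes> x [^] j"
    have w: "?w \<in> U" using pow_conj_closed[OF u] .
    have cd: "commutator G (inv (x [^] j)) u \<in> derived G (carrier G)"
      using x_closed uc by (intro commutator_in_derived) auto
    have "?w = commutator G (inv (x [^] j)) u \<otimes> u" using x_closed uc by (simp add: group_word)
    then have "\<chi> ?w = \<chi> u" using character_on_mult[OF \<chi> _ u] triv[OF cd] cd D by (simp add: subset_iff)
    moreover have "a \<otimes> b = x [^] i \<otimes> x [^] j \<otimes> (?w \<otimes> v)"
      using uc x_closed unfolding a b by (simp add: group_word)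
    then have "a \<otimes> b = x [^] (i + j) \<otimes> (?w \<otimes> v)" using x_closed by (simp add: nat_pow_mult)
    ultimately have "\<chi>' (a \<otimes> b) = z ^ (i + j) * (\<chi> u * \<chi> v)"
      using gen[of "?w \<otimes> v"] w v character_on_mult[OF \<chi> w v] by simp
    then show "\<chi>' (a \<otimes> b) = \<chi>' a * \<chi>' b"
      unfolding a b gen[OF u] gen[OF v] by (simp add: power_add)
  qed
  moreover have "\<forall>u\<in>U. \<chi>' u = \<chi> u" using gen[of _ 0] by simp
  ultimately show ?thesis by blast
qed

text \<open>\<open>S\<close> is finite even where \<open>G\<close> is not, so the extension takes
  finitely many adjunctions and an ordinary induction is enough.\<close>

lemma extend_character_finite:
  assumes S: "finite S" "S \<subseteq> carrier G"
    and U: "subgroup U G" "derived G (carrier G) \<subseteq> U"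
    and tors: "\<And>x. x \<in> S \<Longrightarrow> \<exists>k>0. x [^] (k::nat) \<in> U"
    and \<chi>: "character_on G U \<chi>" and triv: "\<And>d. d \<in> derived G (carrier G) \<Longrightarrow> \<chi> d = 1"
  shows "\<exists>\<chi>'. character_on G (generate G (U \<union> S)) \<chi>' \<and> (\<forall>u\<in>U. \<chi>' u = \<chi> u)"
  using S tors
proof (induction S)
  case empty
  have "generate G U = U" using U by (metis generateI order_refl)
  then show ?case using \<chi> by auto
next
  case (insert x S)
  let ?V = "generate G (U \<union> S)"
  have UG: "U \<subseteq> carrier G" using U subgroup.subset by blast
  obtain \<chi>' where \<chi>': "character_on G ?V \<chi>'" "\<forall>u\<in>U. \<chi>' u = \<chi> u" using insert by auto
  obtain k where k: "0 < k" "x [^] (k::nat) \<in> U" using insert.prems(2)[of x] by blast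
  have UV: "U \<subseteq> ?V" by (auto intro: generate.incl)
  have D: "derived G (carrier G) \<subseteq> ?V" using U(2) UV by (rule order_trans)
  have "?V \<lhd> G" using insert.prems(1) UG U(2) by (intro subgroup_generate_if_derived_subset) auto
  moreover have "x \<in> carrier G" using insert.prems(1) by simp
  moreover have "x [^] k \<in> ?V" using k(2) UV by blast
  ultimately have adj: "adjoin_normal ?V G x k"
    using k(1) by (simp add: adjoin_normal_def adjoin_normal_axioms_def)
  obtain \<chi>'' where \<chi>'': "character_on G (adjoin G x ?V) \<chi>''" "\<forall>u\<in>?V. \<chi>'' u = \<chi>' u"
    using extend_character_adjoin[OF D adj \<chi>'(1)] \<chi>'(2) U triv by (metis subsetD)
  have "generate G (U \<union> insert x S) \<subseteq> adjoin G x ?V"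
    using generate_insert_subset_adjoin[OF adj] by simp
  then show ?case
    using character_on_subset[OF \<chi>''(1)] \<chi>''(2) \<chi>'(2) UV by (metis subsetD)
qed

text \<open>Since \<mu> is trivial where \<open>A\<close> meets the derived subgroup D, the rule d a
  \<mapsto> \<mu>(a) is well defined on D A. It is multiplicative because \<open>A\<close> is
  central and trivial on D, so it extends further to \<open>G\<close>.\<close>

lemma extend_central_character:
  assumes A: "subgroup A G" "A \<subseteq> center G" and \<mu>: "character_on G A \<mu>"
    and triv: "\<And>a. a \<in> A \<Longrightarrow> a \<in> derived G (carrier G) \<Longrightarrow> \<mu> a = 1"
    and S: "finite S" "S \<subseteq> carrier G" "\<And>x. x \<in> S \<Longrightarrow> \<exists>k>0. x [^] (k::nat) \<in> A"
      "generate G (A \<union> S) = carrier G"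
  shows "\<exists>\<chi>. character_on G (carrier G) \<chi> \<and> (\<forall>a\<in>A. \<chi> a = \<mu> a)"
proof -
  let ?D = "derived G (carrier G)"
  interpret D: normal ?D G by (rule derived_self_is_normal)
  interpret A: subgroup A G by fact
  let ?U = "?D <#> A"
  have memU: "d \<otimes> a \<in> ?U" if "d \<in> ?D" "a \<in> A" for d a using that by (auto simp: set_mult_def)
  have U: "subgroup ?U G"
  proof (rule subgroupI)
    show "?U \<subseteq> carrier G" by (auto simp: set_mult_def)
    show "?U \<noteq> {}" using memU D.one_closed A.one_closed by blast
  next
    fix y assume "y \<in> ?U"
    then obtain d a where y: "y = d \<otimes> a" "d \<in> ?D" "a \<in> A" unfolding set_mult_def by blast
    then have "inv y = inv d \<otimes> inv a"
      using A(2) center_comm[of "inv a" "inv d"] by (simp add: inv_mult_group subset_iff)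
    then show "inv y \<in> ?U" using memU y by simp
  next
    fix y y' assume "y \<in> ?U" "y' \<in> ?U"
    then obtain d a d' a' where y: "y = d \<otimes> a" "d \<in> ?D" "a \<in> A" "y' = d' \<otimes> a'" "d' \<in> ?D" "a' \<in> A"
      unfolding set_mult_def by blast
    have "a \<otimes> d' = d' \<otimes> a" using center_comm[of a d'] y A(2) D.mem_carrier by blast
    then have "y \<otimes> y' = (d \<otimes> d') \<otimes> (a \<otimes> a')"
      using y by (metis A.mem_carrier D.mem_carrier m_assoc m_closed)
    then show "y \<otimes> y' \<in> ?U" using memU y by simp
  qed
  have uniq: "\<mu> a = \<mu> a'" if "d \<otimes> a = d' \<otimes> a'" "d \<in> ?D" "d' \<in> ?D" "a \<in> A" "a' \<in> A" for d a d' a'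
  proof -
    have "inv d' \<otimes> d \<otimes> a = a'" using that by (simp add: m_assoc inv_solve_left')
    then have "a' \<otimes> inv a = inv d' \<otimes> d" using that by (metis A.mem_carrier D.mem_carrier inv_closed inv_solve_right' m_closed)
    then have "a' \<otimes> inv a \<in> ?D" using that by simp
    moreover have "a' \<otimes> inv a \<in> A" using that by simp
    ultimately have "\<mu> (a' \<otimes> inv a) = 1" using triv by blast
    moreover have "\<mu> a' = \<mu> (a' \<otimes> inv a) * \<mu> a"
      using that character_on_mult[OF \<mu>, of "a' \<otimes> inv a" a] by (simp add: m_assoc)
    ultimately show ?thesis by simp
  qed
  define \<chi>0 where "\<chi>0 y = \<mu> (SOME a. a \<in> A \<and> (\<exists>d\<in>?D. y = d \<otimes> a))" for y
  have \<chi>0: "\<chi>0 (d \<otimes> a) = \<mu> a" if da: "d \<in> ?D" "a \<in> A" for d a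
  proof -
    let ?a = "SOME a'. a' \<in> A \<and> (\<exists>d'\<in>?D. d \<otimes> a = d' \<otimes> a')"
    have "?a \<in> A \<and> (\<exists>d'\<in>?D. d \<otimes> a = d' \<otimes> ?a)"
      by (rule someI[of "\<lambda>a'. a' \<in> A \<and> (\<exists>d'\<in>?D. d \<otimes> a = d' \<otimes> a')" a]) (use da in blast)
    then obtain d' where "?a \<in> A" "d' \<in> ?D" "d \<otimes> a = d' \<otimes> ?a" by blast
    then show ?thesis unfolding \<chi>0_def using uniq[of d a d' ?a] da by simp
  qed
  have c0: "character_on G ?U \<chi>0"
    unfolding character_on_def
  proof (intro conjI ballI)
    fix y assume "y \<in> ?U"
    then obtain d a where y: "y = d \<otimes> a" "d \<in> ?D" "a \<in> A" unfolding set_mult_def by blast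
    then show "\<chi>0 y \<noteq> 0" using \<chi>0 character_on_nonzero[OF \<mu>] by simp
    fix y' assume "y' \<in> ?U"
    then obtain d' a' where y': "y' = d' \<otimes> a'" "d' \<in> ?D" "a' \<in> A" unfolding set_mult_def by blast
    have "a \<otimes> d' = d' \<otimes> a" using center_comm[of a d'] y y' A(2) D.mem_carrier by blast
    then have "y \<otimes> y' = (d \<otimes> d') \<otimes> (a \<otimes> a')"
      using y y' by (metis A.mem_carrier D.mem_carrier m_assoc m_closed)
    then show "\<chi>0 (y \<otimes> y') = \<chi>0 y * \<chi>0 y'"
      using \<chi>0 y y' character_on_mult[OF \<mu>] by simp
  qed
  have AU: "a \<in> ?U" "\<chi>0 a = \<mu> a" if "a \<in> A" for a
    using memU[OF D.one_closed that] \<chi>0[OF D.one_closed that] that by simp_all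
  have tD: "\<chi>0 d = 1" if "d \<in> ?D" for d
    using \<chi>0[OF that A.one_closed] character_on_one[OF A(1) \<mu>] that by simp
  have DU: "?D \<subseteq> ?U"
  proof
    fix d assume "d \<in> ?D"
    then show "d \<in> ?U" using memU[OF _ A.one_closed, of d] by simp
  qed
  obtain \<chi> where \<chi>: "character_on G (generate G (?U \<union> S)) \<chi>" "\<forall>u\<in>?U. \<chi> u = \<chi>0 u"
    using extend_character_finite[OF S(1,2) U DU _ c0 tD] S(3) AU(1) by blast
  have "generate G (A \<union> S) \<subseteq> generate G (?U \<union> S)" using AU(1) by (intro mono_generate) blast
  then have "character_on G (carrier G) \<chi>" using \<chi>(1) S(4) character_on_subset by metis
  then show ?thesis using \<chi>(2) AU by auto
qed

end

text \<open>A character of \<open>adjoin G x V\<close> is determined by its restriction to V and its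
  value at x, and that value is an n-th root of a prescribed nonzero number, with n the order of x
  modulo V. Each adjunction thus multiplies the number of characters by at most n.\<close>

lemma (in comm_group) card_characters_generate:
  assumes "finite S" "S \<subseteq> carrier G" "finite (carrier G)"
  shows "finite (characters G (generate G S)) \<and> card (characters G (generate G S)) \<le> card (generate G S)"
  using assms(1,2)
proof (induction S)
  case empty
  have "characters G {\<one>} \<subseteq> {\<lambda>x\<in>{\<one>}. 1}"
  proof
    fix \<chi> assume "\<chi> \<in> characters G {\<one>}"
    then have "\<chi> \<in> extensional {\<one>}" "\<chi> \<one> = 1"
      using character_on_one[OF triv_subgroup] by (auto simp: characters_def)
    then show "\<chi> \<in> {\<lambda>x\<in>{\<one>}. 1}" by (auto simp: extensional_def)
  qed
  then show ?case
    using card_mono[of "{\<lambda>x\<in>{\<one>}. 1::complex}"] finite_subset by (fastforce simp: generate_empty)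
next
  case (insert x S)
  let ?V = "generate G S" and ?W = "generate G (insert x S)"
  have x: "x \<in> carrier G" and S: "S \<subseteq> carrier G" using insert by auto
  have "x [^] order G \<in> ?V" using pow_order_eq_1[OF x] by (simp add: generate.one)
  moreover have "?V \<lhd> G" using generate_is_subgroup[OF S] by (rule subgroup_imp_normal)
  ultimately have adj: "adjoin_normal ?V G x (order G)"
    using x assms(3) by (simp add: adjoin_normal_def adjoin_normal_axioms_def order_gt_0_iff_finite)
  interpret adjoin_normal ?V G x "order G" by (rule adj)
  have W: "?W = adjoin G x ?V"
  proof
    show "?W \<subseteq> adjoin G x ?V" using generate_insert_subset_adjoin[OF adj] .
    show "adjoin G x ?V \<subseteq> ?W"
      using insert.prems mono_generate[of S "insert x S"]
      by (intro adjoin_subset_subgroup generate_is_subgroup) (auto intro: generate.incl)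
  qed
  let ?n = "rel_ord"
  let ?B = "SIGMA \<chi>:characters G ?V. {z. z ^ ?n = \<chi> (x [^] ?n)}"
  let ?f = "\<lambda>\<chi>. (restrict \<chi> ?V, \<chi> x)"
  have inj: "inj_on ?f (characters G ?W)"
  proof (rule inj_onI)
    fix \<chi> \<chi>' assume c: "\<chi> \<in> characters G ?W" "\<chi>' \<in> characters G ?W" and eq: "?f \<chi> = ?f \<chi>'"
    have ch: "character_on G ?W \<chi>" "character_on G ?W \<chi>'" using c by (auto simp: characters_def)
    have "\<chi> y = \<chi>' y" if "y \<in> ?W" for y
    proof -
      have "y \<in> adjoin G x ?V" using that W by simp
      then obtain i u where u: "u \<in> ?V" and y: "y = x [^] (i::nat) \<otimes> u" unfolding adjoin_def by blast
      have uW: "u \<in> ?W" "x \<in> ?W" "x [^] i \<in> ?W"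
        using subsetD[OF subset_adjoin u] self_in_adjoin mem_adjoin[OF one_closed, of i] x unfolding W by simp_all
      have sW: "subgroup ?W G" unfolding W by (rule subgroup_adjoin)
      have "\<chi> u = \<chi>' u" using eq u by (metis prod.inject restrict_apply')
      moreover have "\<chi> x = \<chi>' x" using eq by simp
      ultimately show ?thesis
        unfolding y using uW ch character_on_pow[OF sW ch(1)] character_on_pow[OF sW ch(2)]
        by (simp add: character_on_mult)
    qed
    then show "\<chi> = \<chi>'" using c by (intro extensionalityI[of _ ?W]) (auto simp: characters_def)
  qed
  have sub: "?f ` characters G ?W \<subseteq> ?B"
  proof safe
    fix \<chi> assume c: "\<chi> \<in> characters G ?W"
    have sW: "subgroup ?W G" unfolding W by (rule subgroup_adjoin)
    have ch: "character_on G ?W \<chi>" using c by (simp add: characters_def)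
    then have "character_on G ?V \<chi>" using subset_adjoin W character_on_subset by metis
    then show "restrict \<chi> ?V \<in> characters G ?V"
      by (simp add: characters_def character_on_def)
    have "\<chi> x ^ ?n = \<chi> (x [^] ?n)" using character_on_pow[OF sW ch, of x] self_in_adjoin W by simp
    then show "\<chi> x ^ ?n = restrict \<chi> ?V (x [^] ?n)" using pow_rel_ord by simp
  qed
  have IH: "finite (characters G ?V)" "card (characters G ?V) \<le> card ?V" using insert by auto
  have roots: "card {z. z ^ ?n = \<chi> (x [^] ?n)} = ?n \<and> finite {z. z ^ ?n = \<chi> (x [^] ?n)}"
    if "\<chi> \<in> characters G ?V" for \<chi>
  proof -
    have "\<chi> (x [^] ?n) \<noteq> 0" using that pow_rel_ord by (auto simp: characters_def character_on_def)
    then have c: "card {z. z ^ ?n = \<chi> (x [^] ?n)} = ?n" using rel_ord_pos by (rule card_nth_roots)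
    then show ?thesis using rel_ord_pos card_ge_0_finite by metis
  qed
  have finB: "finite ?B" using IH roots by (intro finite_SigmaI) auto
  have "card (characters G ?W) \<le> card ?B" using card_inj_on_le[OF inj sub finB] .
  also have "\<dots> = (\<Sum>\<chi>\<in>characters G ?V. ?n)" using IH roots by (subst card_SigmaI) auto
  also have "\<dots> \<le> card ?W" using IH card_adjoin W by simp
  finally have "card (characters G ?W) \<le> card ?W" .
  then show ?case using inj_on_finite[OF inj sub finB] by blast
qed

subsection \<open>Bilinear maps and the tensor product\<close>

text \<open>Used for torsion: for finite \<open>A\<close> the class of (a, b) has order dividing the
  order of \<open>A\<close>.\<close>

lemma tensor_product_class_hom:
  assumes A: "group A" and B: "group B" and b: "b \<in> carrier B"
  defines "F \<equiv> free_Abelian_group (carrier A \<times> carrier B)"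
  shows "(\<lambda>a. generate F (tensor_relations A B) #>\<^bsub>F\<^esub> frag_of (a, b)) \<in> hom A (tensor_product A B)"
proof -
  interpret A: group A by fact
  interpret F: comm_group F unfolding F_def by (rule abelian_free_Abelian_group)
  let ?R = "generate F (tensor_relations A B)"
  have rel: "tensor_relations A B \<subseteq> carrier F" unfolding F_def using A B by (rule tensor_relations_carrier)
  interpret R: normal ?R F using rel by (intro F.subgroup_imp_normal F.generate_is_subgroup)
  have T: "tensor_product A B = F Mod ?R" by (simp add: tensor_product_def F_def Let_def)
  have fc: "frag_of (a, b) \<in> carrier F" if "a \<in> carrier A" for a using that b by (simp add: F_def)
  show ?thesis
    unfolding T
  proof (rule homI)
    fix a a' assume a: "a \<in> carrier A" and a': "a' \<in> carrier A"
    show "?R #>\<^bsub>F\<^esub> frag_of (a, b) \<in> carrier (F Mod ?R)"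
      using fc[OF a] by (auto simp: carrier_FactGroup)
    have "frag_of (a \<otimes>\<^bsub>A\<^esub> a', b) - frag_of (a, b) - frag_of (a', b) \<in> tensor_relations A B"
      using a a' b unfolding tensor_relations_def by blast
    then have r: "frag_of (a \<otimes>\<^bsub>A\<^esub> a', b) - frag_of (a, b) - frag_of (a', b) \<in> ?R"
      by (rule generate.incl)
    have "frag_of (a \<otimes>\<^bsub>A\<^esub> a', b) = (frag_of (a \<otimes>\<^bsub>A\<^esub> a', b) - frag_of (a, b) - frag_of (a', b))
        \<otimes>\<^bsub>F\<^esub> (frag_of (a, b) \<otimes>\<^bsub>F\<^esub> frag_of (a', b))"
      by (simp add: F_def)
    then have "frag_of (a \<otimes>\<^bsub>A\<^esub> a', b) \<in> ?R #>\<^bsub>F\<^esub> (frag_of (a, b) \<otimes>\<^bsub>F\<^esub> frag_of (a', b))"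
      using r unfolding r_coset_def by blast
    then have "?R #>\<^bsub>F\<^esub> frag_of (a \<otimes>\<^bsub>A\<^esub> a', b) = ?R #>\<^bsub>F\<^esub> (frag_of (a, b) \<otimes>\<^bsub>F\<^esub> frag_of (a', b))"
      using F.repr_independence R.subgroup_axioms fc[OF a] fc[OF a'] F.m_closed by metis
    then show "?R #>\<^bsub>F\<^esub> frag_of (a \<otimes>\<^bsub>A\<^esub> a', b) =
        (?R #>\<^bsub>F\<^esub> frag_of (a, b)) \<otimes>\<^bsub>F Mod ?R\<^esub> (?R #>\<^bsub>F\<^esub> frag_of (a', b))"
      using R.rcos_sum[OF fc[OF a] fc[OF a']] by simp
  qed
qed

text \<open>An abelian group generated by finitely many torsion elements is finite. This has to be
  known before comparing sizes, since \<open>order\<close> is 0 for an infinite carrier.\<close>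

lemma finite_tensor_product:
  assumes A: "group A" and B: "group B" and fin: "finite (carrier A)" "finite (carrier B)"
  shows "finite (carrier (tensor_product A B))"
proof -
  interpret A: group A by fact
  interpret B: group B by fact
  define F where "F = free_Abelian_group (carrier A \<times> carrier B)"
  interpret F: comm_group F unfolding F_def by (rule abelian_free_Abelian_group)
  let ?R = "generate F (tensor_relations A B)"
  have rel: "tensor_relations A B \<subseteq> carrier F" unfolding F_def using A B by (rule tensor_relations_carrier)
  interpret R: normal ?R F using rel by (intro F.subgroup_imp_normal F.generate_is_subgroup)
  have T: "tensor_product A B = F Mod ?R" by (simp add: tensor_product_def F_def Let_def)
  interpret T: comm_group "tensor_product A B" using A B by (rule comm_group_tensor_product)
  interpret q: group_hom F "tensor_product A B" "\<lambda>x. ?R #>\<^bsub>F\<^esub> x"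
    using R.r_coset_hom_Mod T.group_axioms unfolding T by (simp add: group_hom_def group_hom_axioms_def)
  let ?S = "(\<lambda>s. ?R #>\<^bsub>F\<^esub> frag_of s) ` (carrier A \<times> carrier B)"
  let ?V = "generate (tensor_product A B) ?S"
  have S: "?S \<subseteq> carrier (tensor_product A B)" using q.hom_closed by (auto simp: F_def)
  have V: "subgroup ?V (tensor_product A B)" using S by (rule T.generate_is_subgroup)
  have gen: "?R #>\<^bsub>F\<^esub> x \<in> ?V" if "Poly_Mapping.keys x \<subseteq> carrier A \<times> carrier B" for x
    using that
  proof (rule free_Abelian_group_induct)
    have "?R #>\<^bsub>F\<^esub> \<one>\<^bsub>F\<^esub> \<in> ?V" unfolding q.hom_one by (rule generate.one)
    then show "?R #>\<^bsub>F\<^esub> 0 \<in> ?V" by (simp add: F_def)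
  next
    fix x y :: "'a \<times> 'c \<Rightarrow>\<^sub>0 int"
    assume 2: "Poly_Mapping.keys x \<subseteq> carrier A \<times> carrier B" "Poly_Mapping.keys y \<subseteq> carrier A \<times> carrier B"
      "?R #>\<^bsub>F\<^esub> x \<in> ?V" "?R #>\<^bsub>F\<^esub> y \<in> ?V"
    then have xy: "x \<in> carrier F" "y \<in> carrier F" by (simp_all add: F_def)
    have "x - y = x \<otimes>\<^bsub>F\<^esub> inv\<^bsub>F\<^esub> y" using 2 by (simp add: F_def)
    then have "?R #>\<^bsub>F\<^esub> (x - y) = (?R #>\<^bsub>F\<^esub> x) \<otimes>\<^bsub>tensor_product A B\<^esub> inv\<^bsub>tensor_product A B\<^esub> (?R #>\<^bsub>F\<^esub> y)"
      using xy q.hom_mult q.hom_inv F.inv_closed by metis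
    then show "?R #>\<^bsub>F\<^esub> (x - y) \<in> ?V" using 2 V by (simp add: subgroup.m_closed subgroup.m_inv_closed)
  next
    fix a assume "a \<in> carrier A \<times> carrier B"
    then show "?R #>\<^bsub>F\<^esub> frag_of a \<in> ?V" by (intro generate.incl) blast
  qed
  have carV: "carrier (tensor_product A B) \<subseteq> ?V"
    unfolding T carrier_FactGroup using gen by (auto simp: F_def T)
  have fin1: "finite (generate (tensor_product A B) ({\<one>\<^bsub>tensor_product A B\<^esub>} \<union> ?S))"
  proof -
    have "s [^]\<^bsub>tensor_product A B\<^esub> order A \<in> {\<one>\<^bsub>tensor_product A B\<^esub>}" if s: "s \<in> ?S" for s
    proof -
      obtain a b where ab: "a \<in> carrier A" "b \<in> carrier B" "s = ?R #>\<^bsub>F\<^esub> frag_of (a, b)" using s by blast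
      interpret h: group_hom A "tensor_product A B" "\<lambda>a. ?R #>\<^bsub>F\<^esub> frag_of (a, b)"
        using tensor_product_class_hom[OF A B ab(2)] A T.group_axioms
        by (simp add: group_hom_def group_hom_axioms_def F_def)
      show ?thesis
        unfolding ab(3) h.hom_nat_pow[OF ab(1), symmetric] A.pow_order_eq_1[OF ab(1)] h.hom_one by simp
    qed
    moreover have "0 < order A" using fin A.order_gt_0_iff_finite by blast
    moreover have "derived (tensor_product A B) (carrier (tensor_product A B)) \<subseteq> {\<one>\<^bsub>tensor_product A B\<^esub>}"
      using T.derived_eq_singleton by simp
    ultimately show ?thesis
      using T.generate_finite_card_le_prod[OF T.triv_subgroup _ _ _ S, of "\<lambda>_. order A"] fin by blast
  qed
  have "?V \<subseteq> generate (tensor_product A B) ({\<one>\<^bsub>tensor_product A B\<^esub>} \<union> ?S)"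
    by (rule T.mono_generate) blast
  then have "finite ?V" using fin1 by (rule finite_subset)
  with carV show ?thesis by (rule finite_subset)
qed

text \<open>The universal property in the form of an estimate: the homomorphism on the free group
  that extends \<beta> kills the relations, so the subgroup generated by the values is contained in
  an image of the tensor product.\<close>

lemma (in comm_group) card_bilinear_image_le:
  assumes A: "group A" and B: "group B" and fin: "finite (carrier A)" "finite (carrier B)"
    and closed: "\<And>a b. a \<in> carrier A \<Longrightarrow> b \<in> carrier B \<Longrightarrow> \<beta> (a, b) \<in> carrier G"
    and left: "\<And>a a' b. a \<in> carrier A \<Longrightarrow> a' \<in> carrier A \<Longrightarrow> b \<in> carrier B \<Longrightarrow>
      \<beta> (a \<otimes>\<^bsub>A\<^esub> a', b) = \<beta> (a, b) \<otimes> \<beta> (a', b)"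
    and right: "\<And>a b b'. a \<in> carrier A \<Longrightarrow> b \<in> carrier B \<Longrightarrow> b' \<in> carrier B \<Longrightarrow>
      \<beta> (a, b \<otimes>\<^bsub>B\<^esub> b') = \<beta> (a, b) \<otimes> \<beta> (a, b')"
  shows "finite (generate G (\<beta> ` (carrier A \<times> carrier B)))"
    and "card (generate G (\<beta> ` (carrier A \<times> carrier B))) \<le> order (tensor_product A B)"
proof -
  interpret A: group A by fact
  interpret B: group B by fact
  define F where "F = free_Abelian_group (carrier A \<times> carrier B)"
  interpret F: comm_group F unfolding F_def by (rule abelian_free_Abelian_group)
  let ?R = "generate F (tensor_relations A B)"
  have rel: "tensor_relations A B \<subseteq> carrier F" unfolding F_def using A B by (rule tensor_relations_carrier)
  interpret R: normal ?R F using rel by (intro F.subgroup_imp_normal F.generate_is_subgroup)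
  have T: "tensor_product A B = F Mod ?R" by (simp add: tensor_product_def F_def Let_def)
  have "\<beta> ` (carrier A \<times> carrier B) \<subseteq> carrier G" using closed by auto
  then obtain h where h: "h \<in> hom F G" "\<And>s. s \<in> carrier A \<times> carrier B \<Longrightarrow> h (frag_of s) = \<beta> s"
    using free_Abelian_group_universal unfolding F_def by metis
  interpret h: group_hom F G h using h(1) by (simp add: group_hom_def group_hom_axioms_def)
  have fc: "frag_of s \<in> carrier F" if "s \<in> carrier A \<times> carrier B" for s using that by (simp add: F_def)
  have diff: "h (x - y - z) = \<one>"
    if "x \<in> carrier F" "y \<in> carrier F" "z \<in> carrier F" "h x = h y \<otimes> h z" for x y z
  proof -
    have yc: "inv\<^bsub>F\<^esub> y = - y" "inv\<^bsub>F\<^esub> z = - z" using that by (simp_all add: F_def)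
    have "x - y - z = x \<otimes>\<^bsub>F\<^esub> inv\<^bsub>F\<^esub> y \<otimes>\<^bsub>F\<^esub> inv\<^bsub>F\<^esub> z"
      unfolding yc by (simp add: F_def)
    then have "h (x - y - z) = h x \<otimes> inv (h y) \<otimes> inv (h z)" using that by simp
    also have "\<dots> = h x \<otimes> inv (h y \<otimes> h z)"
      using that(1-3) by (simp only: m_assoc inv_mult h.hom_closed inv_closed)
    also have "\<dots> = \<one>" using that(1,4) by (metis h.hom_closed r_inv)
    finally show ?thesis .
  qed
  have "tensor_relations A B \<subseteq> kernel F G h"
  proof
    fix s assume s: "s \<in> tensor_relations A B"
    have "h s = \<one>"
      using s unfolding tensor_relations_def
    proof (elim UnE CollectE exE conjE)
      fix a a' b assume "s = frag_of (a \<otimes>\<^bsub>A\<^esub> a', b) - frag_of (a, b) - frag_of (a', b)"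
        and "a \<in> carrier A" "a' \<in> carrier A" "b \<in> carrier B"
      then show "h s = \<one>" using diff[OF fc fc fc] h(2) left by simp
    next
      fix a b b' assume "s = frag_of (a, b \<otimes>\<^bsub>B\<^esub> b') - frag_of (a, b) - frag_of (a, b')"
        and "a \<in> carrier A" "b \<in> carrier B" "b' \<in> carrier B"
      then show "h s = \<one>" using diff[OF fc fc fc] h(2) right by simp
    qed
    then show "s \<in> kernel F G h" using s rel by (auto simp: kernel_def)
  qed
  then have RK: "?R \<subseteq> kernel F G h" by (intro F.generate_subgroup_incl h.subgroup_kernel)
  have hR: "h x = h y"
    if x: "x \<in> carrier F" and y: "y \<in> carrier F" and eq: "?R #>\<^bsub>F\<^esub> x = ?R #>\<^bsub>F\<^esub> y" for x y
  proof -
    have "x \<in> ?R #>\<^bsub>F\<^esub> y" using F.rcos_self[OF x R.subgroup_axioms] eq by simp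
    then obtain k where "k \<in> ?R" "x = k \<otimes>\<^bsub>F\<^esub> y" unfolding r_coset_def by blast
    then show "h x = h y" using RK y by (auto simp: kernel_def)
  qed
  obtain g where g: "g \<in> hom (F Mod ?R) G" "\<And>x. x \<in> carrier F \<Longrightarrow> g (?R #>\<^bsub>F\<^esub> x) = h x"
    by (rule FactGroup_universal[OF h(1) R.normal_axioms hR]) blast+
  let ?W = "generate G (\<beta> ` (carrier A \<times> carrier B))"
  have "\<beta> ` (carrier A \<times> carrier B) \<subseteq> h ` carrier F"
    using h(2) fc by (metis image_eqI image_subsetI)
  then have "?W \<subseteq> h ` carrier F" by (intro generate_subgroup_incl h.img_is_subgroup)
  also have "\<dots> = g ` carrier (F Mod ?R)" unfolding carrier_FactGroup image_image using g(2) by simp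
  finally have sub: "?W \<subseteq> g ` carrier (tensor_product A B)" unfolding T .
  have fT: "finite (carrier (tensor_product A B))" using A B fin by (rule finite_tensor_product)
  show "finite ?W" using sub fT finite_subset by blast
  have "card ?W \<le> card (g ` carrier (tensor_product A B))" using sub fT by (intro card_mono) auto
  also have "\<dots> \<le> order (tensor_product A B)" unfolding order_def using fT by (rule card_image_le)
  finally show "card ?W \<le> order (tensor_product A B)" .
qed

subsection \<open>Central extensions of a group with a central subgroup\<close>

lemma (in normal) rcos_eq_self_iff: "x \<in> carrier G \<Longrightarrow> H #> x = H \<longleftrightarrow> x \<in> H"
  using coset_join1 coset_join2 subset subgroup_axioms by metis

lemma (in normal) rcos_eqE:
  assumes "x \<in> carrier G" "y \<in> carrier G" "H #> x = H #> y"
  obtains h where "h \<in> H" "x = h \<otimes> y"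
proof -
  have "x \<in> H #> y" using rcos_self[OF assms(1) subgroup_axioms] assms(3) by simp
  then show ?thesis using that unfolding r_coset_def by blast
qed

lemma hom_trivial_on_derived:
  assumes h: "h \<in> hom G M" and G: "group G" and M: "comm_group M" and d: "d \<in> derived G (carrier G)"
  shows "h d = \<one>\<^bsub>M\<^esub>"
proof -
  interpret M: comm_group M by fact
  interpret h: group_hom G M h using h G M.group_axioms by (simp add: group_hom_def group_hom_axioms_def)
  have "h ` carrier G \<subseteq> carrier M" using h.hom_closed by blast
  then have "h ` derived G (carrier G) = {\<one>\<^bsub>M\<^esub>}"
    using h.derived_img[of "carrier G"] M.derived_eq_singleton by simp
  then show ?thesis using d by blast
qed

text \<open>The factor theorem twice: modulo \<open>K\<close>, and modulo the derived subgroup of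
  the quotient, which any map to an abelian group kills.\<close>

lemma hom_factors_abelianization:
  assumes h: "h \<in> hom G M" and G: "group G" and M: "comm_group M" and K: "K \<lhd> G"
    and triv: "\<And>k. k \<in> K \<Longrightarrow> h k = \<one>\<^bsub>M\<^esub>"
  shows "\<exists>h'. h' \<in> hom (abelianization (G Mod K)) M \<and>
    (\<forall>g\<in>carrier G. h' (derived (G Mod K) (carrier (G Mod K)) #>\<^bsub>G Mod K\<^esub> (K #>\<^bsub>G\<^esub> g)) = h g)"
proof -
  have factor: "\<exists>h'. h' \<in> hom (H Mod N) M \<and> (\<forall>g\<in>carrier H. h' (N #>\<^bsub>H\<^esub> g) = h g)"
    if "group H" "N \<lhd> H" "h \<in> hom H M" "\<And>k. k \<in> N \<Longrightarrow> h k = \<one>\<^bsub>M\<^esub>" for H :: "('x, 'y) monoid_scheme" and N h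
  proof -
    interpret M: comm_group M by fact
    interpret N: normal N H by fact
    interpret h: group_hom H M h using that M.group_axioms by (simp add: group_hom_def group_hom_axioms_def)
    have eq: "h x = h y" if xy: "x \<in> carrier H" "y \<in> carrier H" "N #>\<^bsub>H\<^esub> x = N #>\<^bsub>H\<^esub> y" for x y
    proof -
      obtain k where k: "k \<in> N" "x = k \<otimes>\<^bsub>H\<^esub> y" using N.rcos_eqE[OF xy] .
      have kc: "k \<in> carrier H" using k(1) by (rule N.mem_carrier)
      have "h k = \<one>\<^bsub>M\<^esub>" using \<open>\<And>k. k \<in> N \<Longrightarrow> h k = \<one>\<^bsub>M\<^esub>\<close> k(1) .
      then show ?thesis using k(2) kc xy(2) by simp
    qed
    show ?thesis
    proof (rule FactGroup_universal[OF that(3) N.normal_axioms eq])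
      fix g assume "g \<in> hom (H Mod N) M" "\<And>x. x \<in> carrier H \<Longrightarrow> g (N #>\<^bsub>H\<^esub> x) = h x"
      then show ?thesis by (intro exI[of _ g]) simp
    qed
  qed
  obtain h1 where h1: "h1 \<in> hom (G Mod K) M" "\<forall>g\<in>carrier G. h1 (K #>\<^bsub>G\<^esub> g) = h g"
    using factor[OF G K h triv] by blast
  have Q: "group (G Mod K)" using K by (rule normal.factorgroup_is_group)
  obtain h2 where h2: "h2 \<in> hom (G Mod K Mod derived (G Mod K) (carrier (G Mod K))) M"
    "\<forall>q\<in>carrier (G Mod K). h2 (derived (G Mod K) (carrier (G Mod K)) #>\<^bsub>G Mod K\<^esub> q) = h1 q"
    using factor[OF Q group.derived_self_is_normal[OF Q] h1(1)] hom_trivial_on_derived[OF h1(1) Q M] by blast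
  then show ?thesis
    using h1(2) unfolding abelianization_def carrier_FactGroup by (intro exI[of _ h2]) auto
qed

locale central_epi = group_epi +
  assumes kernel_central: "kernel E Q \<pi> \<subseteq> center E"
begin

lemma kernel_in_center:
  "z \<in> carrier E \<Longrightarrow> \<pi> z = \<one>\<^bsub>Q\<^esub> \<Longrightarrow> z \<in> center E"
  using kernel_central by (auto simp: kernel_def)

lemma commutator_cong:
  assumes x: "x \<in> carrier E" "x' \<in> carrier E" "\<pi> x = \<pi> x'"
    and y: "y \<in> carrier E" "y' \<in> carrier E" "\<pi> y = \<pi> y'"
  shows "commutator E x y = commutator E x' y'"
proof -
  have zc: "inv x \<otimes> x' \<in> center E" using x by (intro kernel_in_center) auto
  have wc: "inv y \<otimes> y' \<in> center E" using y by (intro kernel_in_center) auto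
  have "commutator E (x \<otimes> (inv x \<otimes> x')) y' = commutator E x y'"
    using x y zc by (subst G.commutator_mult_left) (simp_all add: G.center_commutator)
  moreover have "commutator E x (y \<otimes> (inv y \<otimes> y')) = commutator E x y"
    using x y wc by (subst G.commutator_mult_right) (simp_all add: G.center_commutator)
  ultimately show ?thesis using x y by (simp add: G.mult_inv_cancel)
qed

definition lift where "lift q = (SOME e. e \<in> carrier E \<and> \<pi> e = q)"

lemma lift: "q \<in> carrier Q \<Longrightarrow> lift q \<in> carrier E \<and> \<pi> (lift q) = q"
  unfolding lift_def using surjE by (metis (mono_tags, lifting) someI_ex)

text \<open>The commutator pairing of a central extension; changing a lift by a kernel element does
  not change the commutator, so the choices are immaterial.\<close>

definition \<kappa> where "\<kappa> k g = commutator E (lift k) (lift g)"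

lemma \<kappa>_eq: "x \<in> carrier E \<Longrightarrow> y \<in> carrier E \<Longrightarrow> \<kappa> (\<pi> x) (\<pi> y) = commutator E x y"
  unfolding \<kappa>_def using lift by (intro commutator_cong) auto

context
  fixes K
  assumes K: "subgroup K Q" "K \<subseteq> center Q"
begin

lemma \<kappa>_kernel:
  assumes k: "k \<in> K" and g: "g \<in> carrier Q" shows "\<kappa> k g \<in> kernel E Q \<pi>"
proof -
  have kc: "k \<in> carrier Q" using K(1) k by (rule subgroup.mem_carrier)
  have "commutator Q k g = \<one>\<^bsub>Q\<^esub>" using K(2) k g by (intro H.center_commutator) auto
  then show ?thesis using lift[OF kc] lift[OF g] by (simp add: kernel_def \<kappa>_def hom_commutator)
qed

lemma \<kappa>_center: "k \<in> K \<Longrightarrow> g \<in> carrier Q \<Longrightarrow> \<kappa> k g \<in> center E"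
  using \<kappa>_kernel kernel_central by blast

lemma \<kappa>_mult_right:
  assumes k: "k \<in> K" and g: "g \<in> carrier Q" and h: "h \<in> carrier Q"
  shows "\<kappa> k (g \<otimes>\<^bsub>Q\<^esub> h) = \<kappa> k g \<otimes> \<kappa> k h"
proof -
  have kc: "k \<in> carrier Q" using K(1) k by (rule subgroup.mem_carrier)
  note l = lift[OF kc] lift[OF g] lift[OF h]
  have "\<kappa> k (g \<otimes>\<^bsub>Q\<^esub> h) = commutator E (lift k) (lift g \<otimes> lift h)"
    using \<kappa>_eq[of "lift k" "lift g \<otimes> lift h"] l by simp
  also have "\<dots> = \<kappa> k g \<otimes> (lift g \<otimes> \<kappa> k h \<otimes> inv (lift g))"
    using l by (simp add: G.commutator_mult_right \<kappa>_def)
  also have "lift g \<otimes> \<kappa> k h \<otimes> inv (lift g) = \<kappa> k h"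
    using l by (intro G.center_conj \<kappa>_center k h) auto
  finally show ?thesis .
qed

lemma \<kappa>_mult_left:
  assumes k: "k \<in> K" "k' \<in> K" and g: "g \<in> carrier Q"
  shows "\<kappa> (k \<otimes>\<^bsub>Q\<^esub> k') g = \<kappa> k g \<otimes> \<kappa> k' g"
proof -
  have kc: "k \<in> carrier Q" "k' \<in> carrier Q" using k subgroup.mem_carrier[OF K(1)] by auto
  note l = lift[OF kc(1)] lift[OF kc(2)] lift[OF g]
  have "\<kappa> (k \<otimes>\<^bsub>Q\<^esub> k') g = commutator E (lift k \<otimes> lift k') (lift g)"
    using \<kappa>_eq[of "lift k \<otimes> lift k'" "lift g"] l by simp
  also have "\<dots> = (lift k \<otimes> \<kappa> k' g \<otimes> inv (lift k)) \<otimes> \<kappa> k g"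
    using l by (simp add: G.commutator_mult_left \<kappa>_def)
  also have "lift k \<otimes> \<kappa> k' g \<otimes> inv (lift k) = \<kappa> k' g"
    using l by (intro G.center_conj \<kappa>_center k g) auto
  also have "\<kappa> k' g \<otimes> \<kappa> k g = \<kappa> k g \<otimes> \<kappa> k' g"
    using \<kappa>_center k g by (intro G.center_comm G.center_closed) auto
  finally show ?thesis .
qed

text \<open>For central \<open>K\<close> the pairing \<open>\<kappa>\<close> is bilinear on
  \<open>K\<close> and \<open>Q\<close> with values in the kernel. Since the preimage of
  \<open>K\<close> is abelian, it vanishes on \<open>K\<close> in the second argument too, and so
  descends to the abelianization of \<open>Q Mod K\<close>. Its values include the generators of
  \<open>lift_comm K\<close>.\<close>

lemma card_lift_comm_le_tensor:
  assumes fin: "finite (carrier Q)"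
    and ab: "\<And>x y. x \<in> preim K \<Longrightarrow> y \<in> preim K \<Longrightarrow> commutator E x y = \<one>"
  shows "finite (lift_comm K)"
    and "card (lift_comm K) \<le> order (tensor_product (abelianization (Q Mod K)) (Q\<lparr>carrier := K\<rparr>))"
proof -
  let ?Z = "kernel E Q \<pi>" and ?B = "Q\<lparr>carrier := K\<rparr>" and ?A = "abelianization (Q Mod K)"
  let ?M = "E\<lparr>carrier := ?Z\<rparr>"
  have M: "comm_group ?M"
  proof (rule group.group_comm_groupI)
    show "group ?M" using subgroup_kernel by (rule G.subgroup_imp_group)
    fix x y assume "x \<in> carrier ?M" "y \<in> carrier ?M"
    then show "x \<otimes>\<^bsub>?M\<^esub> y = y \<otimes>\<^bsub>?M\<^esub> x"
      using kernel_central G.center_comm[of x y] by (auto simp: kernel_def)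
  qed
  interpret M: comm_group ?M by (rule M)
  have Kn: "K \<lhd> Q" using K by (rule H.central_subgroup_normal)
  interpret K: normal K Q by (rule Kn)
  interpret QK: group "Q Mod K" by (rule K.factorgroup_is_group)
  have A: "group ?A" unfolding abelianization_def by (rule QK.derived_quot_is_group)
  have B: "group ?B" using K(1) by (rule H.subgroup_imp_group)
  have hom: "\<kappa> k \<in> hom Q ?M" if "k \<in> K" for k
    using \<kappa>_kernel[OF that] \<kappa>_mult_right[OF that] by (intro homI) auto
  have triv: "\<kappa> k k' = \<one>\<^bsub>?M\<^esub>" if k: "k \<in> K" "k' \<in> K" for k k'
  proof -
    have kc: "k \<in> carrier Q" "k' \<in> carrier Q" using k K.subset by auto
    have "lift k \<in> preim K" "lift k' \<in> preim K" using lift[OF kc(1)] lift[OF kc(2)] k by (simp_all add: preim_def)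
    then show ?thesis using ab by (simp add: \<kappa>_def)
  qed
  let ?c = "\<lambda>g. derived (Q Mod K) (carrier (Q Mod K)) #>\<^bsub>Q Mod K\<^esub> (K #>\<^bsub>Q\<^esub> g)"
  have "\<forall>k\<in>K. \<exists>h'. h' \<in> hom ?A ?M \<and> (\<forall>g\<in>carrier Q. h' (?c g) = \<kappa> k g)"
    using hom_factors_abelianization[OF hom H.group_axioms M Kn triv] by blast
  then obtain h where h: "\<And>k. k \<in> K \<Longrightarrow> h k \<in> hom ?A ?M \<and> (\<forall>g\<in>carrier Q. h k (?c g) = \<kappa> k g)"
    by metis
  have carA: "carrier ?A = ?c ` carrier Q"
    unfolding abelianization_def carrier_FactGroup image_image ..
  let ?\<beta> = "\<lambda>(v, k). h k v"
  have finA: "finite (carrier ?A)" unfolding carA using fin by simp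
  have finB: "finite (carrier ?B)" using fin K.subset finite_subset by auto
  have b1: "?\<beta> (v, k) \<in> carrier ?M" if "v \<in> carrier ?A" "k \<in> carrier ?B" for v k
    using h[of k] that by (auto simp: hom_def)
  have b2: "?\<beta> (v \<otimes>\<^bsub>?A\<^esub> v', k) = ?\<beta> (v, k) \<otimes>\<^bsub>?M\<^esub> ?\<beta> (v', k)"
    if "v \<in> carrier ?A" "v' \<in> carrier ?A" "k \<in> carrier ?B" for v v' k
  proof -
    have "h k \<in> hom ?A ?M" using h that by simp
    then show ?thesis using that(1,2) by (simp add: hom_def)
  qed
  have b3: "?\<beta> (v, k \<otimes>\<^bsub>?B\<^esub> k') = ?\<beta> (v, k) \<otimes>\<^bsub>?M\<^esub> ?\<beta> (v, k')"
    if v: "v \<in> carrier ?A" and k: "k \<in> carrier ?B" "k' \<in> carrier ?B" for v k k'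
  proof -
    obtain g where g: "g \<in> carrier Q" "v = ?c g" using v unfolding carA by (elim imageE)
    have k': "k \<in> K" "k' \<in> K" "k \<otimes>\<^bsub>Q\<^esub> k' \<in> K" using k K(1) by (auto simp: subgroup.m_closed)
    have "h (k \<otimes>\<^bsub>Q\<^esub> k') v = \<kappa> k g \<otimes> \<kappa> k' g" using h[OF k'(3)] g \<kappa>_mult_left[OF k'(1,2) g(1)] by simp
    also have "\<dots> = h k v \<otimes> h k' v" using h[OF k'(1)] h[OF k'(2)] g by simp
    finally show ?thesis by simp
  qed
  let ?I = "?\<beta> ` (carrier ?A \<times> carrier ?B)"
  have I: "?I \<subseteq> ?Z" using b1 by auto
  have "{commutator E x y |x y. x \<in> preim K \<and> y \<in> carrier E} \<subseteq> ?I"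
  proof safe
    fix x y assume x: "x \<in> preim K" and y: "y \<in> carrier E"
    then have x': "x \<in> carrier E" "\<pi> x \<in> K" by (simp_all add: preim_def)
    have "commutator E x y = ?\<beta> (?c (\<pi> y), \<pi> x)" using h[OF x'(2)] \<kappa>_eq[OF x'(1) y] y by simp
    moreover have "(?c (\<pi> y), \<pi> x) \<in> carrier ?A \<times> carrier ?B" unfolding carA using y x'(2) by simp
    ultimately show "commutator E x y \<in> ?I" by (rule image_eqI)
  qed
  then have sub: "lift_comm K \<subseteq> generate E ?I"
    unfolding lift_comm_def commutator_subgroup_eq by (rule G.mono_generate)
  have gen: "generate E ?I = generate ?M ?I" using G.generate_consistent[OF I subgroup_kernel] ..
  note bil = M.card_bilinear_image_le[OF A B finA finB, of ?\<beta>, OF b1 b2 b3]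
  show "finite (lift_comm K)" using sub bil(1) unfolding gen by (rule finite_subset)
  show "card (lift_comm K) \<le> order (tensor_product ?A ?B)"
    using card_mono[OF bil(1) sub[unfolded gen]] bil(2) by (rule order_trans)
qed

end

text \<open>\<open>Q\<close> here is the group G of the theorem, and \<open>Q Mod K\<close> is the Q
  of the overview. The climb is applied to the composite epimorphism from \<open>E\<close> onto
  \<open>Q Mod K\<close>: its N(1) is \<open>lift_comm K\<close>, which the tensor product
  bounds.\<close>

theorem card_derived_le:
  assumes p: "Factorial_Ring.prime (p::nat)" and fin: "finite (carrier Q)"
    and K: "subgroup K Q" "K \<subseteq> center Q"
    and ab: "\<And>x y. x \<in> preim K \<Longrightarrow> y \<in> preim K \<Longrightarrow> commutator E x y = \<one>"
    and m: "order (Q Mod K) = p ^ m"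
    and r: "card (derived (Q Mod K) (carrier (Q Mod K))) = p ^ r" "0 < r"
    and S: "S \<subseteq> carrier (Q Mod K)"
      "generate (Q Mod K) (derived (Q Mod K) (carrier (Q Mod K)) \<union> S) = carrier (Q Mod K)"
  shows "\<exists>t. finite (derived E (carrier E)) \<and>
    card (derived E (carrier E)) \<le> order (tensor_product (abelianization (Q Mod K)) (Q\<lparr>carrier := K\<rparr>)) *
      ((p ^ card S) ^ (r - 1) * p\<^sup>2 * t) \<and>
    t\<^sup>2 \<le> (p ^ (m - r)) ^ (card S - 1) \<and> 2 + r \<le> m"
proof -
  have Kn: "K \<lhd> Q" using K by (rule H.central_subgroup_normal)
  interpret K: normal K Q by (rule Kn)
  interpret QK: group "Q Mod K" by (rule K.factorgroup_is_group)
  let ?\<rho> = "\<lambda>e. K #>\<^bsub>Q\<^esub> \<pi> e"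
  have \<rho>: "?\<rho> \<in> hom E (Q Mod K)"
  proof (rule homI)
    fix x y assume xy: "x \<in> carrier E" "y \<in> carrier E"
    then show "?\<rho> x \<in> carrier (Q Mod K)" by (auto simp: carrier_FactGroup)
    show "?\<rho> (x \<otimes> y) = ?\<rho> x \<otimes>\<^bsub>Q Mod K\<^esub> ?\<rho> y" using xy by (simp add: K.rcos_sum)
  qed
  have sur: "?\<rho> ` carrier E = carrier (Q Mod K)"
    unfolding carrier_FactGroup surj[symmetric] image_image ..
  interpret \<rho>: group_epi E "Q Mod K" ?\<rho>
    using \<rho> sur G.group_axioms QK.group_axioms
    by (simp add: group_epi_def group_epi_axioms_def group_hom_def group_hom_axioms_def)
  have "e \<in> \<rho>.preim {K} \<longleftrightarrow> e \<in> preim K" for e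
    unfolding \<rho>.preim_def preim_def using K.rcos_eq_self_iff[of "\<pi> e"] by (cases "e \<in> carrier E") simp_all
  then have "\<rho>.preim {K} = preim K" by blast
  then have lc: "\<rho>.lift_comm {\<one>\<^bsub>Q Mod K\<^esub>} = lift_comm K"
    unfolding \<rho>.lift_comm_def lift_comm_def by simp
  obtain t where t: "covered E ((p ^ card S) ^ (r - 1) * p\<^sup>2 * t) (derived E (carrier E)) (lift_comm K)"
    "t\<^sup>2 \<le> (p ^ (m - r)) ^ (card S - 1)" "2 + r \<le> m"
    using \<rho>.covered_derived[OF p m r S] unfolding lc by blast
  note b = card_lift_comm_le_tensor[OF K fin ab]
  have "card (derived E (carrier E)) \<le> card (lift_comm K) * ((p ^ card S) ^ (r - 1) * p\<^sup>2 * t)"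
    using covered_finite(2)[OF t(1) b(1)] .
  also have "\<dots> \<le> order (tensor_product (abelianization (Q Mod K)) (Q\<lparr>carrier := K\<rparr>)) *
      ((p ^ card S) ^ (r - 1) * p\<^sup>2 * t)" using b(2) by (rule mult_le_mono1)
  finally show ?thesis using covered_finite(1)[OF t(1) b(1)] t(2,3) by blast
qed

end

subsection \<open>The universal cocycle extension\<close>

text \<open>The extension of \<open>G\<close> by the group of all nowhere vanishing functions on the set of cocycles,
  whose factor set evaluates every cocycle simultaneously; dividing by \<open>f (1, 1)\<close> makes the
  factor set normalised.\<close>

definition norm_cocycle ::
    "('a, 'b) monoid_scheme \<Rightarrow> 'a \<Rightarrow> 'a \<Rightarrow> ('a \<times> 'a \<Rightarrow> complex) \<Rightarrow> complex" where
  "norm_cocycle G x y f =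
     (if f \<in> cocycles2 G complex_units then f (x, y) / f (\<one>\<^bsub>G\<^esub>, \<one>\<^bsub>G\<^esub>) else 1)"

text \<open>The functions are total, and coordinates that are not cocycles receive the constant
  factor 1. The kernel is therefore an infinite group of functions, and finiteness of the derived
  subgroup has to be proved.\<close>

definition cocycle_cover ::
    "('a, 'b) monoid_scheme \<Rightarrow> ((('a \<times> 'a \<Rightarrow> complex) \<Rightarrow> complex) \<times> 'a) monoid" where
  "cocycle_cover G = \<lparr>carrier = {(a, x). (\<forall>f. a f \<noteq> 0) \<and> x \<in> carrier G},
     monoid.mult = (\<lambda>(a, x) (b, y). (\<lambda>f. a f * b f * norm_cocycle G x y f, x \<otimes>\<^bsub>G\<^esub> y)),
     one = (\<lambda>_. 1, \<one>\<^bsub>G\<^esub>)\<rparr>"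

lemma complex_units_simps [simp]:
  "carrier complex_units = - {0}" "x \<otimes>\<^bsub>complex_units\<^esub> y = x * y" "\<one>\<^bsub>complex_units\<^esub> = 1"
  by (simp_all add: complex_units_def)

lemma inv_complex_units [simp]: "x \<noteq> 0 \<Longrightarrow> inv\<^bsub>complex_units\<^esub> x = inverse x"
  by (rule group.inv_equality[OF comm_group.axioms(2)[OF comm_group_complex_units]]) auto

context group
begin

abbreviation "nc \<equiv> norm_cocycle G"

lemma cocycle_nonzero:
  "f \<in> cocycles2 G complex_units \<Longrightarrow> x \<in> carrier G \<Longrightarrow> y \<in> carrier G \<Longrightarrow> f (x, y) \<noteq> 0"
  by (auto simp: cocycles2_def PiE_iff)

lemma cocycle_eq:
  "f \<in> cocycles2 G complex_units \<Longrightarrow> x \<in> carrier G \<Longrightarrow> y \<in> carrier G \<Longrightarrow> z \<in> carrier G \<Longrightarrow>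
    f (y, z) * f (x, y \<otimes> z) = f (x \<otimes> y, z) * f (x, y)"
  by (simp add: cocycles2_def)

lemma nc_nonzero: "x \<in> carrier G \<Longrightarrow> y \<in> carrier G \<Longrightarrow> nc x y f \<noteq> 0"
  by (simp add: norm_cocycle_def cocycle_nonzero)

lemma nc_eq:
  assumes "x \<in> carrier G" "y \<in> carrier G" "z \<in> carrier G"
  shows "nc y z f * nc x (y \<otimes> z) f = nc (x \<otimes> y) z f * nc x y f"
  using cocycle_eq[OF _ assms, of f] by (simp add: norm_cocycle_def)

lemma nc_one: assumes x: "x \<in> carrier G" shows "nc \<one> x f = 1" "nc x \<one> f = 1"
proof -
  have "nc \<one> x f * nc \<one> x f = nc \<one> x f * nc \<one> \<one> f" using nc_eq[of \<one> \<one> x f] x by simp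
  moreover have "nc \<one> \<one> f * nc x \<one> f = nc x \<one> f * nc x \<one> f" using nc_eq[of x \<one> \<one> f] x by simp
  moreover have "nc \<one> \<one> f = 1" using cocycle_nonzero[of f \<one> \<one>] by (simp add: norm_cocycle_def)
  ultimately show "nc \<one> x f = 1" "nc x \<one> f = 1" using nc_nonzero x by auto
qed

abbreviation "E \<equiv> cocycle_cover G"

lemma cover_simps:
  "carrier E = {(a, x). (\<forall>f. a f \<noteq> 0) \<and> x \<in> carrier G}"
  "(a, x) \<otimes>\<^bsub>E\<^esub> (b, y) = (\<lambda>f. a f * b f * nc x y f, x \<otimes> y)"
  "\<one>\<^bsub>E\<^esub> = (\<lambda>_. 1, \<one>)"
  by (simp_all add: cocycle_cover_def)

lemma group_cover: "group E"
proof (rule groupI)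
  fix u v assume "u \<in> carrier E" "v \<in> carrier E"
  then show "u \<otimes>\<^bsub>E\<^esub> v \<in> carrier E" by (auto simp: cover_simps nc_nonzero)
next
  show "\<one>\<^bsub>E\<^esub> \<in> carrier E" by (simp add: cover_simps)
next
  fix u v w assume "u \<in> carrier E" "v \<in> carrier E" "w \<in> carrier E"
  then obtain a x b y c z where u: "u = (a, x)" "v = (b, y)" "w = (c, z)"
    and x: "x \<in> carrier G" "y \<in> carrier G" "z \<in> carrier G" by (auto simp: cover_simps)
  have "a f * b f * nc x y f * c f * nc (x \<otimes> y) z f = a f * (b f * c f * nc y z f) * nc x (y \<otimes> z) f" for f
    using nc_eq[OF x, of f] by (simp add: ac_simps)
  then have "(\<lambda>f. a f * b f * nc x y f * c f * nc (x \<otimes> y) z f) =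
      (\<lambda>f. a f * (b f * c f * nc y z f) * nc x (y \<otimes> z) f)" by (rule ext)
  then show "u \<otimes>\<^bsub>E\<^esub> v \<otimes>\<^bsub>E\<^esub> w = u \<otimes>\<^bsub>E\<^esub> (v \<otimes>\<^bsub>E\<^esub> w)"
    using x by (simp add: u cover_simps m_assoc)
next
  fix u assume "u \<in> carrier E"
  then obtain a x where u: "u = (a, x)" "\<And>f. a f \<noteq> 0" and x: "x \<in> carrier G" by (auto simp: cover_simps)
  show "\<one>\<^bsub>E\<^esub> \<otimes>\<^bsub>E\<^esub> u = u" using x by (simp add: u cover_simps nc_one)
  have ne: "a f * nc (inv x) x f \<noteq> 0" for f using x u(2) nc_nonzero by simp
  then have "inverse (a f * nc (inv x) x f) * a f * nc (inv x) x f = 1" for f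
    by (metis left_inverse mult.assoc)
  then show "\<exists>v\<in>carrier E. v \<otimes>\<^bsub>E\<^esub> u = \<one>\<^bsub>E\<^esub>"
    using x ne by (intro bexI[of _ "(\<lambda>f. inverse (a f * nc (inv x) x f), inv x)"])
      (simp_all add: u(1) cover_simps del: inverse_mult_distrib)
qed

lemma cover_epi: "group_epi E G snd"
proof -
  have "snd \<in> hom E G" by (intro homI) (auto simp: cover_simps)
  moreover have "snd ` carrier E = carrier G"
  proof
    show "carrier G \<subseteq> snd ` carrier E"
    proof
      fix x assume "x \<in> carrier G"
      then have "(\<lambda>_. 1, x) \<in> carrier E" by (simp add: cover_simps)
      then show "x \<in> snd ` carrier E" by (metis image_eqI snd_conv)
    qed
  qed (auto simp: cover_simps)
  ultimately show ?thesis
    using group_cover is_group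
    by (simp add: group_epi_def group_epi_axioms_def group_hom_def group_hom_axioms_def)
qed

lemma cover_kernel: "kernel E G snd = {(a, x). (\<forall>f. a f \<noteq> 0) \<and> x = \<one>}"
  by (auto simp: kernel_def cover_simps)

lemma cover_central_epi: "central_epi E G snd"
proof -
  have "kernel E G snd \<subseteq> center E"
  proof
    fix u assume "u \<in> kernel E G snd"
    then obtain a where u: "u = (a, \<one>)" "\<And>f. a f \<noteq> 0" by (auto simp: cover_kernel)
    have "u \<otimes>\<^bsub>E\<^esub> v = v \<otimes>\<^bsub>E\<^esub> u" if "v \<in> carrier E" for v
      using that u by (auto simp: cover_simps nc_one mult.commute)
    moreover have "u \<in> carrier E" using u by (simp add: cover_simps)
    ultimately show "u \<in> center E" by (simp add: center_def)
  qed
  then show ?thesis using cover_epi by (simp add: central_epi_def central_epi_axioms_def)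
qed

lemma cover_commutator:
  assumes u: "(a, x) \<in> carrier E" and v: "(b, y) \<in> carrier E" and xy: "x \<otimes> y = y \<otimes> x"
    and sym: "\<And>f. f \<in> cocycles2 G complex_units \<Longrightarrow> f (x, y) = f (y, x)"
  shows "commutator E (a, x) (b, y) = \<one>\<^bsub>E\<^esub>"
proof -
  have "nc x y f = nc y x f" for f using sym by (simp add: norm_cocycle_def)
  then have "(a, x) \<otimes>\<^bsub>E\<^esub> (b, y) = (b, y) \<otimes>\<^bsub>E\<^esub> (a, x)"
    using xy by (simp add: cover_simps mult.commute)
  then show ?thesis by (simp only: group.commutator_eq_one_iff[OF group_cover u v])
qed

text \<open>Trivial restriction makes f a coboundary on \<open>K\<close>, and h(l) h(kl)^-1 h(k) is
  symmetric because \<open>K\<close> is abelian. Consequently the preimage of \<open>K\<close> in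
  the extension is abelian.\<close>

lemma restriction_trivial_imp_symmetric:
  assumes K: "subgroup K G" and ab: "\<And>k l. k \<in> K \<Longrightarrow> l \<in> K \<Longrightarrow> k \<otimes> l = l \<otimes> k"
    and res: "\<forall>c\<in>carrier (schur_multiplier G).
       schur_res G K c = \<one>\<^bsub>schur_multiplier (G\<lparr>carrier := K\<rparr>)\<^esub>"
    and f: "f \<in> cocycles2 G complex_units" and k: "k \<in> K" "l \<in> K"
  shows "f (k, l) = f (l, k)"
proof -
  let ?K = "G\<lparr>carrier := K\<rparr>"
  let ?Z = "cocycle_group2 ?K complex_units" and ?B = "coboundaries2 ?K complex_units"
  note A = comm_group_complex_units
  have gK: "group ?K" using K by (rule subgroup_imp_group)
  interpret Z: comm_group ?Z using gK A by (rule comm_group_cocycle_group2)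
  have B: "subgroup ?B ?Z" using gK A by (rule subgroup_coboundaries2)
  let ?c = "coboundaries2 G complex_units #>\<^bsub>cocycle_group2 G complex_units\<^esub> f"
  have "?c \<in> carrier (schur_multiplier G)"
    using f by (auto simp: schur_multiplier_def cohomology2_def carrier_FactGroup cocycle_group2_def)
  then have "?B #>\<^bsub>?Z\<^esub> restrict f (K \<times> K) = ?B"
    using res cohomology2_res_coset(2)[OF is_group A K f]
    by (simp add: schur_res_def schur_multiplier_def cohomology2_def)
  moreover have "restrict f (K \<times> K) \<in> carrier ?Z"
    using cohomology2_res_coset(1)[OF is_group A K f] by (simp add: cocycle_group2_def)
  ultimately have "restrict f (K \<times> K) \<in> ?B" using Z.rcos_self[OF _ B] by metis
  then obtain h where h: "h \<in> K \<rightarrow> carrier complex_units" "restrict f (K \<times> K) = coboundary2 ?K complex_units h"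
    by (auto simp: coboundaries2_def)
  have f_eq: "f (x, y) = h y * inv\<^bsub>complex_units\<^esub> h (x \<otimes> y) * h x" if "x \<in> K" "y \<in> K" for x y
    using fun_cong[OF h(2), of "(x, y)"] that by (simp add: coboundary2_def)
  show ?thesis unfolding f_eq[OF k] f_eq[OF k(2,1)] ab[OF k] by simp
qed

text \<open>Evaluation at f divided by evaluation at f' is a character of the kernel, trivial where
  the kernel meets [E, E]. It extends to \<open>E\<close>, and the extension along the section x
  \<mapsto> (1, x) is a cochain whose coboundary relates f to f'.\<close>

lemma cohomologous_if_agree:
  assumes fin: "finite (carrier G)"
    and f: "f \<in> cocycles2 G complex_units" and f': "f' \<in> cocycles2 G complex_units"
    and agree: "\<And>e. e \<in> derived E (carrier E) \<Longrightarrow> snd e = \<one> \<Longrightarrow> fst e f = fst e f'"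
  shows "coboundaries2 G complex_units #>\<^bsub>cocycle_group2 G complex_units\<^esub> f =
    coboundaries2 G complex_units #>\<^bsub>cocycle_group2 G complex_units\<^esub> f'"
proof -
  interpret c: central_epi E G snd by (rule cover_central_epi)
  let ?A = "kernel E G snd"
  define \<mu> where "\<mu> e = fst e f / fst e f'" for e :: "(('a \<times> 'a \<Rightarrow> complex) \<Rightarrow> complex) \<times> 'a"
  have \<mu>: "character_on E ?A \<mu>"
    unfolding character_on_def cover_kernel \<mu>_def by (auto simp: cover_simps nc_one)
  have triv: "\<mu> e = 1" if "e \<in> ?A" "e \<in> derived E (carrier E)" for e
    using agree[OF that(2)] that(1) by (auto simp: \<mu>_def cover_kernel)
  \<comment> \<open>The section has finitely many values, each torsion modulo the kernel, and
    together with the kernel they generate \<open>E\<close>; this is what the extension of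
    characters asks for.\<close>
  let ?s = "\<lambda>x. (\<lambda>_::'a \<times> 'a \<Rightarrow> complex. 1::complex, x)"
  have sc: "?s x \<in> carrier E" if "x \<in> carrier G" for x using that by (simp add: cover_simps)
  let ?S = "?s ` carrier G"
  have S: "finite ?S" "?S \<subseteq> carrier E" using fin sc by auto
  have tors: "\<exists>k>0. e [^]\<^bsub>E\<^esub> (k::nat) \<in> ?A" if "e \<in> ?S" for e
  proof -
    have ec: "e \<in> carrier E" using that S by blast
    then have "snd (e [^]\<^bsub>E\<^esub> order G) = snd e [^] order G" by (rule c.hom_nat_pow)
    also have "\<dots> = \<one>" using c.hom_closed[OF ec] by (rule pow_order_eq_1)
    finally have "e [^]\<^bsub>E\<^esub> order G \<in> ?A" using ec by (simp add: kernel_def)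
    then show ?thesis using fin order_gt_0_iff_finite by blast
  qed
  have gen: "generate E (?A \<union> ?S) = carrier E"
  proof
    have sub: "?A \<union> ?S \<subseteq> carrier E" using S by (auto simp: kernel_def)
    show "generate E (?A \<union> ?S) \<subseteq> carrier E" using sub by (rule c.G.generate_incl)
    show "carrier E \<subseteq> generate E (?A \<union> ?S)"
    proof
      fix e assume "e \<in> carrier E"
      then obtain a x where e: "e = (a, x)" "\<And>f. a f \<noteq> 0" "x \<in> carrier G" by (auto simp: cover_simps)
      have "e = (a, \<one>) \<otimes>\<^bsub>E\<^esub> ?s x" using e by (simp add: cover_simps nc_one)
      moreover have "(a, \<one>) \<in> generate E (?A \<union> ?S)" using e by (intro generate.incl) (simp add: cover_kernel)
      moreover have "?s x \<in> generate E (?A \<union> ?S)" using e by (intro generate.incl) simp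
      ultimately show "e \<in> generate E (?A \<union> ?S)" using generate.eng by metis
    qed
  qed
  obtain \<chi> where \<chi>: "character_on E (carrier E) \<chi>" "\<And>a. a \<in> ?A \<Longrightarrow> \<chi> a = \<mu> a"
    using c.G.extend_central_character[OF c.subgroup_kernel c.kernel_central \<mu> triv S tors gen] by blast
  \<comment> \<open>The constant in front restores the values at (1, 1) that
    \<open>norm_cocycle\<close> divides out.\<close>
  define h where "h x = f (\<one>, \<one>) / f' (\<one>, \<one>) * \<chi> (?s x)" for x
  have f1: "f (\<one>, \<one>) \<noteq> 0" "f' (\<one>, \<one>) \<noteq> 0" using cocycle_nonzero f f' by auto
  have h0: "h x \<noteq> 0" if "x \<in> carrier G" for x
    using f1 character_on_nonzero[OF \<chi>(1) sc[OF that]] by (simp add: h_def)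
  have eq: "f (x, y) = h y * inverse (h (x \<otimes> y)) * h x * f' (x, y)" if xy: "x \<in> carrier G" "y \<in> carrier G" for x y
  proof -
    have a: "(nc x y, \<one>) \<in> ?A" using nc_nonzero[OF xy] by (simp add: cover_kernel)
    then have ac: "(nc x y, \<one>) \<in> carrier E" by (simp add: kernel_def)
    have "?s x \<otimes>\<^bsub>E\<^esub> ?s y = (nc x y, \<one>) \<otimes>\<^bsub>E\<^esub> ?s (x \<otimes> y)"
      using xy by (simp add: cover_simps nc_one)
    then have "\<chi> (?s x) * \<chi> (?s y) = \<mu> (nc x y, \<one>) * \<chi> (?s (x \<otimes> y))"
      using character_on_mult[OF \<chi>(1) sc[OF xy(1)] sc[OF xy(2)]]
        character_on_mult[OF \<chi>(1) ac sc[of "x \<otimes> y"]] \<chi>(2)[OF a] xy by simp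
    moreover have "\<mu> (nc x y, \<one>) = (f (x, y) / f (\<one>, \<one>)) / (f' (x, y) / f' (\<one>, \<one>))"
      using f f' by (simp add: \<mu>_def norm_cocycle_def)
    ultimately show ?thesis
      using f1 cocycle_nonzero[OF f' xy] character_on_nonzero[OF \<chi>(1) sc[of "x \<otimes> y"]] xy
      by (simp add: h_def field_simps)
  qed
  have hc: "h \<in> carrier G \<rightarrow> carrier complex_units" using h0 by simp
  have "f = coboundary2 G complex_units h \<otimes>\<^bsub>cocycle_group2 G complex_units\<^esub> f'"
  proof
    fix z :: "'a \<times> 'a"
    show "f z = (coboundary2 G complex_units h \<otimes>\<^bsub>cocycle_group2 G complex_units\<^esub> f') z"
    proof (cases "z \<in> carrier G \<times> carrier G")
      case True
      then show ?thesis
        using eq h0 by (auto simp: cocycle_group2_def coboundary2_def)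
    next
      case False
      then show ?thesis using f by (cases z) (auto simp: cocycle_group2_def cocycles2_def PiE_iff extensional_def)
    qed
  qed
  then have mem: "f \<in> coboundaries2 G complex_units #>\<^bsub>cocycle_group2 G complex_units\<^esub> f'"
    using hc unfolding r_coset_def coboundaries2_def by blast
  interpret ZG: comm_group "cocycle_group2 G complex_units"
    using is_group comm_group_complex_units by (rule comm_group_cocycle_group2)
  show ?thesis
    using ZG.repr_independence[OF mem _ subgroup_coboundaries2[OF is_group comm_group_complex_units]] f'
    by (simp add: cocycle_group2_def)
qed

text \<open>Projecting [E, E] onto [G, G] leaves the kernel \<open>D0\<close>, the part of A inside
  [E, E]. A cohomology class is sent to evaluation at a chosen representative, a character of
  \<open>D0\<close>; this is injective by \<open>cohomologous_if_agree\<close>, and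
  \<open>D0\<close> has at most \<open>card D0\<close> characters.\<close>

lemma card_derived_times_schur_le:
  assumes fin: "finite (carrier G)" and finD: "finite (derived E (carrier E))"
  shows "card (derived G (carrier G)) * order (schur_multiplier G) \<le> card (derived E (carrier E))"
proof -
  interpret c: central_epi E G snd by (rule cover_central_epi)
  let ?D = "derived E (carrier E)" and ?B = "coboundaries2 G complex_units"
  let ?Z = "cocycle_group2 G complex_units"
  let ?E' = "E\<lparr>carrier := ?D\<rparr>"
  have sD: "subgroup ?D E" by (rule c.G.derived_is_subgroup) simp
  have "snd \<in> hom ?E' G"
    using c.hom_closed c.hom_mult subgroup.mem_carrier[OF sD] by (intro homI) simp_all
  then interpret h: group_hom ?E' G snd
    using c.G.subgroup_imp_group[OF sD] is_group by (simp add: group_hom_def group_hom_axioms_def)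
  define D0 where "D0 = kernel ?E' G snd"
  have D0: "D0 = {e \<in> ?D. snd e = \<one>}" by (simp add: D0_def kernel_def)
  have img: "snd ` carrier ?E' = derived G (carrier G)"
    using c.derived_img[of "carrier E"] c.surj by simp
  have cardD: "card (derived G (carrier G)) * card D0 = card ?D"
    using h.card_image_kernel finD img by (simp add: order_def D0_def)
  have D0E: "D0 \<subseteq> center E"
    using c.kernel_central subgroup.subset[OF sD] by (auto simp: D0 kernel_def)
  have sD0: "subgroup D0 E"
    unfolding D0_def using c.G.incl_subgroup[OF sD h.subgroup_kernel] .
  have grp0: "comm_group (E\<lparr>carrier := D0\<rparr>)"
  proof (rule group.group_comm_groupI)
    show "group (E\<lparr>carrier := D0\<rparr>)" using sD0 by (rule c.G.subgroup_imp_group)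
    fix x y assume "x \<in> carrier (E\<lparr>carrier := D0\<rparr>)" "y \<in> carrier (E\<lparr>carrier := D0\<rparr>)"
    then have "x \<in> center E" "y \<in> center E" using D0E by auto
    then show "x \<otimes>\<^bsub>E\<lparr>carrier := D0\<rparr>\<^esub> y = y \<otimes>\<^bsub>E\<lparr>carrier := D0\<rparr>\<^esub> x"
      using c.G.center_comm c.G.center_closed by simp
  qed
  interpret D0: comm_group "E\<lparr>carrier := D0\<rparr>" by (rule grp0)
  have fin0: "finite D0" using finD by (simp add: D0)
  have gen0: "generate (E\<lparr>carrier := D0\<rparr>) D0 = D0"
    using D0.generateI[OF D0.subgroup_self, of D0] by simp
  have chars: "finite (characters (E\<lparr>carrier := D0\<rparr>) D0)" "card (characters (E\<lparr>carrier := D0\<rparr>) D0) \<le> card D0"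
    using D0.card_characters_generate[of D0] fin0 gen0 by simp_all
  have rep: "\<exists>f. f \<in> cocycles2 G complex_units \<and> c = ?B #>\<^bsub>?Z\<^esub> f" if "c \<in> carrier (schur_multiplier G)" for c
    using that by (auto simp: schur_multiplier_def cohomology2_def carrier_FactGroup cocycle_group2_def)
  \<comment> \<open>Any representative will do, as only an injection of sets into the characters is
    wanted.\<close>
  define R where "R c = (SOME f. f \<in> cocycles2 G complex_units \<and> c = ?B #>\<^bsub>?Z\<^esub> f)" for c
  have R: "R c \<in> cocycles2 G complex_units" "c = ?B #>\<^bsub>?Z\<^esub> R c" if "c \<in> carrier (schur_multiplier G)" for c
    using someI_ex[OF rep[OF that]] unfolding R_def by auto
  let ?f = "\<lambda>c. \<lambda>e\<in>D0. fst e (R c)"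
  have "inj_on ?f (carrier (schur_multiplier G))"
  proof (rule inj_onI)
    fix c c' assume cc: "c \<in> carrier (schur_multiplier G)" "c' \<in> carrier (schur_multiplier G)" and eq: "?f c = ?f c'"
    have "fst e (R c) = fst e (R c')" if "e \<in> derived E (carrier E)" "snd e = \<one>" for e
      using fun_cong[OF eq, of e] that by (simp add: D0)
    then have "?B #>\<^bsub>?Z\<^esub> R c = ?B #>\<^bsub>?Z\<^esub> R c'"
      using R[OF cc(1)] R[OF cc(2)] by (intro cohomologous_if_agree fin) auto
    then show "c = c'" using R(2)[OF cc(1)] R(2)[OF cc(2)] by simp
  qed
  moreover have "?f ` carrier (schur_multiplier G) \<subseteq> characters (E\<lparr>carrier := D0\<rparr>) D0"
  proof
    fix \<chi> assume "\<chi> \<in> ?f ` carrier (schur_multiplier G)"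
    then obtain g where \<chi>: "\<chi> = (\<lambda>e\<in>D0. fst e g)" by blast
    have "e \<otimes>\<^bsub>E\<^esub> e' \<in> D0 \<and> fst (e \<otimes>\<^bsub>E\<^esub> e') g = fst e g * fst e' g \<and> fst e g \<noteq> 0" if e: "e \<in> D0" "e' \<in> D0" for e e'
    proof -
      have "e \<in> carrier E" "e' \<in> carrier E" using e subgroup.subset[OF sD0] by auto
      moreover have "snd e = \<one>" "snd e' = \<one>" using e by (simp_all add: D0)
      ultimately obtain a a' where "e = (a, \<one>)" "e' = (a', \<one>)" "\<And>f. a f \<noteq> 0"
        by (cases e; cases e') (auto simp: cover_simps)
      then show ?thesis using subgroup.m_closed[OF sD0 e] by (simp add: cover_simps nc_one)
    qed
    then show "\<chi> \<in> characters (E\<lparr>carrier := D0\<rparr>) D0"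
      unfolding \<chi> by (simp add: characters_def character_on_def)
  qed
  ultimately have "order (schur_multiplier G) \<le> card D0"
    using card_inj_on_le[of ?f] chars unfolding order_def by (meson order_trans)
  then have "card (derived G (carrier G)) * order (schur_multiplier G) \<le> card (derived G (carrier G)) * card D0"
    by (rule mult_le_mono2)
  then show ?thesis using cardD by simp
qed

end


section \<open>Nilpotency class and the passage to real exponents\<close>

lemma (in group) nilpotency_class_le_2:
  assumes "derived G (carrier G) \<subseteq> center G" shows "nilpotency_class G \<le> 2"
proof -
  have eq: "commutator_subgroup G (derived G (carrier G)) (carrier G) = {\<one>}"
  proof -
    let ?S = "{commutator G x y |x y. x \<in> derived G (carrier G) \<and> y \<in> carrier G}"
    have "?S \<subseteq> {\<one>}" using assms center_commutator by blast
    then have "generate G ?S \<subseteq> {\<one>}" by (rule generate_subgroup_incl[OF _ triv_subgroup])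
    then show ?thesis unfolding commutator_subgroup_eq using generate.one by blast
  qed
  have "lower_central G 2 = {\<one>}"
    using eq lower_central_1[of G] by (simp add: numeral_2_eq_2)
  then show ?thesis unfolding nilpotency_class_def by (rule Least_le)
qed

lemma derived_bound_powr:
  fixes p d m r t :: nat
  assumes p: "1 < p" and d: "0 < d" and r: "0 < r" and m: "2 + r \<le> m"
    and t: "t\<^sup>2 \<le> (p ^ (m - r)) ^ (d - 1)"
  shows "real ((p ^ d) ^ (r - 1) * p\<^sup>2 * t) \<le> real p powr (1 / 2 * real d * (real m + real r - 2) + 1)"
proof -
  let ?e = "1 / 2 * real ((m - r) * (d - 1))"
  have p1: "1 < real p" using p by simp
  have "real t = sqrt (real (t\<^sup>2))" by simp
  also have "\<dots> \<le> sqrt (real ((p ^ (m - r)) ^ (d - 1)))" using t by (intro real_sqrt_le_mono) (simp only: of_nat_le_iff)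
  also have "\<dots> = real p powr ?e"
  proof -
    have "real ((p ^ (m - r)) ^ (d - 1)) = real p powr real ((m - r) * (d - 1))"
      using p1 by (subst powr_realpow) (simp_all add: power_mult)
    then show ?thesis using p1 by (simp add: powr_half_sqrt[symmetric] powr_powr)
  qed
  finally have t': "real t \<le> real p powr ?e" .
  have pw: "real ((p ^ d) ^ (r - 1) * p\<^sup>2) = real p powr real (d * (r - 1) + 2)"
  proof -
    have "real ((p ^ d) ^ (r - 1) * p\<^sup>2) = real p ^ (d * (r - 1) + 2)"
      by (simp only: of_nat_mult of_nat_power power_add power_mult)
    then show ?thesis using p1 powr_realpow[of "real p" "d * (r - 1) + 2"] by simp
  qed
  have "real ((p ^ d) ^ (r - 1) * p\<^sup>2 * t) = real ((p ^ d) ^ (r - 1) * p\<^sup>2) * real t" by simp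
  also have "\<dots> \<le> real p powr real (d * (r - 1) + 2) * real p powr ?e"
    unfolding pw using t' by (intro mult_left_mono) auto
  also have "\<dots> = real p powr (real (d * (r - 1) + 2) + ?e)" by (simp add: powr_add)
  also have "\<dots> \<le> real p powr (1 / 2 * real d * (real m + real r - 2) + 1)"
  proof (rule powr_mono)
    have "real (d * (r - 1) + 2) + ?e = real d * (real r - 1) + 2 + 1 / 2 * ((real m - real r) * (real d - 1))"
      using d r m by (simp add: of_nat_diff)
    \<comment> \<open>The excess over the claimed exponent is 1 - (m - r)/2, which is at most 0
      exactly because m - r is at least 2.\<close>
    also have "\<dots> = 1 / 2 * real d * (real m + real r - 2) + 1 + (1 - (real m - real r) / 2)"
      by (simp add: field_simps)
    also have "\<dots> \<le> 1 / 2 * real d * (real m + real r - 2) + 1" using m by simp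
    finally show "real (d * (r - 1) + 2) + ?e \<le> 1 / 2 * real d * (real m + real r - 2) + 1" .
  qed (use p1 in simp)
  finally show ?thesis .
qed

theorem theorem1p4:
  fixes G :: "('a, 'b) monoid_scheme" and K :: "'a set" and p m r :: nat
  assumes "Factorial_Ring.prime p"
    and "group G"
    and "\<exists>n. order G = p ^ n"
    and "nilpotency_class G \<ge> 3"
    and "subgroup K G"
    and "\<forall>k\<in>K. \<forall>g\<in>carrier G. k \<otimes>\<^bsub>G\<^esub> g = g \<otimes>\<^bsub>G\<^esub> k"
    and "\<forall>c\<in>carrier (schur_multiplier G).
           schur_res G K c = \<one>\<^bsub>schur_multiplier (G\<lparr>carrier := K\<rparr>)\<^esub>"
    and "order (G Mod K) = p ^ m"
    and "order (G\<lparr>carrier := derived G (carrier G) <#>\<^bsub>G\<^esub> K\<rparr> Mod K) = p ^ r"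
  shows "real (card (derived G (carrier G)) * order (schur_multiplier G))
           \<le> real (order (tensor_product (abelianization (G Mod K)) (G\<lparr>carrier := K\<rparr>)))
               * real p powr (1 / 2 * real (min_generators (G Mod K)) * (real m + real r - 2) + 1)
       \<and> real (card (derived G (carrier G)) * order (schur_multiplier G))
           \<le> real (order (tensor_product (abelianization (G Mod K)) (G\<lparr>carrier := K\<rparr>)))
               * real p powr (1 / 2 * (real m - real r) * (real m + real r - 2) + 1)"
proof -
  interpret G: group G by fact
  have p1: "1 < p" using assms(1) by (rule prime_gt_1_nat)
  have fin: "finite (carrier G)"
    using assms(3) p1 G.order_gt_0_iff_finite by (metis less_trans zero_less_one zero_less_power)
  have KZ: "K \<subseteq> center G" using assms(6) subgroup.subset[OF assms(5)] by (auto simp: center_def)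
  have Kn: "K \<lhd> G" using assms(5) KZ by (rule G.central_subgroup_normal)
  interpret K: normal K G by (rule Kn)
  interpret Q: group "G Mod K" by (rule K.factorgroup_is_group)
  interpret q: group_hom G "G Mod K" "\<lambda>x. K #>\<^bsub>G\<^esub> x"
    using K.r_coset_hom_Mod by (simp add: group_hom_def group_hom_axioms_def Q.group_axioms)
  let ?Q = "G Mod K" and ?D = "derived G (carrier G)"
  let ?DQ = "derived (G Mod K) (carrier (G Mod K))"
  have DQ: "?DQ = (\<lambda>x. K #>\<^bsub>G\<^esub> x) ` ?D"
    using q.derived_img[of "carrier G"] by (simp add: carrier_FactGroup)
  have DG: "?D \<subseteq> carrier G" by (rule G.derived_in_carrier) simp
  \<comment> \<open>The quotient in the hypothesis has the same cosets as the image of [G, G] in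
    \<open>?Q\<close>, which is the derived subgroup of \<open>?Q\<close>.\<close>
  have cDQ: "card ?DQ = p ^ r"
  proof -
    have "carrier (G\<lparr>carrier := ?D <#>\<^bsub>G\<^esub> K\<rparr> Mod K) = (\<lambda>x. K #>\<^bsub>G\<^esub> x) ` (?D <#>\<^bsub>G\<^esub> K)"
      by (simp add: carrier_FactGroup)
    also have "\<dots> = (\<lambda>x. K #>\<^bsub>G\<^esub> x) ` ?D"
    proof -
      have "K #>\<^bsub>G\<^esub> (d \<otimes>\<^bsub>G\<^esub> k) = K #>\<^bsub>G\<^esub> d" if "d \<in> ?D" "k \<in> K" for d k
      proof -
        have "d \<in> carrier G" using that DG by blast
        moreover have "K #>\<^bsub>G\<^esub> k = K" using that K.rcos_eq_self_iff by simp
        ultimately show ?thesis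
          using that q.hom_mult[of d k] q.hom_closed[of d] Q.r_one[of "K #>\<^bsub>G\<^esub> d"] by simp
      qed
      then have "(\<lambda>x. K #>\<^bsub>G\<^esub> x) ` (?D <#>\<^bsub>G\<^esub> K) \<subseteq> (\<lambda>x. K #>\<^bsub>G\<^esub> x) ` ?D"
        unfolding set_mult_def by blast
      moreover have "d \<in> ?D <#>\<^bsub>G\<^esub> K" if "d \<in> ?D" for d
      proof -
        have "d \<otimes>\<^bsub>G\<^esub> \<one>\<^bsub>G\<^esub> \<in> ?D <#>\<^bsub>G\<^esub> K" using that K.one_closed unfolding set_mult_def by blast
        moreover have "d \<in> carrier G" using that DG by blast
        ultimately show ?thesis by simp
      qed
      ultimately show ?thesis by blast
    qed
    finally show ?thesis using assms(9) DQ by (simp add: order_def)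
  qed
  \<comment> \<open>For r = 0 the derived subgroup of \<open>G\<close> would lie in
    \<open>K\<close>, hence in the center, and the class would be at most 2.\<close>
  have r0: "0 < r"
  proof (rule ccontr)
    assume "\<not> 0 < r"
    then have "card ?DQ = 1" using cDQ by simp
    then obtain y where "?DQ = {y}" by (rule card_1_singletonE)
    moreover have "K \<in> ?DQ"
      using subgroup.one_closed[OF Q.derived_is_subgroup[of "carrier ?Q"]] by simp
    ultimately have one: "?DQ = {K}" by simp
    have "?D \<subseteq> K"
    proof
      fix d assume d: "d \<in> ?D"
      then have "K #>\<^bsub>G\<^esub> d = K" using DQ one by blast
      then show "d \<in> K" using K.rcos_eq_self_iff[of d] d DG by blast
    qed
    then have "?D \<subseteq> center G" using KZ by (rule order_trans)
    then have "nilpotency_class G \<le> 2" by (rule G.nilpotency_class_le_2)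
    then show False using assms(4) by simp
  qed
  interpret c: central_epi "cocycle_cover G" G snd by (rule G.cover_central_epi)
  have Kab: "k \<otimes>\<^bsub>G\<^esub> l = l \<otimes>\<^bsub>G\<^esub> k" if "k \<in> K" "l \<in> K" for k l
    using assms(6) that K.subset by blast
  have ab: "commutator (cocycle_cover G) x y = \<one>\<^bsub>cocycle_cover G\<^esub>" if "x \<in> c.preim K" "y \<in> c.preim K" for x y
  proof -
    obtain a k b l where xy: "x = (a, k)" "y = (b, l)" by (meson surj_pair)
    then have "(a, k) \<in> carrier (cocycle_cover G)" "(b, l) \<in> carrier (cocycle_cover G)" "k \<in> K" "l \<in> K"
      using that by (simp_all add: c.preim_def)
    then show ?thesis
      unfolding xy using Kab G.restriction_trivial_imp_symmetric[OF assms(5) Kab assms(7)]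
      by (intro G.cover_commutator) auto
  qed
  let ?T = "order (tensor_product (abelianization ?Q) (G\<lparr>carrier := K\<rparr>))"
  let ?L = "card ?D * order (schur_multiplier G)"
  have main: "real ?L \<le> real ?T * real p powr (1 / 2 * real (card S) * (real m + real r - 2) + 1)"
    and rm: "2 + r \<le> m"
    if S: "S \<subseteq> carrier ?Q" "generate ?Q (?DQ \<union> S) = carrier ?Q" for S
  proof -
    obtain t where t: "finite (derived (cocycle_cover G) (carrier (cocycle_cover G)))"
      "card (derived (cocycle_cover G) (carrier (cocycle_cover G))) \<le> ?T * ((p ^ card S) ^ (r - 1) * p\<^sup>2 * t)"
      "t\<^sup>2 \<le> (p ^ (m - r)) ^ (card S - 1)" "2 + r \<le> m"
      using c.card_derived_le[OF assms(1) fin assms(5) KZ ab assms(8) cDQ r0 S] by blast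
    show "2 + r \<le> m" by (rule t(4))
    have "card S \<noteq> 0"
    proof
      assume "card S = 0"
      moreover have "finite (carrier ?Q)" using fin by (simp add: carrier_FactGroup)
      ultimately have "S = {}" using S(1) finite_subset by fastforce
      moreover have "generate ?Q ?DQ = ?DQ"
        using Q.generateI[OF Q.derived_is_subgroup[of "carrier ?Q"], of ?DQ] by simp
      ultimately have "card ?DQ = p ^ m" using S(2) assms(8) by (simp add: order_def)
      then show False using cDQ p1 t(4) by simp
    qed
    then have b: "real ((p ^ card S) ^ (r - 1) * p\<^sup>2 * t) \<le> real p powr (1 / 2 * real (card S) * (real m + real r - 2) + 1)"
      using derived_bound_powr[OF p1 _ r0 t(4,3)] by simp
    have "real ?L \<le> real (?T * ((p ^ card S) ^ (r - 1) * p\<^sup>2 * t))"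
      using G.card_derived_times_schur_le[OF fin t(1)] t(2) by (simp only: of_nat_le_iff)
    also have "\<dots> = real ?T * real ((p ^ card S) ^ (r - 1) * p\<^sup>2 * t)" by (rule of_nat_mult)
    also have "\<dots> \<le> real ?T * real p powr (1 / 2 * real (card S) * (real m + real r - 2) + 1)"
      using b by (rule mult_left_mono) simp
    finally show "real ?L \<le> real ?T * real p powr (1 / 2 * real (card S) * (real m + real r - 2) + 1)" .
  qed
  have finQ: "finite (carrier ?Q)" using fin by (simp add: carrier_FactGroup)
  obtain S where S: "S \<subseteq> carrier ?Q" "card S = min_generators ?Q" "generate ?Q S = carrier ?Q"
    using Q.min_generators_witness[OF finQ] by blast
  have "generate ?Q (?DQ \<union> S) = carrier ?Q"
    using Q.mono_generate[of S "?DQ \<union> S"] Q.generate_incl[of "?DQ \<union> S"] S Q.derived_in_carrier[of "carrier ?Q"] by blast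
  note first = main[OF S(1) this, unfolded S(2)] rm[OF S(1) this]
  obtain S' where S': "S' \<subseteq> carrier ?Q" "card S' \<le> m - r" "generate ?Q (?DQ \<union> S') = carrier ?Q"
    using Q.p_group_generators_over[OF assms(1,8) Q.derived_is_subgroup[of "carrier ?Q"] _ cDQ] by blast
  have "real (card S') * (real m + real r - 2) \<le> (real m - real r) * (real m + real r - 2)"
    using S'(2) first(2) by (intro mult_right_mono) auto
  then have "real p powr (1 / 2 * real (card S') * (real m + real r - 2) + 1)
      \<le> real p powr (1 / 2 * (real m - real r) * (real m + real r - 2) + 1)"
    using p1 by (intro powr_mono) auto
  then have "real ?L \<le> real ?T * real p powr (1 / 2 * (real m - real r) * (real m + real r - 2) + 1)"
    using main[OF S'(1,3)] by (meson mult_left_mono of_nat_0_le_iff order_trans)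
  then show ?thesis using first(1) by blast
qed

end
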